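(* Let $K$ be any field, let $X$ be an uncountable set, and let $E_{\mathcal{F}(X)}$ be the graph of nonempty finite subsets of $X$ (defined in the context). Then the $K$-algebra unitization $\widehat{L_K(E_{\mathcal{F}(X)})}$ is a unital, prime, non-primitive, von Neumann regular ring. In particular, let $\{X_\alpha\mid\alpha\in\mathcal{A}\}$ be a collection of uncountable sets, each of different cardinality. Then the collection $\{\widehat{L_{\mathbb{C}}(E_{\mathcal{F}(X_\alpha)})}\mid\alpha\in\mathcal{A}\}$ consists of pairwise nonisomorphic, unital, prime, non-primitive, von Neumann regular $\mathbb{C}$-algebras.
   Context: A (directed) graph $E=(E^0,E^1,r,s)$ consists of sets $E^0$ (vertices), $E^1$ (edges), of arbitrary cardinality, and functions $r,s:E^1\to E^0$ (range and source). For a nonempty set $X$, let $\mathcal{F}(X)$ be the collection of nonempty finite subsets of $X$. The graph $E_{\mathcal{F}(X)}$ has vertex set $\mathcal{F}(X)$ and edge set $\{e_{A,A'}\mid A,A'\in\mathcal{F}(X),\ A\subsetneq A'\}$, with $s(e_{A,A'})=A$ and $r(e_{A,A'})=A'$. The Leavitt path algebra $L_K(E)$ is the (associative, not necessarily unital) $K$-algebra generated by the set $\{v\mid v\in E^0\}\cup\{e,e^*\mid e\in E^1\}$ subject to the relations: (V) $vw=\delta_{v,w}v$ for $v,w\in E^0$; (E1) $s(e)e=er(e)=e$ for $e\in E^1$; (E2) $r(e)e^*=e^*s(e)=e^*$ for $e\in E^1$; (CK1) $e^*e'=\delta_{e,e'}r(e)$ for $e,e'\in E^1$; (CK2) $v=\sum_{\{e\in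 E^1\mid s(e)=v\}}ee^*$ for every vertex $v$ with $1\le|s^{-1}(v)|<\infty$. For a $K$-algebra $R$ (not necessarily unital), the $K$-algebra unitization of $R$ is $\widehat{R}=K\oplus R$ with coordinatewise addition and $K$-scalar action and multiplication $(k,r)\cdot(l,s)=(kl,ks+lr+rs)$; it has identity $(1,0)$. A ring $R$ (possibly nonunital) is prime if the product of any two nonzero two-sided ideals is nonzero; (left) primitive if it admits a simple faithful left $R$-module; von Neumann regular if for each $a\in R$ there is $x\in R$ with $a=axa$. *)

theory Defs
  imports
    Complex_Main
    "HOL-Library.Poly_Mapping"
    "HOL-Library.Countable_Set"
    "HOL-Library.Equipollence"
    "HOL-Algebra.Ideal_Product"
    "HOL-Algebra.QuotRing"
    "HOL-Algebra.Module"
    "HOL-Algebra.Algebraic_Closure_Type"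
    "Graph_Theory.Digraph"
begin

text \<open>
  A graph \<open>(E\<^sup>0, E\<^sup>1, r, s)\<close> is a \<^typ>\<open>('v, 'e) pre_digraph\<close> satisfying \<^locale>\<open>wf_digraph\<close>:
  the source map \<open>s\<close> is \<^const>\<open>tail\<close> and the range map \<open>r\<close> is \<^const>\<open>head\<close>.
  No finiteness is assumed.
\<close>

definition nonempty_finite_subsets :: "'x set \<Rightarrow> 'x set set" where
  "nonempty_finite_subsets S = {A. A \<subseteq> S \<and> finite A \<and> A \<noteq> {}}"

text \<open>The edge \<open>e\<^bsub>A,A'\<^esub>\<close> is encoded as the pair \<open>(A, A')\<close>.\<close>

definition finite_subset_graph :: "'x set \<Rightarrow> ('x set, 'x set \<times> 'x set) pre_digraph" where
  "finite_subset_graph S =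
     \<lparr>verts = nonempty_finite_subsets S,
      arcs = {(A, A'). A \<in> nonempty_finite_subsets S \<and> A' \<in> nonempty_finite_subsets S \<and> A \<subset> A'},
      tail = fst,
      head = snd\<rparr>"

lemma wf_digraph_finite_subset_graph: "wf_digraph (finite_subset_graph S)"
  by unfold_locales (auto simp: finite_subset_graph_def)

text \<open>
  The ground field \<open>K\<close> is a type of class \<^class>\<open>field\<close>.  A \<open>K\<close>-algebra that need not have an
  identity is a \<^typ>\<open>('k, 'a) module\<close> record whose field \<^const>\<open>monoid.one\<close> is left unspecified
  and is never used.
\<close>

text \<open>
  The two-sided algebra ideal of \<open>A\<close> generated by \<open>S\<close>.  Closure under negation is closure
  under the scalar \<open>-1\<close>; \<open>S\<close> itself has to be included because \<open>A\<close> may lack an identity.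
\<close>

inductive_set alg_ideal_gen :: "('k, 'a) module \<Rightarrow> 'a set \<Rightarrow> 'a set"
  for A :: "('k, 'a) module" (structure) and S :: "'a set" where
  gen: "x \<in> S \<Longrightarrow> x \<in> alg_ideal_gen A S"
| zero: "\<zero> \<in> alg_ideal_gen A S"
| add: "x \<in> alg_ideal_gen A S \<Longrightarrow> y \<in> alg_ideal_gen A S \<Longrightarrow> x \<oplus> y \<in> alg_ideal_gen A S"
| smult: "x \<in> alg_ideal_gen A S \<Longrightarrow> c \<odot> x \<in> alg_ideal_gen A S"
| lmult: "a \<in> carrier A \<Longrightarrow> x \<in> alg_ideal_gen A S \<Longrightarrow> a \<otimes> x \<in> alg_ideal_gen A S"
| rmult: "a \<in> carrier A \<Longrightarrow> x \<in> alg_ideal_gen A S \<Longrightarrow> x \<otimes> a \<in> alg_ideal_gen A S"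

text \<open>
  As \<^const>\<open>FactRing\<close>, with the induced scalar multiplication and without the identity.
\<close>

definition quotient_algebra :: "('k, 'a) module \<Rightarrow> 'a set \<Rightarrow> ('k, 'a set) module" where
  "quotient_algebra A I =
     \<lparr>carrier = a_rcosets\<^bsub>A\<^esub> I, monoid.mult = rcoset_mult A I, one = undefined,
      zero = I, add = set_add A,
      module.smult = (\<lambda>c P. \<Union>x\<in>P. I +>\<^bsub>A\<^esub> (c \<odot>\<^bsub>A\<^esub> x))\<rparr>"

definition unitization :: "('k::field, 'a) module \<Rightarrow> ('k, 'k \<times> 'a) module" where
  "unitization R =
     \<lparr>carrier = UNIV \<times> carrier R,
      monoid.mult = (\<lambda>(k, r) (l, s). (k * l, (k \<odot>\<^bsub>R\<^esub> s \<oplus>\<^bsub>R\<^esub> l \<odot>\<^bsub>R\<^esub> r) \<oplus>\<^bsub>R\<^esub> r \<otimes>\<^bsub>R\<^esub> s)),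
      one = (1, \<zero>\<^bsub>R\<^esub>),
      zero = (0, \<zero>\<^bsub>R\<^esub>),
      add = (\<lambda>(k, r) (l, s). (k + l, r \<oplus>\<^bsub>R\<^esub> s)),
      module.smult = (\<lambda>c (k, r). (c * k, c \<odot>\<^bsub>R\<^esub> r))\<rparr>"

datatype 'g free_word = Word (letters: "'g list")

instantiation free_word :: (type) monoid_add
begin

definition "0 = Word []"

definition "u + v = Word (letters u @ letters v)"

instance
  by standard (simp_all add: zero_free_word_def plus_free_word_def)

end

text \<open>
  With words as exponents, \<^typ>\<open>'g free_word \<Rightarrow>\<^sub>0 'k\<close> is the free unital algebra on \<^typ>\<open>'g\<close> (its
  product is the convolution product) and \<open>Poly_Mapping.single 0 c\<close> is the scalar \<open>c\<close>.  The free
  non-unital algebra on \<open>G\<close> consists of the elements supported on nonempty words over \<open>G\<close>.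
\<close>

definition free_algebra :: "'g set \<Rightarrow> ('k::field, 'g free_word \<Rightarrow>\<^sub>0 'k) module" where
  "free_algebra G =
     \<lparr>carrier = {f. \<forall>w\<in>Poly_Mapping.keys f. letters w \<noteq> [] \<and> set (letters w) \<subseteq> G},
      monoid.mult = (*), one = undefined, zero = 0, add = (+),
      module.smult = (\<lambda>c f. Poly_Mapping.single 0 c * f)\<rparr>"

datatype ('v, 'e) lpa_generator = Vertex 'v | Edge 'e | Ghost 'e

definition lpa_generators :: "('v, 'e) pre_digraph \<Rightarrow> ('v, 'e) lpa_generator set" where
  "lpa_generators E = Vertex ` verts E \<union> Edge ` arcs E \<union> Ghost ` arcs E"

type_synonym ('k, 'v, 'e) lpa_free = "('v, 'e) lpa_generator free_word \<Rightarrow>\<^sub>0 'k"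

definition vertex :: "'v \<Rightarrow> ('k::field, 'v, 'e) lpa_free" where
  "vertex v = Poly_Mapping.single (Word [Vertex v]) 1"

definition edge :: "'e \<Rightarrow> ('k::field, 'v, 'e) lpa_free" where
  "edge e = Poly_Mapping.single (Word [Edge e]) 1"

definition ghost :: "'e \<Rightarrow> ('k::field, 'v, 'e) lpa_free" where
  "ghost e = Poly_Mapping.single (Word [Ghost e]) 1"

text \<open>A relation \<open>a = b\<close> is recorded as the element \<open>a - b\<close>.\<close>

inductive_set lpa_relations :: "('v, 'e) pre_digraph \<Rightarrow> ('k::field, 'v, 'e) lpa_free set"
  for E :: "('v, 'e) pre_digraph" where
  V: "v \<in> verts E \<Longrightarrow> w \<in> verts E \<Longrightarrow>
        vertex v * vertex w - (if v = w then vertex v else 0) \<in> lpa_relations E"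
| E1_source: "e \<in> arcs E \<Longrightarrow> vertex (tail E e) * edge e - edge e \<in> lpa_relations E"
| E1_range: "e \<in> arcs E \<Longrightarrow> edge e * vertex (head E e) - edge e \<in> lpa_relations E"
| E2_range: "e \<in> arcs E \<Longrightarrow> vertex (head E e) * ghost e - ghost e \<in> lpa_relations E"
| E2_source: "e \<in> arcs E \<Longrightarrow> ghost e * vertex (tail E e) - ghost e \<in> lpa_relations E"
| CK1: "e \<in> arcs E \<Longrightarrow> e' \<in> arcs E \<Longrightarrow>
        ghost e * edge e' - (if e = e' then vertex (head E e) else 0) \<in> lpa_relations E"
| CK2: "v \<in> verts E \<Longrightarrow> finite (out_arcs E v) \<Longrightarrow> out_arcs E v \<noteq> {} \<Longrightarrow>
        vertex v - (\<Sum>e\<in>out_arcs E v. edge e * ghost e) \<in> lpa_relations E"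

definition leavitt_path_algebra ::
    "('v, 'e) pre_digraph \<Rightarrow> ('k::field, ('k, 'v, 'e) lpa_free set) module" where
  "leavitt_path_algebra E =
     quotient_algebra (free_algebra (lpa_generators E))
       (alg_ideal_gen (free_algebra (lpa_generators E)) (lpa_relations E))"

definition prime_ring :: "('a, 'r) ring_scheme \<Rightarrow> bool" where
  "prime_ring R \<longleftrightarrow>
     (\<forall>I J. ideal I R \<longrightarrow> ideal J R \<longrightarrow> I \<noteq> {\<zero>\<^bsub>R\<^esub>} \<longrightarrow> J \<noteq> {\<zero>\<^bsub>R\<^esub>} \<longrightarrow>
        ideal_prod R I J \<noteq> {\<zero>\<^bsub>R\<^esub>})"

definition von_neumann_regular :: "('a, 'r) ring_scheme \<Rightarrow> bool" where
  "von_neumann_regular R \<longleftrightarrow>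
     (\<forall>a\<in>carrier R. \<exists>x\<in>carrier R. a = a \<otimes>\<^bsub>R\<^esub> x \<otimes>\<^bsub>R\<^esub> a)"

text \<open>
  Left modules over a possibly noncommutative, possibly nonunital ring; the library locale
  \<^locale>\<open>module\<close> is restricted to commutative rings.  Only the additive part of the
  \<^typ>\<open>('a, 'm) module\<close> record and its scalar multiplication are used.
\<close>

locale left_module = M: abelian_group M
  for R :: "('a, 'r) ring_scheme" and M :: "('a, 'm) module" +
  assumes smult_closed: "\<lbrakk>r \<in> carrier R; x \<in> carrier M\<rbrakk> \<Longrightarrow> r \<odot>\<^bsub>M\<^esub> x \<in> carrier M"
    and smult_l_distr: "\<lbrakk>r \<in> carrier R; s \<in> carrier R; x \<in> carrier M\<rbrakk> \<Longrightarrow>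
      (r \<oplus>\<^bsub>R\<^esub> s) \<odot>\<^bsub>M\<^esub> x = r \<odot>\<^bsub>M\<^esub> x \<oplus>\<^bsub>M\<^esub> s \<odot>\<^bsub>M\<^esub> x"
    and smult_r_distr: "\<lbrakk>r \<in> carrier R; x \<in> carrier M; y \<in> carrier M\<rbrakk> \<Longrightarrow>
      r \<odot>\<^bsub>M\<^esub> (x \<oplus>\<^bsub>M\<^esub> y) = r \<odot>\<^bsub>M\<^esub> x \<oplus>\<^bsub>M\<^esub> r \<odot>\<^bsub>M\<^esub> y"
    and smult_assoc: "\<lbrakk>r \<in> carrier R; s \<in> carrier R; x \<in> carrier M\<rbrakk> \<Longrightarrow>
      (r \<otimes>\<^bsub>R\<^esub> s) \<odot>\<^bsub>M\<^esub> x = r \<odot>\<^bsub>M\<^esub> (s \<odot>\<^bsub>M\<^esub> x)"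

definition submodule_of :: "'m set \<Rightarrow> ('a, 'r) ring_scheme \<Rightarrow> ('a, 'm) module \<Rightarrow> bool" where
  "submodule_of N R M \<longleftrightarrow>
     additive_subgroup N M \<and> (\<forall>r\<in>carrier R. \<forall>x\<in>N. r \<odot>\<^bsub>M\<^esub> x \<in> N)"

text \<open>
  Simplicity includes \<open>RM \<noteq> 0\<close>, as usual for rings without identity.  If \<open>R\<close> has an identity,
  a simple module in this sense is automatically unital.
\<close>

definition simple_module :: "('a, 'r) ring_scheme \<Rightarrow> ('a, 'm) module \<Rightarrow> bool" where
  "simple_module R M \<longleftrightarrow>
     left_module R M \<and>
     (\<exists>r\<in>carrier R. \<exists>x\<in>carrier M. r \<odot>\<^bsub>M\<^esub> x \<noteq> \<zero>\<^bsub>M\<^esub>) \<and>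
     (\<forall>N. submodule_of N R M \<longrightarrow> N = {\<zero>\<^bsub>M\<^esub>} \<or> N = carrier M)"

definition faithful_module :: "('a, 'r) ring_scheme \<Rightarrow> ('a, 'm) module \<Rightarrow> bool" where
  "faithful_module R M \<longleftrightarrow>
     (\<forall>r\<in>carrier R. (\<forall>x\<in>carrier M. r \<odot>\<^bsub>M\<^esub> x = \<zero>\<^bsub>M\<^esub>) \<longrightarrow> r = \<zero>\<^bsub>R\<^esub>)"

text \<open>
  Left primitivity witnessed by a module whose elements have type \<^typ>\<open>'m\<close>.  HOL cannot quantify
  over types inside a formula, but a theorem asserting the negation for an arbitrary type
  \<^typ>\<open>'m\<close> excludes simple faithful modules altogether.
\<close>

definition left_primitive :: "'m itself \<Rightarrow> ('a, 'r) ring_scheme \<Rightarrow> bool" where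
  "left_primitive (_ :: 'm itself) R \<longleftrightarrow>
     (\<exists>M :: ('a, 'm) module. simple_module R M \<and> faithful_module R M)"

text \<open>
  The locale \<^locale>\<open>algebra\<close> of the library is restricted to commutative algebras.
\<close>

definition unital_algebra :: "('k::field, 'a) module \<Rightarrow> bool" where
  "unital_algebra A \<longleftrightarrow>
     ring A \<and> module (ring_of_type_algebra :: 'k ring) A \<and>
     (\<forall>c. \<forall>x\<in>carrier A. \<forall>y\<in>carrier A.
        (c \<odot>\<^bsub>A\<^esub> x) \<otimes>\<^bsub>A\<^esub> y = c \<odot>\<^bsub>A\<^esub> (x \<otimes>\<^bsub>A\<^esub> y) \<and>
        x \<otimes>\<^bsub>A\<^esub> (c \<odot>\<^bsub>A\<^esub> y) = c \<odot>\<^bsub>A\<^esub> (x \<otimes>\<^bsub>A\<^esub> y))"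

definition algebra_isomorphic :: "('k::field, 'a) module \<Rightarrow> ('k, 'b) module \<Rightarrow> bool" where
  "algebra_isomorphic A B \<longleftrightarrow>
     (\<exists>h\<in>ring_iso A B. \<forall>c. \<forall>x\<in>carrier A. h (c \<odot>\<^bsub>A\<^esub> x) = c \<odot>\<^bsub>B\<^esub> h x)"

end

theory Submission
  imports Defs
begin

text \<open>
  For infinite \<open>X\<close> every vertex of the graph of nonempty finite subsets emits infinitely many edges.
  Hence relation (CK2) never applies, and the Leavitt path algebra has the basis \<open>p q\<^sup>*\<close>, where \<open>p\<close> and
  \<open>q\<close> are paths with the same end, that is, strictly increasing chains of finite sets with the same
  last member.  The proof realizes \<open>p q\<^sup>*\<close> as the operator \<open>shift p q\<close> on functions of words which
  exchanges the prefixes \<open>q\<close> and \<open>p\<close>.  These operators multiply like the elements \<open>p q\<^sup>*\<close>, they are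
  linearly independent (\<open>shift_independent\<close>), and \<open>shift [] []\<close> is the identity.  The defining relations
  reduce each word in the generators to zero or to some \<open>p q\<^sup>*\<close> (\<open>reducible_word\<close>).  Therefore the
  unitization is isomorphic to the span \<open>chain_ops V\<close> of the operators \<open>p q\<^sup>*\<close> and the identity
  (\<open>algebra_isomorphic_unitization_lpa\<close>), and everything can be proved for this span, for a partially
  ordered set \<open>V\<close> of vertices.

  Regularity (\<open>chain_ops_regular\<close>): an element involves only finitely many vertices.  Over a finite set
  of vertices, a triangular change of basis turns the operators into matrix units, and a combination of
  matrix units is regular by elimination of one row at a time together with McCoy's lemma.

  Primeness (\<open>prime_op_algebra\<close>): each nonzero ideal contains a vertex \<open>w\<close> and all vertices above \<open>w\<close>,
  and two finite sets lie in a third one.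

  Non-primitivity (\<open>not_left_primitive_op_algebra\<close>): for a nonzero element \<open>m\<close> of a simple faithful module
  consider the paths \<open>r\<close> with \<open>r\<^sup>* m \<noteq> 0\<close>.  For each vertex \<open>x\<close> at least one, and all but finitely many of
  them, end above \<open>x\<close>.  Consequently some countable set of their ends contains an upper bound of every
  vertex, so that countably many finite sets cover \<open>X\<close>; this is impossible for uncountable \<open>X\<close>.

  Non-isomorphism (\<open>card_of_surj_chain_ops\<close>): if one algebra of this kind maps linearly onto another, the vertices
  of the second are at most as many as those of the first, because a spanning set of the first of the
  cardinality of its vertices has images which involve finitely many vertices each.
\<close>

section \<open>Linear operators on functions of words\<close>

text \<open>
  The endomorphism ring of the vector space of all functions from words over \<^typ>\<open>'a\<close> to the
  field \<^typ>\<open>'k\<close>.  Its product is composition, and \<open>scal c\<close> below is multiplication by the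
  scalar \<open>c\<close>, so that scalar multiples are products inside the ring.
\<close>

typedef (overloaded) ('a, 'k::field) linop =
  "{f :: ('a list \<Rightarrow> 'k) \<Rightarrow> ('a list \<Rightarrow> 'k).
     (\<forall>g h. f (\<lambda>y. g y + h y) = (\<lambda>y. f g y + f h y)) \<and> (\<forall>c g. f (\<lambda>y. c * g y) = (\<lambda>y. c * f g y))}"
  morphisms app Abs_linop
  by (rule exI[of _ "\<lambda>g. g"]) simp

setup_lifting type_definition_linop

lemma app_add: "app T (\<lambda>y. g y + h y) = (\<lambda>y. app T g y + app T h y)"
  and app_scale: "app T (\<lambda>y. c * g y) = (\<lambda>y. c * app T g y)"
  using app[of T] by auto

lemma linop_eqI: "(\<And>g y. app S g y = app T g y) \<Longrightarrow> S = T"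
  by (metis app_inject ext)

instantiation linop :: (type, field) ring_1
begin

lift_definition zero_linop :: "('a, 'b) linop" is "\<lambda>g y. 0" by simp
lift_definition one_linop :: "('a, 'b) linop" is "\<lambda>g. g" by simp
lift_definition plus_linop :: "('a, 'b) linop \<Rightarrow> ('a, 'b) linop \<Rightarrow> ('a, 'b) linop"
  is "\<lambda>S T g y. S g y + T g y" by (auto simp: algebra_simps)
lift_definition uminus_linop :: "('a, 'b) linop \<Rightarrow> ('a, 'b) linop"
  is "\<lambda>S g y. - S g y" by (auto simp: algebra_simps)
lift_definition minus_linop :: "('a, 'b) linop \<Rightarrow> ('a, 'b) linop \<Rightarrow> ('a, 'b) linop"
  is "\<lambda>S T g y. S g y - T g y" by (auto simp: algebra_simps)
lift_definition times_linop :: "('a, 'b) linop \<Rightarrow> ('a, 'b) linop \<Rightarrow> ('a, 'b) linop"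
  is "\<lambda>S T g. S (T g)" by auto

instance
proof
  fix S T U :: "('a, 'b) linop"
  show "S * T * U = S * (T * U)" by transfer simp
  show "S + T + U = S + (T + U)" by transfer (simp add: algebra_simps)
  show "S + T = T + S" by transfer (simp add: algebra_simps)
  show "0 + S = S" by transfer simp
  show "- S + S = 0" by transfer simp
  show "S - T = S + - T" by transfer simp
  show "1 * S = S" by transfer simp
  show "S * 1 = S" by transfer simp
  show "(S + T) * U = S * U + T * U" by transfer simp
  show "S * (T + U) = S * T + S * U" by transfer simp
  show "(0::('a, 'b) linop) \<noteq> 1"
  proof
    assume "(0::('a, 'b) linop) = 1"
    then have "app (0::('a, 'b) linop) (\<lambda>_. 1) [] = app 1 (\<lambda>_. 1) []" by simp
    then show False by (simp add: zero_linop.rep_eq one_linop.rep_eq)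
  qed
qed

end

lift_definition scal :: "'k::field \<Rightarrow> ('a, 'k) linop" is "\<lambda>c g y. c * g y"
  by (auto simp: algebra_simps)

lemmas app_simps = zero_linop.rep_eq one_linop.rep_eq plus_linop.rep_eq uminus_linop.rep_eq
  minus_linop.rep_eq times_linop.rep_eq scal.rep_eq

lemma scal_add: "scal (c + d) = scal c + scal d"
  and scal_mult: "scal (c * d) = scal c * scal d"
  and scal_0 [simp]: "scal 0 = 0"
  and scal_1 [simp]: "scal 1 = 1"
  and scal_commute: "T * scal c = scal c * T"
  by (rule linop_eqI; simp add: app_simps app_scale algebra_simps)+

lemma scal_left_commute: "T * (scal c * U) = scal c * (T * U)"
  by (metis mult.assoc scal_commute)

lemma scal_uminus: "scal (- c) = - scal c"
  by (rule linop_eqI) (simp add: app_simps)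

interpretation linop: vector_space "\<lambda>c T. scal c * T :: ('a, 'k::field) linop"
  by unfold_locales (simp_all add: algebra_simps scal_add scal_mult)

lemma app_sum: "app (sum f A) g y = (\<Sum>x\<in>A. app (f x) g y)"
  by (induction A rule: infinite_finite_induct) (auto simp: app_simps)

section \<open>Prefix exchange operators\<close>

text \<open>
  \<open>strip p y\<close> is the word that is left of \<open>y\<close> once the prefix \<open>p\<close> is removed.
\<close>

definition strip :: "'a list \<Rightarrow> 'a list \<Rightarrow> 'a list option" where
  "strip p y = (if take (length p) y = p then Some (drop (length p) y) else None)"

lemma strip_eq_Some: "strip p y = Some z \<longleftrightarrow> y = p @ z"
  unfolding strip_def by (metis append_eq_conv_conj append_take_drop_id option.distinct(1) option.inject)

lemma strip_eq_None: "strip p y = None \<longleftrightarrow> (\<forall>z. y \<noteq> p @ z)"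
  using strip_eq_Some[of p y] by (cases "strip p y") auto

text \<open>
  The operator that stands for \<open>p q\<^sup>*\<close>: it maps the indicator function of \<open>q @ z\<close> to that of
  \<open>p @ z\<close> and kills the indicator functions of words without the prefix \<open>q\<close>.  Words are arbitrary
  lists; only later are they restricted to chains.
\<close>

lift_definition shift :: "'a list \<Rightarrow> 'a list \<Rightarrow> ('a, 'k::field) linop" is
  "\<lambda>p q g y. case strip p y of None \<Rightarrow> 0 | Some z \<Rightarrow> g (q @ z)"
  by (auto split: option.splits)

lemma app_shift_append [simp]: "app (shift p q) g (p @ z) = g (q @ z)"
proof -
  have "strip p (p @ z) = Some z" by (simp add: strip_eq_Some)
  then show ?thesis by (simp add: shift.rep_eq)
qed

lemma app_shift_outside: "(\<And>z. y \<noteq> p @ z) \<Longrightarrow> app (shift p q) g y = 0"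
proof -
  assume "\<And>z. y \<noteq> p @ z"
  then have "strip p y = None" by (simp add: strip_eq_None)
  then show ?thesis by (simp add: shift.rep_eq)
qed

lemma shift_Nil [simp]: "shift [] [] = 1"
proof (rule linop_eqI)
  fix g y show "app (shift [] []) g y = app 1 g y"
    using app_shift_append[of "[]" "[]" g y] by (simp add: app_simps)
qed

lemma shift_mult_ext_right: "shift p q * shift (q @ z) s = shift (p @ z) s"
proof (rule linop_eqI)
  fix g y
  show "app (shift p q * shift (q @ z) s) g y = app (shift (p @ z) s) g y"
  proof (cases "\<exists>x. y = p @ x")
    case True
    then obtain x where y: "y = p @ x" by blast
    show ?thesis
    proof (cases "\<exists>u. x = z @ u")
      case True
      then obtain u where "x = z @ u" by blast
      with y show ?thesis
        using app_shift_append[of "q @ z" s g u] app_shift_append[of "p @ z" s g u]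
        by (simp add: app_simps)
    next
      case False
      with y show ?thesis by (simp add: app_simps app_shift_outside)
    qed
  next
    case False
    then show ?thesis by (simp add: app_simps app_shift_outside)
  qed
qed

lemma shift_mult_ext_left: "shift p (r @ z) * shift r s = shift p (s @ z)"
proof (rule linop_eqI)
  fix g y
  show "app (shift p (r @ z) * shift r s) g y = app (shift p (s @ z)) g y"
    by (cases "\<exists>x. y = p @ x") (auto simp: app_simps app_shift_outside)
qed

lemma shift_mult_incomparable:
  assumes "\<And>z. r \<noteq> q @ z" "\<And>z. q \<noteq> r @ z"
  shows "shift p q * shift r s = 0"
proof (rule linop_eqI)
  fix g y
  show "app (shift p q * shift r s) g y = app 0 g y"
  proof (cases "\<exists>x. y = p @ x")
    case True
    then obtain x where y: "y = p @ x" by blast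
    have "q @ x \<noteq> r @ z" for z
      using assms by (auto simp: append_eq_append_conv2)
    with y show ?thesis by (simp add: app_simps app_shift_outside)
  qed (simp add: app_simps app_shift_outside)
qed

lemma shift_mult_same [simp]: "shift p q * shift q s = shift p s"
  using shift_mult_ext_right[of p q "[]" s] by simp

text \<open>
  Evaluating the sum at the indicator function of \<open>q\<close> and at the word \<open>p\<close> gives the coefficient of
  \<open>shift p q\<close> plus coefficients of operators \<open>shift p' q'\<close> with \<open>p = p' @ z\<close>, \<open>q = q' @ z\<close> and
  \<open>z \<noteq> []\<close>, which vanish by induction on the length of \<open>q\<close>.
\<close>

lemma shift_independent:
  assumes fin: "finite D" and zero: "(\<Sum>d\<in>D. scal (c d) * shift (fst d) (snd d)) = 0" and "d \<in> D"
  shows "c d = (0::'k::field)"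
  using \<open>d \<in> D\<close>
proof (induction "length (snd d)" arbitrary: d rule: less_induct)
  case less
  obtain p q where d: "d = (p, q)" by force
  let ?g = "\<lambda>x. if x = q then 1 else (0::'k)"
  have "0 = app (\<Sum>d\<in>D. scal (c d) * shift (fst d) (snd d)) ?g p"
    by (simp add: zero app_simps)
  also have "\<dots> = (\<Sum>d'\<in>D. if d' = d then c d else 0)"
    unfolding app_sum
  proof (rule sum.cong[OF refl])
    fix d' assume d': "d' \<in> D"
    obtain p' q' where pq: "d' = (p', q')" by force
    show "app (scal (c d') * shift (fst d') (snd d')) ?g p = (if d' = d then c d else 0)"
    proof (cases "\<exists>z. p = p' @ z")
      case True
      then obtain z where z: "p = p' @ z" by blast
      show ?thesis
      proof (cases "q' @ z = q")
        case True
        show ?thesis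
        proof (cases "z = []")
          case True
          with \<open>q' @ z = q\<close> z pq d show ?thesis
            using app_shift_append[of p' q' ?g "[]"] by (simp add: app_simps)
        next
          case False
          then have "length (snd d') < length (snd d)" using \<open>q' @ z = q\<close> pq d by auto
          then have "c d' = 0" using less d' by blast
          then show ?thesis by (auto simp: app_simps)
        qed
      next
        case False
        then have "d' \<noteq> d" using pq d z by auto
        with False show ?thesis by (simp add: app_simps pq z)
      qed
    next
      case False
      then have "d' \<noteq> d" using pq d by (metis append_Nil2 fst_conv)
      with False show ?thesis by (simp add: app_simps app_shift_outside pq)
    qed
  qed
  also have "\<dots> = c d" using fin less.prems by simp
  finally show ?case by simp
qed

section \<open>Algebras of operators spanned by pairs of chains\<close>

lemma span_image_explicit:
  assumes "a \<in> linop.span (f ` I)"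
  obtains D c where "finite D" "D \<subseteq> I" "a = (\<Sum>d\<in>D. scal (c d) * f d)"
proof -
  obtain t r where t: "finite t" "t \<subseteq> f ` I" "a = (\<Sum>x\<in>t. scal (r x) * x)"
    using assms unfolding linop.span_explicit by blast
  obtain D where D: "D \<subseteq> I" "inj_on f D" "t = f ` D"
    using t(2) unfolding subset_image_inj by blast
  show thesis
  proof (rule that[of D "\<lambda>d. r (f d)"])
    show "finite D" using t(1) D by (simp add: finite_image_iff)
    show "a = (\<Sum>d\<in>D. scal (r (f d)) * f d)" using t(3) D by (simp add: sum.reindex)
  qed (fact D)
qed

text \<open>
  Strictly increasing lists of elements of \<open>V\<close>.  If \<open>V\<close> is the set of vertices of the graph whose
  edges are the pairs \<open>v < w\<close>, the nonempty ones are the paths, each given by its sequence of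
  vertices.
\<close>

definition strict_chain :: "'a::order set \<Rightarrow> 'a list \<Rightarrow> bool" where
  "strict_chain V p \<longleftrightarrow> set p \<subseteq> V \<and> sorted_wrt (<) p"

text \<open>
  Two paths end at the same vertex.  The empty list matches only itself, so that the pair
  \<open>([], [])\<close>, whose operator is the identity, can be treated like a pair of paths.
\<close>

definition same_end :: "'a list \<Rightarrow> 'a list \<Rightarrow> bool" where
  "same_end p q \<longleftrightarrow> (p = [] \<longleftrightarrow> q = []) \<and> (p \<noteq> [] \<longrightarrow> last p = last q)"

text \<open>
  The pairs \<open>(p, q)\<close> that index the elements \<open>p q\<^sup>*\<close>, and the pair \<open>([], [])\<close>.
\<close>

definition chain_pairs :: "'a::order set \<Rightarrow> ('a list \<times> 'a list) set" where
  "chain_pairs V = {(p, q). strict_chain V p \<and> strict_chain V q \<and> same_end p q}"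

text \<open>
  The linear span of the operators \<open>p q\<^sup>*\<close> together with the identity.
\<close>

definition chain_ops :: "'a::order set \<Rightarrow> ('a, 'k::field) linop set" where
  "chain_ops V = linop.span ((\<lambda>d. shift (fst d) (snd d)) ` chain_pairs V)"

lemma same_end_refl [simp]: "same_end p p"
  and same_end_sym: "same_end p q \<Longrightarrow> same_end q p"
  and same_end_trans: "same_end p q \<Longrightarrow> same_end q r \<Longrightarrow> same_end p r"
  and same_end_append: "same_end p q \<Longrightarrow> same_end (p @ z) (q @ z)"
  by (cases "z = []"; auto simp: same_end_def)+

lemma chain_Nil [simp]: "strict_chain V []"
  by (simp add: strict_chain_def)

lemma chain_snoc:
  "strict_chain V (p @ [w]) \<longleftrightarrow> strict_chain V p \<and> w \<in> V \<and> (p \<noteq> [] \<longrightarrow> last p < w)"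
proof -
  have "x \<le> last p" if "sorted_wrt (<) p" "x \<in> set p" for x
    using that by (induction p rule: rev_induct) (auto simp: sorted_wrt_append less_imp_le)
  then show ?thesis
    by (auto simp: strict_chain_def sorted_wrt_append intro: le_less_trans)
qed

lemma chain_appendD: "strict_chain V (p @ z) \<Longrightarrow> strict_chain V p"
  by (simp add: strict_chain_def sorted_wrt_append)

lemma chain_append_same_end:
  assumes "same_end p q" "strict_chain V q" "strict_chain V (p @ z)"
  shows "strict_chain V (q @ z)"
  using assms(3)
proof (induction z rule: rev_induct)
  case (snoc w z)
  have "strict_chain V (p @ z)" using snoc.prems chain_appendD[of V "p @ z" "[w]"] by simp
  with snoc.IH have "strict_chain V (q @ z)" by blast
  moreover have "same_end (p @ z) (q @ z)" using assms(1) by (rule same_end_append)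
  ultimately show ?case
    using snoc.prems chain_snoc[of V "p @ z" w] chain_snoc[of V "q @ z" w] by (auto simp: same_end_def)
qed (simp add: assms)

lemma chain_distinct: "strict_chain V p \<Longrightarrow> distinct p"
  unfolding strict_chain_def by (induction p) auto

lemma finite_chains: "finite F \<Longrightarrow> finite {p. strict_chain F p}"
  using finite_subset[OF _ finite_subset_distinct[of F], of "{p. strict_chain F p}"] chain_distinct[of F]
  unfolding strict_chain_def by blast

lemma chain_length: "finite F \<Longrightarrow> strict_chain F p \<Longrightarrow> length p \<le> card F"
  by (metis strict_chain_def chain_distinct card_mono distinct_card)

lemma chain_pairs_append:
  "(p, q) \<in> chain_pairs V \<Longrightarrow> strict_chain V (p @ z) \<Longrightarrow> (p @ z, q @ z) \<in> chain_pairs V"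
  using chain_append_same_end same_end_append by (fastforce simp: chain_pairs_def)

lemma chain_pairs_sym: "(p, q) \<in> chain_pairs V \<Longrightarrow> (q, p) \<in> chain_pairs V"
  by (auto simp: chain_pairs_def same_end_sym)

lemma chain_pairs_trans:
  "(p, q) \<in> chain_pairs V \<Longrightarrow> (q, r) \<in> chain_pairs V \<Longrightarrow> (p, r) \<in> chain_pairs V"
  by (auto simp: chain_pairs_def intro: same_end_trans)

lemma Nil_chain_pairs: "([], []) \<in> chain_pairs V"
  by (simp add: chain_pairs_def)

lemma shift_in_chain_ops: "(p, q) \<in> chain_pairs V \<Longrightarrow> shift p q \<in> chain_ops V"
  unfolding chain_ops_def by (rule linop.span_base) force

lemma chain_ops_0: "0 \<in> chain_ops V"
  and chain_ops_add: "a \<in> chain_ops V \<Longrightarrow> b \<in> chain_ops V \<Longrightarrow> a + b \<in> chain_ops V"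
  and chain_ops_diff: "a \<in> chain_ops V \<Longrightarrow> b \<in> chain_ops V \<Longrightarrow> a - b \<in> chain_ops V"
  and chain_ops_uminus: "a \<in> chain_ops V \<Longrightarrow> - a \<in> chain_ops V"
  and chain_ops_scale: "a \<in> chain_ops V \<Longrightarrow> scal c * a \<in> chain_ops V"
  and chain_ops_sum: "(\<And>i. i \<in> I \<Longrightarrow> f i \<in> chain_ops V) \<Longrightarrow> sum f I \<in> chain_ops V"
  unfolding chain_ops_def
  by (auto intro: linop.span_zero linop.span_add linop.span_diff linop.span_neg linop.span_scale linop.span_sum)

lemma chain_ops_1: "1 \<in> chain_ops V"
  using shift_in_chain_ops[OF Nil_chain_pairs] by simp

lemma chain_ops_scal: "scal c \<in> chain_ops V"
  using chain_ops_scale[OF chain_ops_1] by simp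

lemma span_shift_induct [consumes 1, case_names zero step]:
  fixes I :: "('a list \<times> 'a list) set" and P :: "('a, 'k::field) linop \<Rightarrow> bool"
  assumes "a \<in> linop.span ((\<lambda>d. shift (fst d) (snd d)) ` I)" "P 0"
    and "\<And>c p q b. (p, q) \<in> I \<Longrightarrow> b \<in> linop.span ((\<lambda>d. shift (fst d) (snd d)) ` I) \<Longrightarrow>
      P b \<Longrightarrow> P (scal c * shift p q + b)"
  shows "P a"
proof -
  let ?S = "linop.span ((\<lambda>d. shift (fst d) (snd d)) ` I) :: ('a, 'k) linop set"
  have "a \<in> ?S \<and> P a"
    using assms(1)
  proof (induction rule: linop.span_induct_alt)
    case base
    show ?case using assms(2) linop.span_zero by blast
  next
    case (step c x y)
    then obtain p q where pq: "x = shift p q" "(p, q) \<in> I" by force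
    have "x \<in> ?S" using step(1) by (rule linop.span_base)
    then have "scal c * x + y \<in> ?S"
      using step.IH by (intro linop.span_add linop.span_scale) auto
    then show ?case using step.IH assms(3)[OF pq(2), of y c] by (simp add: pq(1))
  qed
  then show ?thesis ..
qed

lemmas chain_ops_induct [consumes 1, case_names zero step] =
  span_shift_induct[where I = "chain_pairs V" for V, folded chain_ops_def]

lemma chain_last_le: "strict_chain V (p @ z) \<Longrightarrow> p \<noteq> [] \<Longrightarrow> last p \<le> last (p @ z)"
  by (cases z rule: rev_cases) (auto simp: strict_chain_def sorted_wrt_append intro!: less_imp_le)

text \<open>
  A nonzero product of two operators of the spanning family is again in the family, and its
  chains end above the ends of both factors.
\<close>

lemma shift_mult_chain_pairs:
  fixes p :: "'a::order list"
  assumes "(p, q) \<in> chain_pairs V" "(r, s) \<in> chain_pairs V"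
    and nonzero: "shift p q * shift r s \<noteq> (0 :: ('a, 'k::field) linop)"
  obtains p' q' where "(p', q') \<in> chain_pairs V"
    "shift p q * shift r s = (shift p' q' :: ('a, 'k) linop)"
    "p \<noteq> [] \<longrightarrow> p' \<noteq> [] \<and> last p \<le> last p'" "r \<noteq> [] \<longrightarrow> p' \<noteq> [] \<and> last r \<le> last p'"
proof -
  consider z where "r = q @ z" | z where "q = r @ z"
    using nonzero shift_mult_incomparable by blast
  then show thesis
  proof cases
    case (1 z)
    then have "strict_chain V (q @ z)" using assms(2) by (simp add: chain_pairs_def)
    then have "(q @ z, p @ z) \<in> chain_pairs V"
      using chain_pairs_append[OF chain_pairs_sym[OF assms(1)]] by blast
    then have *: "(p @ z, s) \<in> chain_pairs V" "strict_chain V (p @ z)" "last (q @ z) = last (p @ z)"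
      "q @ z = [] \<longleftrightarrow> p @ z = []"
      using assms(2) chain_pairs_sym chain_pairs_trans 1
      by (blast, auto simp: chain_pairs_def same_end_def)
    show thesis
    proof (rule that[OF *(1)])
      show "shift p q * shift r s = (shift (p @ z) s :: ('a, 'k) linop)"
        using 1 by (simp add: shift_mult_ext_right)
    qed (use * 1 chain_last_le in auto)
  next
    case (2 z)
    then have "strict_chain V (r @ z)" using assms(1) by (simp add: chain_pairs_def)
    then have "(r @ z, s @ z) \<in> chain_pairs V"
      using chain_pairs_append[OF assms(2)] by blast
    then have *: "(p, s @ z) \<in> chain_pairs V" "last p = last (r @ z)" "p = [] \<longleftrightarrow> r @ z = []"
      using assms(1) chain_pairs_trans 2 by (blast, auto simp: chain_pairs_def same_end_def)
    show thesis
    proof (rule that[OF *(1)])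
      show "shift p q * shift r s = (shift p (s @ z) :: ('a, 'k) linop)"
        using 2 by (simp add: shift_mult_ext_left)
    qed (use * \<open>strict_chain V (r @ z)\<close> chain_last_le[of V r z] in auto)
  qed
qed

lemma chain_ops_mult:
  fixes a b :: "('a::order, 'k::field) linop"
  assumes "a \<in> chain_ops V" "b \<in> chain_ops V"
  shows "a * b \<in> chain_ops V"
  using assms(1)
proof (induction rule: chain_ops_induct)
  case (step c p q a)
  have "shift p q * b \<in> chain_ops V"
    using assms(2)
  proof (induction rule: chain_ops_induct)
    case (step d r s b)
    have "shift p q * shift r s \<in> (chain_ops V :: ('a, 'k) linop set)"
      using \<open>(p, q) \<in> _\<close> \<open>(r, s) \<in> _\<close> shift_mult_chain_pairs[of p q V r s] shift_in_chain_ops chain_ops_0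
      by metis
    then show ?case
      using step.IH by (simp add: distrib_left scal_left_commute chain_ops_add chain_ops_scale)
  qed (simp add: chain_ops_0)
  then show ?case
    using step.IH by (simp add: distrib_right mult.assoc chain_ops_add chain_ops_scale)
qed (simp add: chain_ops_0)

lemma chain_ops_explicit:
  assumes "a \<in> chain_ops V"
  obtains D c where "finite D" "D \<subseteq> chain_pairs V"
    "a = (\<Sum>d\<in>D. scal (c d) * shift (fst d) (snd d))"
  using assms unfolding chain_ops_def by (rule span_image_explicit)

lemma chain_ops_mono: "V \<subseteq> W \<Longrightarrow> chain_ops V \<subseteq> chain_ops W"
  unfolding chain_ops_def
  by (intro linop.span_mono image_mono) (auto simp: chain_pairs_def strict_chain_def)

text \<open>
  Each element involves only finitely many vertices.
\<close>

lemma chain_ops_local: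
  assumes "a \<in> chain_ops V"
  shows "\<exists>F. finite F \<and> F \<subseteq> V \<and> a \<in> chain_ops F"
  using assms
proof (induction rule: chain_ops_induct)
  case (step c p q b)
  then obtain F where F: "finite F" "F \<subseteq> V" "b \<in> chain_ops F" by blast
  let ?G = "F \<union> set p \<union> set q"
  have "(p, q) \<in> chain_pairs ?G" "?G \<subseteq> V"
    using \<open>(p, q) \<in> _\<close> F(2) by (auto simp: chain_pairs_def strict_chain_def)
  moreover have "b \<in> chain_ops ?G" using F(3) chain_ops_mono[of F ?G] by blast
  ultimately show ?case
    using F(1) by (intro exI[of _ ?G]) (auto intro!: chain_ops_add chain_ops_scale shift_in_chain_ops)
qed (use chain_ops_0 in blast)

lemma shift_in_chain_opsD:
  assumes "shift p q \<in> (chain_ops V :: ('a::order, 'k::field) linop set)"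
  shows "(p, q) \<in> chain_pairs V"
proof (rule ccontr)
  assume not: "(p, q) \<notin> chain_pairs V"
  obtain D c where D: "finite D" "D \<subseteq> chain_pairs V"
    "(shift p q :: ('a, 'k) linop) = (\<Sum>d\<in>D. scal (c d) * shift (fst d) (snd d))"
    using assms by (rule chain_ops_explicit)
  let ?c = "\<lambda>d. if d = (p, q) then -1 else c d"
  have "(p, q) \<notin> D" using not D(2) by blast
  then have "(\<Sum>d\<in>D. scal (?c d) * shift (fst d) (snd d)) = (shift p q :: ('a, 'k) linop)"
    unfolding D(3) by (intro sum.cong) auto
  then have "(\<Sum>d\<in>insert (p, q) D. scal (?c d) * shift (fst d) (snd d)) = (0 :: ('a, 'k) linop)"
    using D(1) \<open>(p, q) \<notin> D\<close> by (simp add: scal_uminus)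
  from shift_independent[OF _ this, of "(p, q)"] D(1) show False by simp
qed

section \<open>Von Neumann regularity\<close>

lemma scal_diff: "scal (c - d) = scal c - scal d"
  by (rule linop_eqI) (simp add: app_simps left_diff_distrib)

lemma scal_mult_scal: "scal c * S * (scal d * T) = scal (c * d) * (S * T)"
  by (metis mult.assoc scal_commute scal_mult)

lemma mult_scal_mult: "S * (scal c * T) * U = scal c * (S * T * U)"
  by (metis mult.assoc scal_commute)

text \<open>
  A linear combination of matrix units \<open>e p q\<close>, indexed by the pairs of a partial equivalence
  relation \<open>R\<close> (so that several blocks are allowed), is von Neumann regular.  If the coefficient at
  \<open>(p0, q0)\<close> is not zero, the multiple \<open>x\<close> of \<open>e q0 p0\<close> by its inverse makes row \<open>p0\<close> of
  \<open>a - a * x * a\<close> vanish and creates no new nonzero row; the claim follows by induction on the number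
  of nonzero rows.  The set \<open>W\<close> is any subalgebra that contains the units.
\<close>

lemma matrix_units_regular:
  fixes e :: "'i \<Rightarrow> 'i \<Rightarrow> ('a, 'k::field) linop" and c :: "'i \<Rightarrow> 'i \<Rightarrow> 'k"
  assumes fin: "finite Q"
    and units: "\<And>p q r s. R p q \<Longrightarrow> R r s \<Longrightarrow> e p q * e r s = (if q = r then e p s else 0)"
    and sym: "\<And>p q. R p q \<Longrightarrow> R q p" and trans: "\<And>p q r. R p q \<Longrightarrow> R q r \<Longrightarrow> R p r"
    and supp: "\<And>p q. c p q \<noteq> 0 \<Longrightarrow> R p q"
    and W: "\<And>p q. R p q \<Longrightarrow> e p q \<in> W" "0 \<in> W" "\<And>x y. x \<in> W \<Longrightarrow> y \<in> W \<Longrightarrow> x + y \<in> W"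
      "\<And>x y. x \<in> W \<Longrightarrow> y \<in> W \<Longrightarrow> x - y \<in> W" "\<And>x y. x \<in> W \<Longrightarrow> y \<in> W \<Longrightarrow> x * y \<in> W"
      "\<And>k x. x \<in> W \<Longrightarrow> scal k * x \<in> W"
  shows "\<exists>x\<in>W. (\<Sum>p\<in>Q. \<Sum>q\<in>Q. scal (c p q) * e p q) =
    (\<Sum>p\<in>Q. \<Sum>q\<in>Q. scal (c p q) * e p q) * x * (\<Sum>p\<in>Q. \<Sum>q\<in>Q. scal (c p q) * e p q)"
  using supp
proof (induction "card {p\<in>Q. \<exists>q\<in>Q. c p q \<noteq> 0}" arbitrary: c rule: less_induct)
  case less
  define a where "a = (\<Sum>p\<in>Q. \<Sum>q\<in>Q. scal (c p q) * e p q)"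
  have aW: "a \<in> W"
  proof -
    have sum_W: "sum f A \<in> W" if "\<And>i. i \<in> A \<Longrightarrow> f i \<in> W" for f and A :: "'i set"
      using that by (induction A rule: infinite_finite_induct) (auto intro: W)
    have "scal (c p q) * e p q \<in> W" for p q
      using less.prems[of p q] W by (cases "c p q = 0") auto
    then show ?thesis unfolding a_def by (intro sum_W)
  qed
  show ?case
  proof (cases "\<exists>p\<in>Q. \<exists>q\<in>Q. c p q \<noteq> 0")
    case False
    then have "a = 0" unfolding a_def by simp
    with W(2) show ?thesis unfolding a_def[symmetric] by force
  next
    case True
    then obtain p0 q0 where pq: "p0 \<in> Q" "q0 \<in> Q" "c p0 q0 \<noteq> 0" by blast
    then have R0: "R p0 q0" "R q0 p0" using less.prems sym by blast+
    \<comment> \<open>Subtracting \<open>a * x * a\<close> from \<open>a\<close> clears row \<open>p0\<close>.\<close>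
    define x where "x = scal (1 / c p0 q0) * e q0 p0"
    have xW: "x \<in> W" unfolding x_def by (intro W R0)
    define c' where "c' p q = c p q - c p q0 * c p0 q / c p0 q0" for p q
    have "a * e q0 p0 = (\<Sum>p\<in>Q. \<Sum>q\<in>Q. if q = q0 then scal (c p q0) * e p p0 else 0)"
      unfolding a_def sum_distrib_right
    proof (intro sum.cong refl)
      fix p q
      show "scal (c p q) * e p q * e q0 p0 = (if q = q0 then scal (c p q0) * e p p0 else 0)"
        using less.prems[of p q] R0 units[of p q q0 p0] by (cases "c p q = 0") (auto simp: mult.assoc)
    qed
    also have "\<dots> = (\<Sum>p\<in>Q. scal (c p q0) * e p p0)"
      using fin pq by simp
    finally have "a * e q0 p0 * a = (\<Sum>p\<in>Q. scal (c p q0) * e p p0 * a)"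
      by (simp only: sum_distrib_right)
    also have "\<dots> = (\<Sum>p\<in>Q. \<Sum>r\<in>Q. \<Sum>s\<in>Q. (scal (c p q0) * e p p0) * (scal (c r s) * e r s))"
      by (simp only: a_def sum_distrib_left)
    also have "\<dots> = (\<Sum>p\<in>Q. \<Sum>r\<in>Q. \<Sum>s\<in>Q. if r = p0 then scal (c p q0 * c p0 s) * e p s else 0)"
    proof (intro sum.cong refl)
      fix p r s
      have "R p p0" if "c p q0 \<noteq> 0" using less.prems[OF that] R0 trans by blast
      moreover have "R r s" if "c r s \<noteq> 0" using less.prems[OF that] .
      ultimately show "scal (c p q0) * e p p0 * (scal (c r s) * e r s) =
          (if r = p0 then scal (c p q0 * c p0 s) * e p s else 0)"
        using units[of p p0 r s]
        by (cases "c p q0 = 0"; cases "c r s = 0") (auto simp: scal_mult_scal)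
    qed
    also have "\<dots> = (\<Sum>p\<in>Q. \<Sum>s\<in>Q. scal (c p q0 * c p0 s) * e p s)"
    proof (rule sum.cong[OF refl])
      fix p
      have "(\<Sum>r\<in>Q. \<Sum>s\<in>Q. if r = p0 then scal (c p q0 * c p0 s) * e p s else 0) =
          (\<Sum>r\<in>Q. if r = p0 then \<Sum>s\<in>Q. scal (c p q0 * c p0 s) * e p s else 0)"
        by (rule sum.cong) auto
      then show "(\<Sum>r\<in>Q. \<Sum>s\<in>Q. if r = p0 then scal (c p q0 * c p0 s) * e p s else 0) =
          (\<Sum>s\<in>Q. scal (c p q0 * c p0 s) * e p s)" using fin pq by simp
    qed
    finally have "a * x * a = scal (1 / c p0 q0) * (\<Sum>p\<in>Q. \<Sum>s\<in>Q. scal (c p q0 * c p0 s) * e p s)"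
      by (simp add: x_def mult_scal_mult)
    also have "\<dots> = (\<Sum>p\<in>Q. \<Sum>s\<in>Q. scal (c p q0 * c p0 s / c p0 q0) * e p s)"
      unfolding sum_distrib_left by (simp add: mult.assoc[symmetric] scal_mult[symmetric])
    finally have axa: "a - a * x * a = (\<Sum>p\<in>Q. \<Sum>q\<in>Q. scal (c' p q) * e p q)"
      by (simp add: a_def[symmetric]) (simp add: a_def c'_def scal_diff left_diff_distrib sum_subtractf)
    have row: "c' p0 q = 0" for q using pq by (simp add: c'_def)
    have "{p\<in>Q. \<exists>q\<in>Q. c' p q \<noteq> 0} \<subset> {p\<in>Q. \<exists>q\<in>Q. c p q \<noteq> 0}"
    proof
      have "\<exists>q\<in>Q. c p q \<noteq> 0" if "q \<in> Q" "c' p q \<noteq> 0" for p q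
        using that pq by (cases "c p q = 0") (auto simp: c'_def)
      then show "{p\<in>Q. \<exists>q\<in>Q. c' p q \<noteq> 0} \<subseteq> {p\<in>Q. \<exists>q\<in>Q. c p q \<noteq> 0}" by blast
      show "{p\<in>Q. \<exists>q\<in>Q. c' p q \<noteq> 0} \<noteq> {p\<in>Q. \<exists>q\<in>Q. c p q \<noteq> 0}"
        using pq row by blast
    qed
    then have card: "card {p\<in>Q. \<exists>q\<in>Q. c' p q \<noteq> 0} < card {p\<in>Q. \<exists>q\<in>Q. c p q \<noteq> 0}"
      using fin by (intro psubset_card_mono) auto
    have supp': "R p q" if "c' p q \<noteq> 0" for p q
    proof (cases "c p q = 0")
      case True
      with that have "c p q0 \<noteq> 0" "c p0 q \<noteq> 0" by (auto simp: c'_def)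
      then have "R p q0" "R p0 q" by (auto intro: less.prems)
      with R0 trans show ?thesis by blast
    qed (use less.prems in blast)
    have "\<exists>y\<in>W. a - a * x * a = (a - a * x * a) * y * (a - a * x * a)"
      unfolding axa by (rule less.hyps[OF card]) (rule supp')
    then obtain y where y: "y \<in> W" "a - a * x * a = (a - a * x * a) * y * (a - a * x * a)" ..
    \<comment> \<open>McCoy: if \<open>a - axa\<close> has the quasi-inverse \<open>y\<close>, then \<open>a\<close> has the quasi-inverse
      \<open>x + (1 - xa) y (1 - ax)\<close>.\<close>
    have "a = a * x * a + (a - a * x * a) * y * (a - a * x * a)"
      using y(2) by (simp add: algebra_simps)
    also have "\<dots> = a * (x + (y - x * a * y - y * a * x + x * a * y * a * x)) * a"
      by (simp add: algebra_simps)
    finally have "a = a * (x + (y - x * a * y - y * a * x + x * a * y * a * x)) * a" .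
    moreover have "x + (y - x * a * y - y * a * x + x * a * y * a * x) \<in> W"
      by (intro W(3-5) aW xW y(1))
    ultimately show ?thesis unfolding a_def[symmetric] by (rule bexI)
  qed
qed

text \<open>
  For a finite set \<open>F\<close> of vertices, the operators \<open>p (v - \<Sum> f f\<^sup>*) q\<^sup>*\<close>, where \<open>v\<close> is the common
  end of \<open>p\<close> and \<open>q\<close> and \<open>f\<close> runs through the edges from \<open>v\<close> to vertices in \<open>F\<close>; for empty \<open>p\<close>
  and \<open>q\<close> this is the identity minus all vertices in \<open>F\<close>.  They are matrix units for the chains
  in \<open>F\<close>.
\<close>

definition chain_unit :: "'a::order set \<Rightarrow> 'a list \<Rightarrow> 'a list \<Rightarrow> ('a, 'k::field) linop" where
  "chain_unit F p q = shift p q - (\<Sum>w | w \<in> F \<and> strict_chain F (p @ [w]). shift (p @ [w]) (q @ [w]))"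

text \<open>
  \<open>p\<close> is a prefix of \<open>y\<close> that the next letter of \<open>y\<close>, if there is one, does not prolong to a
  chain in \<open>F\<close>.  A word has at most one stem that is a chain in \<open>F\<close>, and \<open>chain_unit F p q\<close>
  replaces the stem \<open>q\<close> by the stem \<open>p\<close>.
\<close>

definition is_stem :: "'a::order set \<Rightarrow> 'a list \<Rightarrow> 'a list \<Rightarrow> bool" where
  "is_stem F p y \<longleftrightarrow> (\<exists>z. y = p @ z \<and> (z = [] \<or> \<not> strict_chain F (p @ [hd z])))"

lemma is_stem_unique:
  assumes "strict_chain F p" "strict_chain F q" "is_stem F p y" "is_stem F q y"
  shows "p = q"
proof -
  have no_ext: "u = []" if "strict_chain F (r @ u)" "is_stem F r (r @ u @ z)" for r u z
  proof (rule ccontr)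
    assume "u \<noteq> []"
    then obtain w v where u: "u = w # v" by (cases u) auto
    then have "strict_chain F (r @ [w])" using that(1) chain_appendD[of F "r @ [w]" v] by simp
    then show False using that(2) u by (auto simp: is_stem_def)
  qed
  obtain x z where xz: "y = p @ x" "y = q @ z" using assms unfolding is_stem_def by blast
  then consider u where "q = p @ u" "x = u @ z" | u where "p = q @ u" "z = u @ x"
    by (metis append_eq_append_conv2)
  then show ?thesis
  proof cases
    case 1
    then show ?thesis using no_ext[of p u z] assms xz by simp
  next
    case 2
    then show ?thesis using no_ext[of q u x] assms xz by simp
  qed
qed

lemma app_chain_unit:
  "app (chain_unit F p q) g y = (if is_stem F p y then g (q @ drop (length p) y) else 0)" if "finite F"
proof (cases "\<exists>z. y = p @ z")
  case False
  then have "\<not> is_stem F p y" "\<And>w z. y \<noteq> (p @ [w]) @ z" by (auto simp: is_stem_def)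
  with False show ?thesis
    by (simp add: chain_unit_def app_simps app_sum app_shift_outside del: append_assoc)
next
  case True
  then obtain z where y: "y = p @ z" by blast
  have stem: "is_stem F p (p @ z) \<longleftrightarrow> z = [] \<or> \<not> strict_chain F (p @ [hd z])"
    by (auto simp: is_stem_def)
  have fin: "finite {w \<in> F. strict_chain F (p @ [w])}" using that by simp
  show ?thesis
  proof (cases z)
    case Nil
    then have "y \<noteq> (p @ [w]) @ z'" for w z' by (simp add: y)
    then have "app (shift (p @ [w]) (q @ [w])) g y = 0" for w by (rule app_shift_outside)
    then show ?thesis
      using Nil stem app_shift_append[of p q g "[]"] by (simp add: chain_unit_def app_simps app_sum y)
  next
    case (Cons w x)
    have "app (shift (p @ [w']) (q @ [w'])) g y = (if w' = w then g (q @ z) else 0)" for w'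
    proof (cases "w' = w")
      case True
      have "y = (p @ [w]) @ x" by (simp add: y Cons)
      then show ?thesis
        using app_shift_append[of "p @ [w]" "q @ [w]" g x] True Cons by simp
    next
      case False
      then have "y \<noteq> (p @ [w']) @ z'" for z' by (simp add: y Cons)
      with False show ?thesis by (simp add: app_shift_outside del: append_assoc)
    qed
    moreover have "w \<in> F" if "strict_chain F (p @ [w])" using that by (simp add: chain_snoc)
    ultimately show ?thesis
      using Cons fin stem by (auto simp: chain_unit_def app_simps app_sum y)
  qed
qed

lemma chain_unit_mult:
  assumes fin: "finite F" and pq: "(p, q) \<in> chain_pairs F" and rs: "(r, s) \<in> chain_pairs F"
  shows "chain_unit F p q * chain_unit F r s = (if q = r then chain_unit F p s else 0)"
proof (rule linop_eqI)
  fix g y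
  show "app (chain_unit F p q * chain_unit F r s) g y = app (if q = r then chain_unit F p s else 0) g y"
  proof (cases "is_stem F p y")
    case True
    then obtain z where z: "y = p @ z" "z = [] \<or> \<not> strict_chain F (p @ [hd z])"
      unfolding is_stem_def by blast
    have "strict_chain F (p @ [w]) \<longleftrightarrow> strict_chain F (q @ [w])" for w
      using pq chain_append_same_end same_end_sym by (fastforce simp: chain_pairs_def)
    then have stem: "is_stem F q (q @ z)" using z by (auto simp: is_stem_def)
    have "is_stem F r (q @ z) \<longleftrightarrow> q = r"
      using is_stem_unique[OF _ _ stem, of r] stem pq rs by (auto simp: chain_pairs_def)
    with True z show ?thesis by (simp add: app_simps app_chain_unit[OF fin])
  qed (simp add: app_simps app_chain_unit[OF fin])
qed

lemma chain_unit_in_chain_ops: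
  "(p, q) \<in> chain_pairs F \<Longrightarrow> chain_unit F p q \<in> chain_ops F"
  unfolding chain_unit_def
  by (intro chain_ops_diff chain_ops_sum shift_in_chain_ops chain_pairs_append) auto

text \<open>
  By definition \<open>shift p q\<close> is \<open>chain_unit F p q\<close> plus a sum of operators belonging to chains that
  are longer by one; the length of a chain in \<open>F\<close> is bounded.
\<close>

lemma shift_in_span_chain_unit:
  assumes fin: "finite F" and "(p, q) \<in> chain_pairs F"
  shows "(shift p q :: ('a::order, 'k::field) linop) \<in> linop.span ((\<lambda>d. chain_unit F (fst d) (snd d)) ` chain_pairs F)"
  using assms(2)
proof (induction "card F - length p" arbitrary: p q rule: less_induct)
  case less
  let ?S = "linop.span ((\<lambda>d. chain_unit F (fst d) (snd d)) ` chain_pairs F) :: ('a, 'k) linop set"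
  have "(shift (p @ [w]) (q @ [w]) :: ('a, 'k) linop) \<in> ?S" if "strict_chain F (p @ [w])" for w
    using chain_length[OF fin that] chain_pairs_append[OF less.prems that]
    by (intro less.hyps) auto
  then have "(\<Sum>w | w \<in> F \<and> strict_chain F (p @ [w]). shift (p @ [w]) (q @ [w]) :: ('a, 'k) linop) \<in> ?S"
    by (intro linop.span_sum) auto
  moreover have "(chain_unit F p q :: ('a, 'k) linop) \<in> ?S"
    using less.prems by (intro linop.span_base) force
  ultimately have "chain_unit F p q + (\<Sum>w | w \<in> F \<and> strict_chain F (p @ [w]). shift (p @ [w]) (q @ [w])) \<in> ?S"
    by (intro linop.span_add)
  then show ?case by (simp add: chain_unit_def)
qed

lemma chain_ops_regular:
  assumes "a \<in> chain_ops V"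
  shows "\<exists>x\<in>chain_ops V. a = a * x * a"
proof -
  obtain F where F: "finite F" "F \<subseteq> V" "a \<in> chain_ops F"
    using chain_ops_local[OF assms] by blast
  let ?e = "\<lambda>d. chain_unit F (fst d) (snd d)" and ?Q = "{p. strict_chain F p}"
  have "chain_ops F \<subseteq> linop.span (?e ` chain_pairs F)"
    unfolding chain_ops_def
    by (rule linop.span_minimal) (auto intro: shift_in_span_chain_unit[OF F(1)])
  with F(3) have "a \<in> linop.span (?e ` chain_pairs F)" by blast
  then obtain D c where D: "finite D" "D \<subseteq> chain_pairs F" "a = (\<Sum>d\<in>D. scal (c d) * ?e d)"
    by (rule span_image_explicit)
  \<comment> \<open>Extend the coefficients by zero to a full square matrix.\<close>
  define c' where "c' p q = (if (p, q) \<in> D then c (p, q) else 0)" for p q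
  have "D \<subseteq> ?Q \<times> ?Q" using D(2) by (auto simp: chain_pairs_def)
  then have "a = (\<Sum>d\<in>?Q\<times>?Q. scal (c' (fst d) (snd d)) * ?e d)"
    unfolding D(3) using finite_chains[OF F(1)]
    by (intro sum.mono_neutral_cong_left) (auto simp: c'_def)
  then have a: "a = (\<Sum>p\<in>?Q. \<Sum>q\<in>?Q. scal (c' p q) * chain_unit F p q)"
    by (simp add: sum.cartesian_product case_prod_beta)
  have supp: "(p, q) \<in> chain_pairs F" if "c' p q \<noteq> 0" for p q
    using that D(2) by (auto simp: c'_def split: if_splits)
  have "\<exists>x\<in>chain_ops F. a = a * x * a"
    unfolding a
    by (rule matrix_units_regular[where R = "\<lambda>p q. (p, q) \<in> chain_pairs F" and W = "chain_ops F",
          OF finite_chains[OF F(1)] chain_unit_mult[OF F(1)] chain_pairs_sym chain_pairs_trans supp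
            chain_unit_in_chain_ops chain_ops_0 chain_ops_add chain_ops_diff chain_ops_mult chain_ops_scale])
  then show ?thesis using chain_ops_mono[OF F(2)] by blast
qed

section \<open>The ring of chain operators\<close>

text \<open>
  The span \<open>chain_ops V\<close> as an algebra with identity.
\<close>

definition op_algebra :: "'a::order set \<Rightarrow> ('k::field, ('a, 'k) linop) module" where
  "op_algebra V =
     \<lparr>carrier = chain_ops V, monoid.mult = (*), one = 1, zero = 0, add = (+),
      module.smult = (\<lambda>c T. scal c * T)\<rparr>"

lemma op_algebra_simps [simp]:
  "carrier (op_algebra V) = chain_ops V" "a \<otimes>\<^bsub>op_algebra V\<^esub> b = a * b"
  "\<one>\<^bsub>op_algebra V\<^esub> = 1" "\<zero>\<^bsub>op_algebra V\<^esub> = 0" "a \<oplus>\<^bsub>op_algebra V\<^esub> b = a + b"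
  "c \<odot>\<^bsub>op_algebra V\<^esub> a = scal c * a"
  by (simp_all add: op_algebra_def)

lemma ring_op_algebra: "ring (op_algebra V)"
proof (rule ringI)
  show "abelian_group (op_algebra V)"
  proof (rule abelian_groupI)
    show "\<exists>y\<in>carrier (op_algebra V). y \<oplus>\<^bsub>op_algebra V\<^esub> x = \<zero>\<^bsub>op_algebra V\<^esub>"
      if "x \<in> carrier (op_algebra V)" for x
      using that chain_ops_uminus by (intro bexI[of _ "- x"]) auto
  qed (auto simp: chain_ops_0 chain_ops_add algebra_simps)
  show "monoid (op_algebra V)"
    by unfold_locales (auto simp: chain_ops_1 chain_ops_mult mult.assoc)
qed (auto simp: algebra_simps)

lemma ring_of_type_algebra_simps:
  "carrier (ring_of_type_algebra :: 'b::field ring) = UNIV"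
  "\<one>\<^bsub>ring_of_type_algebra\<^esub> = (1 :: 'b)"
  "a \<otimes>\<^bsub>ring_of_type_algebra\<^esub> b = (a * b :: 'b)" "a \<oplus>\<^bsub>ring_of_type_algebra\<^esub> b = (a + b :: 'b)"
  by (simp_all add: ring_of_type_algebra_def)

lemma unital_algebra_op_algebra:
  "unital_algebra (op_algebra V :: ('b::field, ('a::order, 'b) linop) module)"
proof -
  have "Module.module (ring_of_type_algebra :: 'b ring) (op_algebra V :: ('b, ('a, 'b) linop) module)"
  proof (rule moduleI)
    show "cring (ring_of_type_algebra :: 'b ring)" by (rule cring_from_type_algebra)
    show "abelian_group (op_algebra V :: ('b, ('a, 'b) linop) module)" using ring_op_algebra by (rule ring.is_abelian_group)
  qed (simp_all only: ring_of_type_algebra_simps op_algebra_simps chain_ops_scale scal_add scal_mult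
      scal_1 mult_1_left distrib_left distrib_right mult.assoc)
  moreover have "scal c * x * y = scal c * (x * y)" "x * (scal c * y) = scal c * (x * y)"
    for c and x y :: "('a, 'b) linop"
    by (rule mult.assoc) (rule scal_left_commute)
  ultimately show ?thesis
    by (simp add: unital_algebra_def ring_op_algebra)
qed

lemma von_neumann_regular_op_algebra: "von_neumann_regular (op_algebra V)"
  using chain_ops_regular by (auto simp: von_neumann_regular_def)

section \<open>Primeness\<close>

lemma shift_nonzero: "shift p q \<noteq> (0 :: ('a, 'k::field) linop)"
  using shift_independent[of "{(p, q)}" "\<lambda>_. 1 :: 'k" "(p, q)"] by auto

lemma vertex_chain_pairs: "w \<in> V \<Longrightarrow> ([w], [w]) \<in> chain_pairs V"
  by (simp add: chain_pairs_def strict_chain_def)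

text \<open>
  Let \<open>p q\<^sup>*\<close> occur in \<open>a\<close> with nonzero coefficient and with \<open>q\<close> as short as possible, and let \<open>w\<close>
  be a vertex above the end of \<open>p\<close> that does not occur in \<open>a\<close>.  Multiplication by the operators
  \<open>w (p w)\<^sup>*\<close> and \<open>(q w) w\<^sup>*\<close> from the left and from the right annihilates all terms of \<open>a\<close>
  but this one.
\<close>

lemma chain_ops_sandwich:
  fixes V :: "'a::order set" and a :: "('a, 'k::field) linop"
  assumes inf: "infinite V" "\<And>v. v \<in> V \<Longrightarrow> infinite {w\<in>V. v < w}"
    and a: "a \<in> chain_ops V" "a \<noteq> 0"
  shows "\<exists>b\<in>chain_ops V. \<exists>c\<in>chain_ops V. \<exists>w\<in>V. b * a * c = shift [w] [w]"
proof -
  obtain D k where D: "finite D" "D \<subseteq> chain_pairs V"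
    "a = (\<Sum>d\<in>D. scal (k d) * shift (fst d) (snd d))"
    using a(1) by (rule chain_ops_explicit)
  have "\<exists>d. d \<in> D \<and> k d \<noteq> 0" using a(2) unfolding D(3) by (auto intro: sum.neutral)
  then obtain d0 where d0: "d0 \<in> D" "k d0 \<noteq> 0"
    and min: "\<And>d. d \<in> D \<Longrightarrow> k d \<noteq> 0 \<Longrightarrow> length (snd d0) \<le> length (snd d)"
    using ex_has_least_nat[of "\<lambda>d. d \<in> D \<and> k d \<noteq> 0" _ "\<lambda>d. length (snd d)"] by blast
  obtain p q where pq: "d0 = (p, q)" by force
  have pqV: "(p, q) \<in> chain_pairs V" using D(2) d0 pq by blast
  let ?F = "\<Union>d\<in>D. set (fst d) \<union> set (snd d)"
  have "infinite {w\<in>V. p \<noteq> [] \<longrightarrow> last p < w}"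
  proof (cases "p = []")
    case False
    then have "last p \<in> V" using pqV by (auto simp: chain_pairs_def strict_chain_def)
    then show ?thesis using inf(2) False by simp
  qed (simp add: inf)
  moreover have "finite ?F" using D(1) by simp
  ultimately obtain w where w: "w \<in> V" "p \<noteq> [] \<longrightarrow> last p < w" "w \<notin> ?F"
    using finite_subset[of "{w\<in>V. p \<noteq> [] \<longrightarrow> last p < w}" ?F] by blast
  have pw: "(p @ [w], q @ [w]) \<in> chain_pairs V"
    using w pqV by (intro chain_pairs_append) (auto simp: chain_snoc chain_pairs_def)
  have "([w], p @ [w]) \<in> chain_pairs V" "(q @ [w], [w]) \<in> chain_pairs V"
    using pw w(1) by (auto simp: chain_pairs_def same_end_def strict_chain_def)
  then have bc: "scal (1 / k d0) * shift [w] (p @ [w]) \<in> (chain_ops V :: ('a, 'k) linop set)"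
    "shift (q @ [w]) [w] \<in> (chain_ops V :: ('a, 'k) linop set)"
    by (auto intro: shift_in_chain_ops chain_ops_scale)
  have key: "shift [w] (p @ [w]) * shift p' q' * shift (q @ [w]) [w] =
      (if (p', q') = (p, q) then shift [w] [w] else (0 :: ('a, 'k) linop))"
    if d': "(p', q') \<in> D" "k (p', q') \<noteq> 0" for p' q'
  proof -
    have w': "w \<notin> set p'" "w \<notin> set q'" "w \<notin> set p" "w \<notin> set q" using w(3) d' d0 pq by fastforce+
    show ?thesis
    proof (cases "q' = q")
      case True
      show ?thesis
      proof (cases "p' = p")
        case False
        have "p' @ [w] \<noteq> (p @ [w]) @ z" "p @ [w] \<noteq> (p' @ [w]) @ z" for z
          using w' False by (cases z rule: rev_cases; auto)+
        then have "shift [w] (p @ [w]) * shift (p' @ [w]) [w] = (0 :: ('a, 'k) linop)"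
          by (intro shift_mult_incomparable) auto
        then show ?thesis using True False by (simp add: mult.assoc shift_mult_ext_right)
      qed (use True in \<open>simp add: mult.assoc shift_mult_ext_right\<close>)
    next
      case False
      have "q' \<noteq> (q @ [w]) @ z" for z using w' by auto
      moreover have "q @ [w] \<noteq> q' @ z" for z
      proof
        assume *: "q @ [w] = q' @ z"
        then have "z \<noteq> []" using w' by (metis append_Nil2 in_set_conv_decomp)
        then obtain z' where "q = q' @ z'" using * by (cases z rule: rev_cases) auto
        then show False using min[OF d'] pq False by simp
      qed
      ultimately have "shift p' q' * shift (q @ [w]) [w] = (0 :: ('a, 'k) linop)"
        by (rule shift_mult_incomparable[rotated])
      then show ?thesis using False by (simp add: mult.assoc)
    qed
  qed
  have "scal (1 / k d0) * shift [w] (p @ [w]) * a * shift (q @ [w]) [w] =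
      scal (1 / k d0) * (\<Sum>d\<in>D. scal (k d) *
        (shift [w] (p @ [w]) * shift (fst d) (snd d) * shift (q @ [w]) [w]))"
    unfolding D(3) by (simp add: sum_distrib_left sum_distrib_right mult_scal_mult mult.assoc[symmetric])
       (simp add: mult.assoc scal_left_commute[of "shift _ _"])
  also have "(\<Sum>d\<in>D. scal (k d) * (shift [w] (p @ [w]) * shift (fst d) (snd d) * shift (q @ [w]) [w])) =
      (\<Sum>d\<in>D. if d = d0 then scal (k d0) * shift [w] [w] else (0 :: ('a, 'k) linop))"
  proof (rule sum.cong[OF refl])
    fix d assume "d \<in> D"
    then show "scal (k d) * (shift [w] (p @ [w]) * shift (fst d) (snd d) * shift (q @ [w]) [w]) =
        (if d = d0 then scal (k d0) * shift [w] [w] else (0 :: ('a, 'k) linop))"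
      using key[of "fst d" "snd d"] pq by (cases "k d = 0") auto
  qed
  also have "\<dots> = scal (k d0) * shift [w] [w]" using D(1) d0 by simp
  also have "scal (1 / k d0) * (scal (k d0) * shift [w] [w]) = (shift [w] [w] :: ('a, 'k) linop)"
    using d0 by (simp add: mult.assoc[symmetric] scal_mult[symmetric])
  finally show ?thesis using bc w(1) by blast
qed

text \<open>
  A nonzero ideal contains some vertex \<open>w\<close> by the preceding lemma, hence all vertices above \<open>w\<close>.
  As \<open>V\<close> is directed, two nonzero ideals have a common vertex, which is idempotent and so lies in
  their product.
\<close>

lemma prime_op_algebra:
  fixes V :: "'a::order set"
  assumes inf: "infinite V" "\<And>v. v \<in> V \<Longrightarrow> infinite {w\<in>V. v < w}"
    and dir: "\<And>v w. v \<in> V \<Longrightarrow> w \<in> V \<Longrightarrow> \<exists>u\<in>V. v \<le> u \<and> w \<le> u"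
  shows "prime_ring (op_algebra V :: ('k::field, ('a, 'k) linop) module)"
proof -
  let ?R = "op_algebra V :: ('k, ('a, 'k) linop) module"
  have vertex: "\<exists>w\<in>V. \<forall>u\<in>V. w \<le> u \<longrightarrow> shift [u] [u] \<in> I" if I: "ideal I ?R" "I \<noteq> {\<zero>\<^bsub>?R\<^esub>}" for I
  proof -
    interpret ideal I ?R by fact
    obtain a where a: "a \<in> I" "a \<noteq> 0"
      using I(2) additive_subgroup.zero_closed[OF ideal.axioms(1)[OF I(1)]] by auto
    then have "a \<in> chain_ops V" using Icarr by simp
    then obtain b c w where w: "b \<in> chain_ops V" "c \<in> chain_ops V" "w \<in> V" "b * a * c = shift [w] [w]"
      using chain_ops_sandwich[OF inf] a(2) by blast
    have wI: "shift [w] [w] \<in> I"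
      using I_r_closed[OF I_l_closed[OF a(1), of b], of c] w by simp
    have "shift [u] [u] \<in> I" if "u \<in> V" "w \<le> u" for u
    proof (cases "w = u")
      case False
      then have "w < u" using that by simp
      then have "([u], [w] @ [u]) \<in> chain_pairs V" "([w] @ [u], [u]) \<in> chain_pairs V"
        using w(3) that(1) by (auto simp: chain_pairs_def strict_chain_def same_end_def)
      then have "shift [u] ([w] @ [u]) \<in> carrier ?R" "shift ([w] @ [u]) [u] \<in> carrier ?R"
        by (auto intro: shift_in_chain_ops)
      from I_r_closed[OF I_l_closed[OF wI this(1)] this(2)]
      have "shift [u] ([w] @ [u]) * shift [w] [w] * shift ([w] @ [u]) [u] \<in> I" by simp
      also have "shift [u] ([w] @ [u]) * shift [w] [w] * shift ([w] @ [u]) [u] =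
          (shift [u] [u] :: ('a, 'k) linop)"
        unfolding mult.assoc shift_mult_ext_right by (rule shift_mult_same)
      finally show ?thesis .
    qed (use wI in simp)
    then show ?thesis using w(3) by blast
  qed
  show ?thesis
    unfolding prime_ring_def
  proof (intro allI impI notI)
    fix I J assume I: "ideal I ?R" "I \<noteq> {\<zero>\<^bsub>?R\<^esub>}" and J: "ideal J ?R" "J \<noteq> {\<zero>\<^bsub>?R\<^esub>}"
      and zero: "ideal_prod ?R I J = {\<zero>\<^bsub>?R\<^esub>}"
    obtain v w where "v \<in> V" "\<forall>u\<in>V. v \<le> u \<longrightarrow> shift [u] [u] \<in> I"
      "w \<in> V" "\<forall>u\<in>V. w \<le> u \<longrightarrow> shift [u] [u] \<in> J"
      using vertex[OF I] vertex[OF J] by blast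
    then obtain u where "shift [u] [u] \<in> I" "shift [u] [u] \<in> J" using dir by meson
    then have "shift [u] [u] \<otimes>\<^bsub>?R\<^esub> shift [u] [u] \<in> ideal_prod ?R I J" by (rule ideal_prod.prod)
    then have "shift [u] [u] = (0 :: ('a, 'k) linop)" using zero by simp
    then show False using shift_nonzero by blast
  qed
qed

section \<open>Non-primitivity\<close>

text \<open>
  Pairs of paths whose common end lies above \<open>x\<close>; their operators span the two-sided ideal
  generated by the vertex \<open>x\<close>.
\<close>

definition pairs_above :: "'a::order set \<Rightarrow> 'a \<Rightarrow> ('a list \<times> 'a list) set" where
  "pairs_above V x = {(p, q). (p, q) \<in> chain_pairs V \<and> p \<noteq> [] \<and> x \<le> last p}"

definition ideal_above :: "'a::order set \<Rightarrow> 'a \<Rightarrow> ('a, 'k::field) linop set" where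
  "ideal_above V x = linop.span ((\<lambda>d. shift (fst d) (snd d)) ` pairs_above V x)"

lemma shift_in_ideal_above: "(p, q) \<in> pairs_above V x \<Longrightarrow> shift p q \<in> ideal_above V x"
  unfolding ideal_above_def by (rule linop.span_base) force

lemma ideal_above_0: "0 \<in> ideal_above V x"
  and ideal_above_add: "a \<in> ideal_above V x \<Longrightarrow> b \<in> ideal_above V x \<Longrightarrow> a + b \<in> ideal_above V x"
  and ideal_above_scale: "a \<in> ideal_above V x \<Longrightarrow> scal c * a \<in> ideal_above V x"
  unfolding ideal_above_def by (auto intro: linop.span_zero linop.span_add linop.span_scale)

lemma ideal_above_subset: "ideal_above V x \<subseteq> chain_ops V"
  unfolding ideal_above_def chain_ops_def
  by (intro linop.span_mono image_mono) (auto simp: pairs_above_def)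

lemmas ideal_above_induct [consumes 1, case_names zero step] =
  span_shift_induct[where I = "pairs_above V x" for V x, folded ideal_above_def]

lemma ideal_above_mult:
  fixes a b :: "('a::order, 'k::field) linop"
  assumes a: "a \<in> ideal_above V x" and b: "b \<in> chain_ops V"
  shows "a * b \<in> ideal_above V x" "b * a \<in> ideal_above V x"
proof -
  have gen: "shift p q * shift r s \<in> (ideal_above V x :: ('a, 'k) linop set)"
    if "(p, q) \<in> chain_pairs V" "(r, s) \<in> chain_pairs V"
      "(p, q) \<in> pairs_above V x \<or> (r, s) \<in> pairs_above V x" for p q r s
  proof (cases "shift p q * shift r s = (0 :: ('a, 'k) linop)")
    case False
    from that(1,2) False obtain p' q' where *: "(p', q') \<in> chain_pairs V"
      "shift p q * shift r s = (shift p' q' :: ('a, 'k) linop)"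
      "p \<noteq> [] \<longrightarrow> p' \<noteq> [] \<and> last p \<le> last p'" "r \<noteq> [] \<longrightarrow> p' \<noteq> [] \<and> last r \<le> last p'"
      by (rule shift_mult_chain_pairs)
    then have "(p', q') \<in> pairs_above V x"
      using that(3) order_trans unfolding pairs_above_def by auto
    then show ?thesis using *(2) shift_in_ideal_above by metis
  qed (simp add: ideal_above_0)
  have pa: "(p, q) \<in> chain_pairs V" if "(p, q) \<in> pairs_above V x" for p q
    using that by (simp add: pairs_above_def)
  have "shift p q * b \<in> ideal_above V x \<and> b * shift p q \<in> ideal_above V x"
    if pq: "(p, q) \<in> pairs_above V x" for p q
    using b
  proof (induction rule: chain_ops_induct)
    case (step d r s b)
    have "shift p q * shift r s \<in> (ideal_above V x :: ('a, 'k) linop set)"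
      "shift r s * shift p q \<in> (ideal_above V x :: ('a, 'k) linop set)"
      using gen pa[OF pq] pq step.hyps(1) by blast+
    then show ?case
      using step.IH
      by (simp add: distrib_left distrib_right scal_left_commute mult.assoc ideal_above_add ideal_above_scale)
  qed (simp add: ideal_above_0)
  note shift_b = this
  have "a * b \<in> ideal_above V x \<and> b * a \<in> ideal_above V x"
    using a
  proof (induction rule: ideal_above_induct)
    case (step c p q a)
    then show ?case
      using shift_b[OF step.hyps(1)]
      by (simp add: distrib_left distrib_right scal_left_commute[of b] mult.assoc ideal_above_add ideal_above_scale)
  qed (simp add: ideal_above_0)
  then show "a * b \<in> ideal_above V x" "b * a \<in> ideal_above V x" by blast+
qed

text \<open>
  The operator \<open>shift [last r] r\<close> stands for \<open>r\<^sup>*\<close>.  The product \<open>r\<^sup>* p q\<^sup>*\<close> vanishes unless one of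
  \<open>r\<close> and \<open>p\<close> is a prefix of the other, so if \<open>r\<close> does not end above \<open>x\<close>, it has to be one of the
  finitely many prefixes of \<open>p\<close>.
\<close>

lemma finite_exceptions_ideal_above:
  fixes b :: "('a::order, 'k::field) linop"
  assumes "b \<in> ideal_above V x"
  shows "finite {r. strict_chain V r \<and> r \<noteq> [] \<and> \<not> x \<le> last r \<and> shift [last r] r * b \<noteq> 0}"
  using assms
proof (induction rule: ideal_above_induct)
  case (step c p q b)
  let ?A = "{r. strict_chain V r \<and> r \<noteq> [] \<and> \<not> x \<le> last r \<and> shift [last r] r * b \<noteq> 0}"
  have "r \<in> (\<lambda>n. take n p) ` {..length p} \<union> ?A"
    if r: "strict_chain V r" "r \<noteq> []" "\<not> x \<le> last r" "shift [last r] r * (scal c * shift p q + b) \<noteq> 0" for r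
  proof (cases "shift [last r] r * b = 0")
    case True
    with r(4) have "shift [last r] r * shift p q \<noteq> (0 :: ('a, 'k) linop)"
      by (auto simp: distrib_left scal_left_commute)
    then consider z where "p = r @ z" | z where "r = p @ z"
      using shift_mult_incomparable by blast
    then show ?thesis
    proof cases
      case 1
      then have "r = take (length r) p" "length r \<le> length p" by auto
      then show ?thesis by blast
    next
      case 2
      then have "x \<le> last r"
        using step.hyps(1) chain_last_le[of V p z] r(1) order_trans by (auto simp: pairs_above_def)
      then show ?thesis using r(3) by blast
    qed
  qed (use r in blast)
  then have "{r. strict_chain V r \<and> r \<noteq> [] \<and> \<not> x \<le> last r \<and> shift [last r] r * (scal c * shift p q + b) \<noteq> 0}
      \<subseteq> (\<lambda>n. take n p) ` {..length p} \<union> ?A" by blast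
  then show ?case by (rule finite_subset) (use step.IH in simp)
qed simp

text \<open>
  The hypothesis is the failure of the countable separation property: no countable set of vertices
  is such that each vertex lies below one of its members.  Suppose that \<open>M\<close> is simple and faithful,
  and fix \<open>m \<noteq> 0\<close>.  The ideal \<open>I\<close> of a vertex \<open>x\<close> satisfies \<open>I m = M\<close>, so some \<open>b\<close> in \<open>I\<close> fixes \<open>m\<close>.
  Let \<open>Q\<close> be the set of all paths \<open>r\<close> with \<open>r\<^sup>* m \<noteq> 0\<close>.  Expanding \<open>b m = m\<close> shows that some path in
  \<open>Q\<close> ends above \<open>x\<close>, and \<open>r\<^sup>* m = r\<^sup>* b m\<close> shows that all but finitely many paths in \<open>Q\<close> do.  If
  \<open>Q\<close> is finite, choose \<open>x\<close> below none of the ends of its members; if \<open>Q\<close> is infinite, choose \<open>x\<close>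
  below none of the ends of a countably infinite subset.  Either choice is a contradiction.
\<close>

lemma not_left_primitive_op_algebra:
  fixes V :: "'a::order set"
  assumes no_csp: "\<And>C. countable C \<Longrightarrow> C \<subseteq> V \<Longrightarrow> \<exists>x\<in>V. \<forall>c\<in>C. \<not> x \<le> c"
  shows "\<not> left_primitive TYPE('m) (op_algebra V :: ('k::field, ('a, 'k) linop) module)"
proof
  let ?R = "op_algebra V :: ('k, ('a, 'k) linop) module"
  assume "left_primitive TYPE('m) ?R"
  then obtain M :: "(('a, 'k) linop, 'm) module" where simple: "simple_module ?R M"
    and faithful: "faithful_module ?R M"
    unfolding left_primitive_def by blast
  interpret left_module ?R M using simple by (simp add: simple_module_def)
  note closed = smult_closed[simplified]
  have add_l: "(r + s) \<odot>\<^bsub>M\<^esub> y = r \<odot>\<^bsub>M\<^esub> y \<oplus>\<^bsub>M\<^esub> s \<odot>\<^bsub>M\<^esub> y"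
    if "r \<in> chain_ops V" "s \<in> chain_ops V" "y \<in> carrier M" for r s y
    using smult_l_distr that by simp
  have add_r: "r \<odot>\<^bsub>M\<^esub> (y \<oplus>\<^bsub>M\<^esub> z) = r \<odot>\<^bsub>M\<^esub> y \<oplus>\<^bsub>M\<^esub> r \<odot>\<^bsub>M\<^esub> z"
    if "r \<in> chain_ops V" "z \<in> carrier M" "y \<in> carrier M" for r z y
    using smult_r_distr that by simp
  have assoc: "(r * s) \<odot>\<^bsub>M\<^esub> y = r \<odot>\<^bsub>M\<^esub> (s \<odot>\<^bsub>M\<^esub> y)"
    if "r \<in> chain_ops V" "s \<in> chain_ops V" "y \<in> carrier M" for r s y
    using smult_assoc that by simp
  have zero_l: "0 \<odot>\<^bsub>M\<^esub> y = \<zero>\<^bsub>M\<^esub>" if "y \<in> carrier M" for y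
    using add_l[OF chain_ops_0 chain_ops_0 that] closed[OF chain_ops_0 that]
    by (simp add: M.add.r_cancel_one')
  have zero_r: "r \<odot>\<^bsub>M\<^esub> \<zero>\<^bsub>M\<^esub> = \<zero>\<^bsub>M\<^esub>" if "r \<in> chain_ops V" for r
    using add_r[OF that, of "\<zero>\<^bsub>M\<^esub>" "\<zero>\<^bsub>M\<^esub>"] closed[OF that, of "\<zero>\<^bsub>M\<^esub>"]
    by (simp add: M.add.r_cancel_one')
  have minus_l: "(- r) \<odot>\<^bsub>M\<^esub> y = \<ominus>\<^bsub>M\<^esub> (r \<odot>\<^bsub>M\<^esub> y)" if "r \<in> chain_ops V" "y \<in> carrier M" for r y
  proof -
    have "(- r) \<odot>\<^bsub>M\<^esub> y \<oplus>\<^bsub>M\<^esub> r \<odot>\<^bsub>M\<^esub> y = \<zero>\<^bsub>M\<^esub>"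
      using add_l[OF chain_ops_uminus[OF that(1)] that(1,2)] zero_l[OF that(2)] by simp
    then show ?thesis
      using M.minus_equality closed[OF that] closed[OF chain_ops_uminus[OF that(1)] that(2)] by metis
  qed
  have minus_r: "r \<odot>\<^bsub>M\<^esub> (\<ominus>\<^bsub>M\<^esub> y) = \<ominus>\<^bsub>M\<^esub> (r \<odot>\<^bsub>M\<^esub> y)" if "r \<in> chain_ops V" "y \<in> carrier M" for r y
  proof -
    have y': "\<ominus>\<^bsub>M\<^esub> y \<in> carrier M" using that by simp
    have "r \<odot>\<^bsub>M\<^esub> (\<ominus>\<^bsub>M\<^esub> y) \<oplus>\<^bsub>M\<^esub> r \<odot>\<^bsub>M\<^esub> y = \<zero>\<^bsub>M\<^esub>"
      using add_r[OF that(1) that(2) y'] zero_r[OF that(1)] that by (simp add: M.l_neg)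
    then show ?thesis
      using M.minus_equality closed[OF that] closed[OF that(1) y'] by metis
  qed
  have submoduleI: "submodule_of N ?R M"
    if "N \<subseteq> carrier M" "\<zero>\<^bsub>M\<^esub> \<in> N" "\<And>y z. y \<in> N \<Longrightarrow> z \<in> N \<Longrightarrow> y \<oplus>\<^bsub>M\<^esub> z \<in> N"
      "\<And>y. y \<in> N \<Longrightarrow> \<ominus>\<^bsub>M\<^esub> y \<in> N" "\<And>r y. r \<in> chain_ops V \<Longrightarrow> y \<in> N \<Longrightarrow> r \<odot>\<^bsub>M\<^esub> y \<in> N" for N
    using that unfolding submodule_of_def additive_subgroup_def
    by (auto intro!: M.add.subgroupI simp: a_inv_def)
  have simpleD: "N = {\<zero>\<^bsub>M\<^esub>} \<or> N = carrier M" if "submodule_of N ?R M" for N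
    using simple that by (simp add: simple_module_def)
  obtain r y where "r \<in> chain_ops V" "y \<in> carrier M" "r \<odot>\<^bsub>M\<^esub> y \<noteq> \<zero>\<^bsub>M\<^esub>"
    using simple unfolding simple_module_def op_algebra_simps by blast
  then obtain m where m: "m \<in> carrier M" "m \<noteq> \<zero>\<^bsub>M\<^esub>"
    using closed by blast
  have fixes_m: "\<exists>b\<in>ideal_above V x. b \<odot>\<^bsub>M\<^esub> m = m" if "x \<in> V" for x
  proof -
    have sub: "b \<in> chain_ops V" if "b \<in> ideal_above V x" for b :: "('a, 'k) linop"
      using that ideal_above_subset by blast
    define N where "N = {y\<in>carrier M. \<forall>b\<in>ideal_above V x. b \<odot>\<^bsub>M\<^esub> y = \<zero>\<^bsub>M\<^esub>}"
    have "submodule_of N ?R M"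
    proof (rule submoduleI)
      show "N \<subseteq> carrier M" by (auto simp: N_def)
      show "\<zero>\<^bsub>M\<^esub> \<in> N" by (simp add: N_def zero_r sub)
      show "y \<oplus>\<^bsub>M\<^esub> z \<in> N" if "y \<in> N" "z \<in> N" for y z
        using that by (simp add: N_def add_r sub)
      show "\<ominus>\<^bsub>M\<^esub> y \<in> N" if "y \<in> N" for y
        using that by (simp add: N_def minus_r sub)
      show "r \<odot>\<^bsub>M\<^esub> y \<in> N" if "r \<in> chain_ops V" "y \<in> N" for r y
      proof -
        have "b \<odot>\<^bsub>M\<^esub> (r \<odot>\<^bsub>M\<^esub> y) = \<zero>\<^bsub>M\<^esub>" if b: "b \<in> ideal_above V x" for b
          using assoc[OF sub[OF b] \<open>r \<in> chain_ops V\<close>, of y] \<open>y \<in> N\<close>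
            ideal_above_mult(1)[OF b \<open>r \<in> chain_ops V\<close>]
          by (simp add: N_def)
        then show ?thesis using that closed by (simp add: N_def)
      qed
    qed
    moreover have "N \<noteq> carrier M"
    proof
      assume "N = carrier M"
      moreover have "([x], [x]) \<in> pairs_above V x"
        using vertex_chain_pairs[OF that] by (simp add: pairs_above_def)
      ultimately have "\<forall>y\<in>carrier M. shift [x] [x] \<odot>\<^bsub>M\<^esub> y = \<zero>\<^bsub>M\<^esub>"
        using shift_in_ideal_above unfolding N_def by blast
      then have "shift [x] [x] = (0 :: ('a, 'k) linop)"
        using faithful shift_in_chain_ops[OF vertex_chain_pairs[OF that]]
        unfolding faithful_module_def op_algebra_simps by blast
      then show False by (simp add: shift_nonzero)
    qed
    ultimately have "N = {\<zero>\<^bsub>M\<^esub>}" using simpleD[of N] by simp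
    then have "m \<notin> N" using m by simp
    then obtain b0 where b0: "b0 \<in> ideal_above V x" "b0 \<odot>\<^bsub>M\<^esub> m \<noteq> \<zero>\<^bsub>M\<^esub>"
      using m by (auto simp: N_def)
    let ?I = "(\<lambda>b. b \<odot>\<^bsub>M\<^esub> m) ` ideal_above V x"
    have "submodule_of ?I ?R M"
    proof (rule submoduleI)
      show "?I \<subseteq> carrier M" using closed m sub by blast
      show "\<zero>\<^bsub>M\<^esub> \<in> ?I" using zero_l[OF m(1)] ideal_above_0 by force
      show "y \<oplus>\<^bsub>M\<^esub> z \<in> ?I" if "y \<in> ?I" "z \<in> ?I" for y z
      proof -
        obtain b c where bc: "b \<in> ideal_above V x" "c \<in> ideal_above V x" "y = b \<odot>\<^bsub>M\<^esub> m" "z = c \<odot>\<^bsub>M\<^esub> m"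
          using \<open>y \<in> ?I\<close> \<open>z \<in> ?I\<close> by blast
        then have "y \<oplus>\<^bsub>M\<^esub> z = (b + c) \<odot>\<^bsub>M\<^esub> m" using add_l[OF sub sub m(1)] by simp
        then show ?thesis using ideal_above_add[OF bc(1,2)] by (rule image_eqI)
      qed
      show "\<ominus>\<^bsub>M\<^esub> y \<in> ?I" if yI: "y \<in> ?I" for y
      proof -
        obtain b where b: "b \<in> ideal_above V x" "y = b \<odot>\<^bsub>M\<^esub> m" using yI by blast
        have "- b \<in> ideal_above V x"
          using ideal_above_scale[OF b(1), of "-1"] by (simp add: scal_uminus)
        then show ?thesis using minus_l[OF sub[OF b(1)] m(1)] b(2) by (intro image_eqI) simp_all
      qed
      show "r \<odot>\<^bsub>M\<^esub> y \<in> ?I" if r: "r \<in> chain_ops V" "y \<in> ?I" for r y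
      proof -
        obtain b where b: "b \<in> ideal_above V x" "y = b \<odot>\<^bsub>M\<^esub> m" using r(2) by blast
        then show ?thesis
          using assoc[OF r(1) sub[OF b(1)] m(1)] ideal_above_mult(2)[OF b(1) r(1)]
          by (intro image_eqI[of _ _ "r * b"]) simp_all
      qed
    qed
    moreover have "?I \<noteq> {\<zero>\<^bsub>M\<^esub>}"
      using b0 imageI[OF b0(1), of "\<lambda>b. b \<odot>\<^bsub>M\<^esub> m"] by auto
    ultimately have "?I = carrier M" using simpleD[of ?I] by simp
    then show ?thesis using m(1) by (metis imageE)
  qed
  define Q where "Q = {r. strict_chain V r \<and> r \<noteq> [] \<and> shift [last r] r \<odot>\<^bsub>M\<^esub> m \<noteq> \<zero>\<^bsub>M\<^esub>}"
  have last_pair: "(p, [last p]) \<in> chain_pairs V" "([last p], p) \<in> chain_pairs V"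
    if "strict_chain V p" "p \<noteq> []" for p
    using that last_in_set by (fastforce simp: chain_pairs_def strict_chain_def same_end_def)+
  note last_op = shift_in_chain_ops[OF last_pair(1)] shift_in_chain_ops[OF last_pair(2)]
  have cofinite: "finite {r\<in>Q. \<not> x \<le> last r}" if x: "x \<in> V" for x
  proof -
    obtain b where b: "b \<in> ideal_above V x" "b \<odot>\<^bsub>M\<^esub> m = m" using fixes_m[OF x] by blast
    have "shift [last r] r * b \<noteq> 0" if "r \<in> Q" for r
    proof
      assume *: "shift [last r] r * b = 0"
      have r: "strict_chain V r" "r \<noteq> []" using that by (auto simp: Q_def)
      have "shift [last r] r \<odot>\<^bsub>M\<^esub> m = (shift [last r] r * b) \<odot>\<^bsub>M\<^esub> m"
        using assoc[OF last_op(2)[OF r] subsetD[OF ideal_above_subset b(1)] m(1)] b(2) by simp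
      then show False using that * zero_l[OF m(1)] by (simp add: Q_def)
    qed
    then have "{r\<in>Q. \<not> x \<le> last r} \<subseteq>
        {r. strict_chain V r \<and> r \<noteq> [] \<and> \<not> x \<le> last r \<and> shift [last r] r * b \<noteq> 0}"
      by (auto simp: Q_def)
    then show ?thesis using finite_exceptions_ideal_above[OF b(1)] by (rule finite_subset)
  qed
  have covered: "\<exists>r\<in>Q. x \<le> last r" if x: "x \<in> V" for x
  proof (rule ccontr)
    assume not: "\<not> (\<exists>r\<in>Q. x \<le> last r)"
    obtain b where b: "b \<in> ideal_above V x" "b \<odot>\<^bsub>M\<^esub> m = m" using fixes_m[OF x] by blast
    have "b \<odot>\<^bsub>M\<^esub> m = \<zero>\<^bsub>M\<^esub>"
      using b(1)
    proof (induction rule: ideal_above_induct)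
      case zero
      show ?case using zero_l[OF m(1)] .
    next
      case (step c p q b)
      then have pq: "strict_chain V q" "q \<noteq> []" "x \<le> last q" "(p, q) \<in> chain_pairs V"
        by (auto simp: pairs_above_def chain_pairs_def same_end_def)
      then have "q \<notin> Q" using not by blast
      then have q0: "shift [last q] q \<odot>\<^bsub>M\<^esub> m = \<zero>\<^bsub>M\<^esub>" using pq by (simp add: Q_def)
      have pl: "scal c * shift p [last q] \<in> (chain_ops V :: ('a, 'k) linop set)"
        using chain_pairs_trans[OF pq(4) last_pair(1)[OF pq(1,2)]]
        by (intro chain_ops_scale shift_in_chain_ops)
      have "(scal c * shift p q) \<odot>\<^bsub>M\<^esub> m =
          ((scal c * shift p [last q]) * shift [last q] q) \<odot>\<^bsub>M\<^esub> m"
        by (simp add: mult.assoc)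
      also have "\<dots> = \<zero>\<^bsub>M\<^esub>"
        using assoc[OF pl last_op(2)[OF pq(1,2)] m(1)] q0 zero_r[OF pl] by simp
      finally show ?case
        using step.IH add_l[OF chain_ops_scale[OF shift_in_chain_ops[OF pq(4)]] subsetD[OF ideal_above_subset step.hyps(2)] m(1)]
        by simp
    qed
    then show False using b(2) m(2) by simp
  qed
  have last_V: "last r \<in> V" if "r \<in> Q" for r
    using that last_in_set by (fastforce simp: Q_def strict_chain_def)
  show False
  proof (cases "finite Q")
    case True
    then obtain x where "x \<in> V" "\<forall>c\<in>last ` Q. \<not> x \<le> c"
      using no_csp[of "last ` Q"] last_V by (auto simp: countable_finite)
    then show False using covered by blast
  next
    case False
    then obtain D where D: "D \<subseteq> Q" "infinite D" "countable D"
      using infinite_countable_subset' by metis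
    then obtain x where x: "x \<in> V" "\<forall>c\<in>last ` D. \<not> x \<le> c"
      using no_csp[of "last ` D"] last_V by blast
    then have "D \<subseteq> {r\<in>Q. \<not> x \<le> last r}" using D(1) by blast
    then show False using cofinite[OF x(1)] D(2) finite_subset by blast
  qed
qed


section \<open>Cardinality\<close>

unbundle cardinal_syntax

lemma card_of_finite_ordLeq_infinite: "finite A \<Longrightarrow> infinite B \<Longrightarrow> |A| \<le>o |B|"
  by (meson card_of_Well_order card_of_ordLeq_finite ordLeq_total)

lemma card_of_lists_length:
  assumes "infinite V"
  shows "|{p. length p = n \<and> set p \<subseteq> V}| \<le>o |V|"
proof (induction n)
  case 0
  have "finite {p. length p = 0 \<and> set p \<subseteq> V}" by (rule finite_subset[of _ "{[]}"]) auto
  then show ?case using assms by (rule card_of_finite_ordLeq_infinite)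
next
  case (Suc n)
  have "{p. length p = Suc n \<and> set p \<subseteq> V} = (\<Union>v\<in>V. (#) v ` {p. length p = n \<and> set p \<subseteq> V})"
    by (auto simp: length_Suc_conv)
  also have "|\<dots>| \<le>o |V|"
  proof (rule card_of_UNION_ordLeq_infinite[OF assms])
    show "|V| \<le>o |V|" by (rule card_of_mono1) simp
    show "\<forall>v\<in>V. |(#) v ` {p. length p = n \<and> set p \<subseteq> V}| \<le>o |V|"
      using card_of_image Suc.IH ordLeq_transitive by blast
  qed
  finally show ?case .
qed

lemma card_of_lists_ordLeq:
  assumes "infinite V"
  shows "|{p. set p \<subseteq> V}| \<le>o |V|"
proof -
  have "{p. set p \<subseteq> V} = (\<Union>n. {p. length p = n \<and> set p \<subseteq> V})" by blast
  also have "|\<dots>| \<le>o |V|"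
  proof (rule card_of_UNION_ordLeq_infinite[OF assms])
    show "|UNIV :: nat set| \<le>o |V|" using assms by (simp add: infinite_iff_card_of_nat)
  qed (use card_of_lists_length[OF assms] in blast)
  finally show ?thesis .
qed

lemma card_of_chain_pairs:
  assumes "infinite V"
  shows "|chain_pairs V| \<le>o |V|"
proof -
  have "chain_pairs V \<subseteq> {p. set p \<subseteq> V} \<times> {p. set p \<subseteq> V}"
    by (auto simp: chain_pairs_def strict_chain_def)
  then have "|chain_pairs V| \<le>o |{p. set p \<subseteq> V} \<times> {p. set p \<subseteq> V}|" by (rule card_of_mono1)
  also have "|{p. set p \<subseteq> V} \<times> {p. set p \<subseteq> V}| \<le>o |V|"
    using assms card_of_lists_ordLeq[OF assms] by (intro card_of_Sigma_ordLeq_infinite) auto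
  finally show ?thesis .
qed

text \<open>
  Each image of a spanning operator involves only finitely many elements of \<open>W\<close>.  All images
  together involve a set \<open>U\<close> of elements that is not larger than \<open>V\<close>, and surjectivity forces
  \<open>W \<subseteq> U\<close>.
\<close>

lemma card_of_surj_chain_ops:
  fixes V :: "'a::order set" and W :: "'b::order set" and H :: "('a, 'k::field) linop \<Rightarrow> ('b, 'k) linop"
  assumes inf: "infinite V"
    and add: "\<And>a b. a \<in> chain_ops V \<Longrightarrow> b \<in> chain_ops V \<Longrightarrow> H (a + b) = H a + H b"
    and scale: "\<And>c a. a \<in> chain_ops V \<Longrightarrow> H (scal c * a) = scal c * H a"
    and surj: "H ` chain_ops V = chain_ops W"
  shows "|W| \<le>o |V|"
proof -
  have "\<exists>F. finite F \<and> F \<subseteq> W \<and> H (shift (fst d) (snd d)) \<in> chain_ops F" if "d \<in> chain_pairs V" for d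
  proof -
    have "shift (fst d) (snd d) \<in> (chain_ops V :: ('a, 'k) linop set)"
      using that by (intro shift_in_chain_ops) simp
    then show ?thesis using surj by (intro chain_ops_local) blast
  qed
  then obtain F where F: "\<And>d. d \<in> chain_pairs V \<Longrightarrow>
      finite (F d) \<and> F d \<subseteq> W \<and> H (shift (fst d) (snd d)) \<in> chain_ops (F d)" by metis
  let ?U = "\<Union>d\<in>chain_pairs V. F d"
  have H_U: "H a \<in> chain_ops ?U" if "a \<in> chain_ops V" for a
    using that
  proof (induction rule: chain_ops_induct)
    case zero
    have "H 0 = 0" using scale[OF chain_ops_0, of 0] by simp
    then show ?case by (simp add: chain_ops_0)
  next
    case (step c p q b)
    have s: "shift p q \<in> (chain_ops V :: ('a, 'k) linop set)"
      using step.hyps(1) by (rule shift_in_chain_ops)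
    have "F (p, q) \<subseteq> ?U" using step.hyps(1) by blast
    moreover have "H (shift p q) \<in> chain_ops (F (p, q))" using F[OF step.hyps(1)] by simp
    ultimately have "H (shift p q) \<in> chain_ops ?U" using chain_ops_mono by blast
    then show ?case
      unfolding add[OF chain_ops_scale[OF s] step.hyps(2)] scale[OF s]
      by (intro chain_ops_add chain_ops_scale step.IH)
  qed
  have sub: "chain_ops W \<subseteq> (chain_ops ?U :: ('b, 'k) linop set)"
    unfolding surj[symmetric] by (rule image_subsetI) (rule H_U)
  have "W \<subseteq> ?U"
  proof
    fix w assume "w \<in> W"
    then have "shift [w] [w] \<in> (chain_ops W :: ('b, 'k) linop set)"
      by (intro shift_in_chain_ops vertex_chain_pairs)
    then have "([w], [w]) \<in> chain_pairs ?U" by (rule shift_in_chain_opsD[OF subsetD[OF sub]])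
    then show "w \<in> ?U" by (simp add: chain_pairs_def strict_chain_def)
  qed
  then have "|W| \<le>o |?U|" by (rule card_of_mono1)
  also have "|?U| \<le>o |V|"
  proof (rule card_of_UNION_ordLeq_infinite[OF inf card_of_chain_pairs[OF inf]])
    show "\<forall>d\<in>chain_pairs V. |F d| \<le>o |V|"
      using F card_of_finite_ordLeq_infinite[OF _ inf] by blast
  qed
  finally show ?thesis .
qed

section \<open>The poset of nonempty finite subsets\<close>

lemma infinite_supersets:
  assumes "infinite S" "A \<in> nonempty_finite_subsets S"
  shows "infinite {B\<in>nonempty_finite_subsets S. A < B}"
proof
  assume "finite {B\<in>nonempty_finite_subsets S. A < B}"
  moreover have "(\<lambda>x. insert x A) ` (S - A) \<subseteq> {B\<in>nonempty_finite_subsets S. A < B}"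
    using assms(2) by (auto simp: nonempty_finite_subsets_def)
  ultimately have "finite ((\<lambda>x. insert x A) ` (S - A))" by (rule rev_finite_subset)
  moreover have "inj_on (\<lambda>x. insert x A) (S - A)" by (auto simp: inj_on_def)
  ultimately have "finite (S - A)" by (rule finite_imageD)
  then show False using assms by (auto simp: nonempty_finite_subsets_def)
qed

lemma lepoll_nonempty_finite_subsets: "S \<lesssim> nonempty_finite_subsets S"
  unfolding lepoll_def
  by (rule exI[of _ "\<lambda>x. {x}"]) (auto simp: inj_on_def nonempty_finite_subsets_def)

lemma infinite_nonempty_finite_subsets: "infinite S \<Longrightarrow> infinite (nonempty_finite_subsets S)"
  using lepoll_nonempty_finite_subsets by (meson lepoll_trans infinite_le_lepoll)

lemma nonempty_finite_subsets_lepoll: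
  assumes "infinite S"
  shows "nonempty_finite_subsets S \<lesssim> S"
proof -
  have "nonempty_finite_subsets S \<subseteq> set ` {p. set p \<subseteq> S}"
    by (auto simp: nonempty_finite_subsets_def image_iff) (metis finite_list)
  then have "|nonempty_finite_subsets S| \<le>o |set ` {p. set p \<subseteq> S}|" by (rule card_of_mono1)
  also have "|set ` {p. set p \<subseteq> S}| \<le>o |{p. set p \<subseteq> S}|" by (rule card_of_image)
  also have "|{p. set p \<subseteq> S}| \<le>o |S|" using assms by (rule card_of_lists_ordLeq)
  finally show ?thesis by (simp add: lepoll_def card_of_ordLeq)
qed

text \<open>
  A countable family of finite sets has countable union; the singleton of a point outside the
  union is not contained in any member.
\<close>

lemma no_countable_cover:
  assumes "uncountable S" "countable C" "C \<subseteq> nonempty_finite_subsets S"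
  shows "\<exists>A\<in>nonempty_finite_subsets S. \<forall>c\<in>C. \<not> A \<le> c"
proof -
  have "countable (\<Union>C)"
    using countable_UN[OF assms(2), of "\<lambda>c. c"] assms(3)
    by (simp add: nonempty_finite_subsets_def countable_finite subset_iff)
  then obtain x where "x \<in> S" "x \<notin> \<Union>C" using assms(1) by (metis countable_subset subsetI)
  then show ?thesis by (intro bexI[of _ "{x}"]) (auto simp: nonempty_finite_subsets_def)
qed

lemma directed_nonempty_finite_subsets:
  "A \<in> nonempty_finite_subsets S \<Longrightarrow> B \<in> nonempty_finite_subsets S \<Longrightarrow>
   \<exists>C\<in>nonempty_finite_subsets S. A \<le> C \<and> B \<le> C"
  by (rule bexI[of _ "A \<union> B"]) (auto simp: nonempty_finite_subsets_def)

section \<open>Invariance under ring isomorphisms\<close>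

lemma prime_ring_iso:
  assumes "ring R" "ring S" and h: "h \<in> ring_iso R S" and prime: "prime_ring R"
  shows "prime_ring S"
proof -
  interpret R: ring R by fact
  interpret S: ring S by fact
  have hom: "h \<in> ring_hom R S" and bij: "bij_betw h (carrier R) (carrier S)"
    using h by (auto simp: ring_iso_def)
  interpret h: ring_hom_ring R S h by (rule ring_hom_ringI2) (fact+)
  have h0: "x = \<zero>\<^bsub>R\<^esub>" if "x \<in> carrier R" "h x = \<zero>\<^bsub>S\<^esub>" for x
    using that bij h.hom_zero R.zero_closed unfolding bij_betw_def inj_on_def by metis
  have pre: "ideal {r\<in>carrier R. h r \<in> I} R" "{r\<in>carrier R. h r \<in> I} \<noteq> {\<zero>\<^bsub>R\<^esub>}"
    if I: "ideal I S" "I \<noteq> {\<zero>\<^bsub>S\<^esub>}" for I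
  proof -
    show "ideal {r\<in>carrier R. h r \<in> I} R" using h.ideal_vimage[OF I(1)] .
    obtain y where "y \<in> I" "y \<noteq> \<zero>\<^bsub>S\<^esub>"
      using I additive_subgroup.zero_closed[OF ideal.axioms(1)[OF I(1)]] by auto
    moreover from this obtain x where "x \<in> carrier R" "y = h x"
      using bij ideal.Icarr[OF I(1)] unfolding bij_betw_def by (metis imageE)
    ultimately have "x \<in> {r\<in>carrier R. h r \<in> I}" "x \<noteq> \<zero>\<^bsub>R\<^esub>" using h.hom_zero by auto
    then show "{r\<in>carrier R. h r \<in> I} \<noteq> {\<zero>\<^bsub>R\<^esub>}" by blast
  qed
  show ?thesis
    unfolding prime_ring_def
  proof (intro allI impI notI)
    fix I J assume I: "ideal I S" "I \<noteq> {\<zero>\<^bsub>S\<^esub>}" and J: "ideal J S" "J \<noteq> {\<zero>\<^bsub>S\<^esub>}"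
      and zero: "ideal_prod S I J = {\<zero>\<^bsub>S\<^esub>}"
    let ?P = "ideal_prod R {r\<in>carrier R. h r \<in> I} {r\<in>carrier R. h r \<in> J}"
    have P: "x \<in> carrier R \<and> h x \<in> ideal_prod S I J" if "x \<in> ?P" for x
      using that
    proof (induction rule: ideal_prod.induct)
      case (prod i j)
      then show ?case using ideal_prod.prod[of "h i" I "h j" J S] by simp
    next
      case (sum s t)
      then show ?case using ideal_prod.sum[of "h s" S I J "h t"] by simp
    qed
    then have "?P \<subseteq> {\<zero>\<^bsub>R\<^esub>}" using zero h0 by blast
    moreover have "\<zero>\<^bsub>R\<^esub> \<in> ?P"
      using additive_subgroup.zero_closed[OF ideal.axioms(1)[OF R.ideal_prod_is_ideal[OF pre(1)[OF I] pre(1)[OF J]]]] .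
    ultimately have "?P = {\<zero>\<^bsub>R\<^esub>}" by blast
    then show False using prime pre[OF I] pre[OF J] unfolding prime_ring_def by blast
  qed
qed

lemma left_primitive_ring_iso:
  assumes "ring R" "ring S" and h: "h \<in> ring_iso R S" and prim: "left_primitive TYPE('m) S"
  shows "left_primitive TYPE('m) R"
proof -
  interpret R: ring R by fact
  interpret S: ring S by fact
  have hom: "h \<in> ring_hom R S" and bij: "bij_betw h (carrier R) (carrier S)"
    using h by (auto simp: ring_iso_def)
  interpret h: ring_hom_ring R S h by (rule ring_hom_ringI2) (fact+)
  have hR: "h ` carrier R = carrier S" using bij by (simp add: bij_betw_def)
  obtain M :: "(_, 'm) module" where simple: "simple_module S M" and faithful: "faithful_module S M"
    using prim unfolding left_primitive_def by blast
  interpret M: left_module S M using simple by (simp add: simple_module_def)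
  define N :: "(_, 'm) module" where
    "N = \<lparr>carrier = carrier M, monoid.mult = undefined, one = undefined, zero = \<zero>\<^bsub>M\<^esub>,
       add = add M, module.smult = (\<lambda>r x. h r \<odot>\<^bsub>M\<^esub> x)\<rparr>"
  have N: "carrier N = carrier M" "\<zero>\<^bsub>N\<^esub> = \<zero>\<^bsub>M\<^esub>" "add N = add M" "r \<odot>\<^bsub>N\<^esub> x = h r \<odot>\<^bsub>M\<^esub> x" for r x
    by (simp_all add: N_def)
  have "abelian_group N"
  proof (rule abelian_groupI)
    show "\<exists>y\<in>carrier N. y \<oplus>\<^bsub>N\<^esub> x = \<zero>\<^bsub>N\<^esub>" if "x \<in> carrier N" for x
      using that M.M.l_neg[of x] by (intro bexI[of _ "\<ominus>\<^bsub>M\<^esub> x"]) (simp_all add: N)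
  qed (simp_all add: N M.M.add.m_ac)
  then have "left_module R N"
    by (auto simp: left_module_def left_module_axioms_def N M.smult_closed M.smult_l_distr
        M.smult_r_distr M.smult_assoc)
  moreover have "submodule_of I R N \<longleftrightarrow> submodule_of I S M" for I
    unfolding submodule_of_def additive_subgroup_def subgroup_def m_inv_def hR[symmetric]
    by (simp add: N)
  moreover have "\<exists>r\<in>carrier R. \<exists>x\<in>carrier N. r \<odot>\<^bsub>N\<^esub> x \<noteq> \<zero>\<^bsub>N\<^esub>"
    using simple unfolding simple_module_def N hR[symmetric] by auto
  ultimately have "simple_module R N"
    using simple by (simp add: simple_module_def N)
  moreover have "faithful_module R N"
    unfolding faithful_module_def N
  proof (intro ballI impI)
    fix r assume r: "r \<in> carrier R" "\<forall>x\<in>carrier M. h r \<odot>\<^bsub>M\<^esub> x = \<zero>\<^bsub>M\<^esub>"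
    then have "h r = \<zero>\<^bsub>S\<^esub>" using faithful by (simp add: faithful_module_def)
    then show "r = \<zero>\<^bsub>R\<^esub>"
      using r bij h.hom_zero R.zero_closed unfolding bij_betw_def inj_on_def by metis
  qed
  ultimately show ?thesis unfolding left_primitive_def by blast
qed

lemma von_neumann_regular_ring_iso:
  assumes h: "h \<in> ring_iso R S" and "ring R" and R: "von_neumann_regular R"
  shows "von_neumann_regular S"
  unfolding von_neumann_regular_def
proof
  interpret R: ring R by fact
  fix b assume "b \<in> carrier S"
  then obtain a where a: "a \<in> carrier R" "b = h a"
    using ring_iso_memE(5)[OF h] by (auto simp: bij_betw_def)
  then obtain x where x: "x \<in> carrier R" "a = a \<otimes>\<^bsub>R\<^esub> x \<otimes>\<^bsub>R\<^esub> a" using R by (auto simp: von_neumann_regular_def)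
  have "h a = h a \<otimes>\<^bsub>S\<^esub> h x \<otimes>\<^bsub>S\<^esub> h a"
    using arg_cong[OF x(2), of h] a(1) x(1) by (simp add: ring_iso_memE(2)[OF h])
  then show "\<exists>x\<in>carrier S. b = b \<otimes>\<^bsub>S\<^esub> x \<otimes>\<^bsub>S\<^esub> b"
    using a(2) x(1) ring_iso_memE(1)[OF h] by blast
qed

section \<open>The free algebra and its evaluation\<close>

lemma poly_mapping_sum_single:
  fixes f :: "'a \<Rightarrow>\<^sub>0 'b::comm_monoid_add"
  shows "f = (\<Sum>w\<in>Poly_Mapping.keys f. Poly_Mapping.single w (Poly_Mapping.lookup f w))"
proof (rule poly_mapping_eqI)
  fix v
  have "Poly_Mapping.lookup (\<Sum>w\<in>Poly_Mapping.keys f. Poly_Mapping.single w (Poly_Mapping.lookup f w)) v =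
      (\<Sum>w\<in>Poly_Mapping.keys f. if w = v then Poly_Mapping.lookup f v else 0)"
    unfolding lookup_sum by (rule sum.cong) (auto simp: lookup_single when_def)
  then show "Poly_Mapping.lookup f v =
      Poly_Mapping.lookup (\<Sum>w\<in>Poly_Mapping.keys f. Poly_Mapping.single w (Poly_Mapping.lookup f w)) v"
    by (simp add: in_keys_iff)
qed

lemma poly_mapping_induct_single [case_names zero single]:
  fixes f :: "'a \<Rightarrow>\<^sub>0 'b::comm_monoid_add"
  assumes "P 0"
    and "\<And>w g. w \<in> Poly_Mapping.keys f \<Longrightarrow> P g \<Longrightarrow>
      P (Poly_Mapping.single w (Poly_Mapping.lookup f w) + g)"
  shows "P f"
proof -
  have "P (\<Sum>w\<in>A. Poly_Mapping.single w (Poly_Mapping.lookup f w))"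
    if "finite A" "A \<subseteq> Poly_Mapping.keys f" for A
    using that by (induction A rule: finite_induct) (auto intro: assms)
  from this[OF finite_keys order_refl] show ?thesis
    by (subst poly_mapping_sum_single)
qed

type_synonym 'x gens = "('x set, 'x set \<times> 'x set) lpa_generator"

text \<open>
  \<open>gen_op\<close> realizes the generators as operators, and \<open>eval_op\<close> is the homomorphism from the free
  algebra that extends it.
\<close>

fun gen_op :: "'x gens \<Rightarrow> ('x set, 'k::field) linop" where
  "gen_op (Vertex A) = shift [A] [A]"
| "gen_op (Edge (A, B)) = shift [A, B] [B]"
| "gen_op (Ghost (A, B)) = shift [B] [A, B]"

definition word_op :: "'x gens list \<Rightarrow> ('x set, 'k::field) linop" where
  "word_op ws = prod_list (map gen_op ws)"

definition eval_op :: "('x gens free_word \<Rightarrow>\<^sub>0 'k::field) \<Rightarrow> ('x set, 'k) linop" where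
  "eval_op f = (\<Sum>w\<in>Poly_Mapping.keys f. scal (Poly_Mapping.lookup f w) * word_op (letters w))"

lemma word_op_simps [simp]: "word_op [] = 1" "word_op (x # ws) = gen_op x * word_op ws"
  "word_op (us @ vs) = word_op us * word_op vs"
  by (simp_all add: word_op_def)

lemma eval_op_superset:
  assumes "finite K" "Poly_Mapping.keys f \<subseteq> K"
  shows "eval_op f = (\<Sum>w\<in>K. scal (Poly_Mapping.lookup f w) * word_op (letters w))"
  unfolding eval_op_def using assms
  by (intro sum.mono_neutral_left) (auto simp: in_keys_iff)

lemma eval_op_0 [simp]: "eval_op 0 = 0"
  by (simp add: eval_op_def)

lemma eval_op_add: "eval_op (f + g) = eval_op f + eval_op g"
proof -
  let ?K = "Poly_Mapping.keys f \<union> Poly_Mapping.keys g"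
  have "Poly_Mapping.keys (f + g) \<subseteq> ?K" by (rule keys_add)
  then show ?thesis
    by (simp add: eval_op_superset[of ?K] lookup_add scal_add distrib_right sum.distrib)
qed

lemma eval_op_single: "eval_op (Poly_Mapping.single w c) = scal c * word_op (letters w)"
  by (cases "c = 0") (auto simp: eval_op_def)

lemma eval_op_mult_single:
  "eval_op (Poly_Mapping.single w c * g) = scal c * word_op (letters w) * eval_op g"
proof (induction g rule: poly_mapping_induct_single)
  case (single v h)
  show ?case
    unfolding distrib_left eval_op_add single.IH mult_single eval_op_single
    by (simp only: plus_free_word_def free_word.sel word_op_simps scal_mult_scal)
qed simp

lemma eval_op_mult: "eval_op (f * g) = eval_op f * eval_op g"
proof (induction f rule: poly_mapping_induct_single)
  case (single v h)
  show ?case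
    unfolding distrib_right eval_op_add single.IH eval_op_mult_single eval_op_single ..
qed simp

lemma eval_op_uminus: "eval_op (- f) = - eval_op f"
  using eval_op_add[of f "- f"] by (simp add: eq_neg_iff_add_eq_0 add.commute)

lemma eval_op_diff: "eval_op (f - g) = eval_op f - eval_op g"
  using eval_op_add[of f "- g"] by (simp add: eval_op_uminus)

lemma eval_op_sum: "eval_op (sum f A) = (\<Sum>x\<in>A. eval_op (f x))"
  by (induction A rule: infinite_finite_induct) (auto simp: eval_op_add)

lemma eval_op_scale: "eval_op (Poly_Mapping.single 0 c * f) = scal c * eval_op f"
  by (simp add: eval_op_mult_single zero_free_word_def)

text \<open>
  The monomial of a word, as an element of the free algebra.
\<close>

definition word_mon :: "'g list \<Rightarrow> 'g free_word \<Rightarrow>\<^sub>0 'k::field" where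
  "word_mon ws = Poly_Mapping.single (Word ws) 1"

lemma mon_append: "word_mon (us @ vs) = word_mon us * word_mon vs"
  by (simp add: word_mon_def mult_single plus_free_word_def)

lemma mon_pair: "word_mon [x, y] = word_mon [x] * word_mon [y]"
  and mon_Cons: "word_mon (x # us) = word_mon [x] * word_mon us"
  by (simp_all flip: mon_append)

lemma mon_Nil [simp]: "word_mon [] = 1"
  by (simp add: word_mon_def zero_free_word_def[symmetric])

lemma eval_op_mon: "eval_op (word_mon ws) = word_op ws"
  by (simp add: word_mon_def eval_op_single)

lemma generator_mon: "vertex v = word_mon [Vertex v]" "edge e = word_mon [Edge e]" "ghost e = word_mon [Ghost e]"
  by (simp_all add: vertex_def edge_def ghost_def word_mon_def)

section \<open>The defining ideal\<close>

abbreviation gens :: "'x set \<Rightarrow> 'x gens set" where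
  "gens S \<equiv> lpa_generators (finite_subset_graph S)"

abbreviation free_alg :: "'x set \<Rightarrow> ('k::field, 'x gens free_word \<Rightarrow>\<^sub>0 'k) module" where
  "free_alg S \<equiv> free_algebra (gens S)"

text \<open>
  The ideal of the free algebra by which the Leavitt path algebra is defined.
\<close>

definition lpa_ideal :: "'x set \<Rightarrow> ('x gens free_word \<Rightarrow>\<^sub>0 'k::field) set" where
  "lpa_ideal S = alg_ideal_gen (free_alg S) (lpa_relations (finite_subset_graph S))"

lemma free_algebra_simps [simp]:
  "f \<otimes>\<^bsub>free_algebra G\<^esub> g = f * g" "f \<oplus>\<^bsub>free_algebra G\<^esub> g = f + g"
  "\<zero>\<^bsub>free_algebra G\<^esub> = 0" "c \<odot>\<^bsub>free_algebra G\<^esub> f = Poly_Mapping.single 0 c * f"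
  by (simp_all add: free_algebra_def)

lemma in_free_algebra:
  "f \<in> carrier (free_algebra G) \<longleftrightarrow> (\<forall>w\<in>Poly_Mapping.keys f. letters w \<noteq> [] \<and> set (letters w) \<subseteq> G)"
  by (simp add: free_algebra_def)

lemma free_algebra_add:
  "f \<in> carrier (free_algebra G) \<Longrightarrow> g \<in> carrier (free_algebra G) \<Longrightarrow> f + g \<in> carrier (free_algebra G)"
  using keys_add[of f g] by (auto simp: in_free_algebra)

lemma free_algebra_mult:
  assumes "f \<in> carrier (free_algebra G)" "g \<in> carrier (free_algebra G)"
  shows "f * g \<in> carrier (free_algebra G)"
  unfolding in_free_algebra
proof
  fix w assume "w \<in> Poly_Mapping.keys (f * g)"
  then obtain u v where "u \<in> Poly_Mapping.keys f" "v \<in> Poly_Mapping.keys g" "w = u + v"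
    using keys_mult[of f g] by blast
  then show "letters w \<noteq> [] \<and> set (letters w) \<subseteq> G"
    using assms by (auto simp: in_free_algebra plus_free_word_def)
qed

lemma free_algebra_scale:
  assumes "f \<in> carrier (free_algebra G)"
  shows "Poly_Mapping.single 0 c * f \<in> carrier (free_algebra G)"
  unfolding in_free_algebra
proof
  fix w assume "w \<in> Poly_Mapping.keys (Poly_Mapping.single 0 c * f)"
  then obtain v where "v \<in> Poly_Mapping.keys f" "w = v"
    using keys_mult[of "Poly_Mapping.single 0 c" f] by (fastforce split: if_splits)
  then show "letters w \<noteq> [] \<and> set (letters w) \<subseteq> G"
    using assms by (auto simp: in_free_algebra)
qed

lemma free_algebra_0: "0 \<in> carrier (free_algebra G)"
  by (simp add: in_free_algebra)

lemma free_algebra_uminus: "f \<in> carrier (free_algebra G) \<Longrightarrow> - f \<in> carrier (free_algebra G)"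
  by (simp add: in_free_algebra)

lemma free_algebra_diff:
  "f \<in> carrier (free_algebra G) \<Longrightarrow> g \<in> carrier (free_algebra G) \<Longrightarrow> f - g \<in> carrier (free_algebra G)"
  using free_algebra_add[of f G "- g"] free_algebra_uminus[of g G] by simp

lemma mon_in_free_algebra: "ws \<noteq> [] \<Longrightarrow> set ws \<subseteq> G \<Longrightarrow> word_mon ws \<in> carrier (free_algebra G)"
  by (simp add: in_free_algebra word_mon_def)

lemma lpa_ideal_0: "0 \<in> lpa_ideal S"
  and lpa_ideal_rel: "r \<in> lpa_relations (finite_subset_graph S) \<Longrightarrow> r \<in> lpa_ideal S"
  and lpa_ideal_add: "f \<in> lpa_ideal S \<Longrightarrow> g \<in> lpa_ideal S \<Longrightarrow> f + g \<in> lpa_ideal S"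
  and lpa_ideal_scale: "f \<in> lpa_ideal S \<Longrightarrow> Poly_Mapping.single 0 c * f \<in> lpa_ideal S"
  and lpa_ideal_lmult: "g \<in> carrier (free_alg S) \<Longrightarrow> f \<in> lpa_ideal S \<Longrightarrow> g * f \<in> lpa_ideal S"
  and lpa_ideal_rmult: "g \<in> carrier (free_alg S) \<Longrightarrow> f \<in> lpa_ideal S \<Longrightarrow> f * g \<in> lpa_ideal S"
  unfolding lpa_ideal_def
  using alg_ideal_gen.intros[where A = "free_alg S" and S = "lpa_relations (finite_subset_graph S)"]
  by simp_all

lemma lpa_ideal_uminus: "f \<in> lpa_ideal S \<Longrightarrow> - f \<in> lpa_ideal S"
  using lpa_ideal_scale[of f S "-1"] by (simp add: single_uminus)

lemma lpa_ideal_sum: "(\<And>x. x \<in> A \<Longrightarrow> f x \<in> lpa_ideal S) \<Longrightarrow> sum f A \<in> lpa_ideal S"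
  by (induction A rule: infinite_finite_induct) (auto simp: lpa_ideal_0 lpa_ideal_add)

lemma graph_simps [simp]:
  "verts (finite_subset_graph S) = nonempty_finite_subsets S"
  "(A, B) \<in> arcs (finite_subset_graph S) \<longleftrightarrow>
    A \<in> nonempty_finite_subsets S \<and> B \<in> nonempty_finite_subsets S \<and> A < B"
  "tail (finite_subset_graph S) e = fst e" "head (finite_subset_graph S) e = snd e"
  by (auto simp: finite_subset_graph_def)

lemma gens_simps [simp]:
  "Vertex A \<in> gens S \<longleftrightarrow> A \<in> nonempty_finite_subsets S"
  "Edge (A, B) \<in> gens S \<longleftrightarrow> (A, B) \<in> arcs (finite_subset_graph S)"
  "Ghost (A, B) \<in> gens S \<longleftrightarrow> (A, B) \<in> arcs (finite_subset_graph S)"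
  by (auto simp: lpa_generators_def)

lemma infinite_out_arcs:
  assumes "infinite S" "A \<in> nonempty_finite_subsets S"
  shows "infinite (out_arcs (finite_subset_graph S) A)"
proof
  assume "finite (out_arcs (finite_subset_graph S) A)"
  then have "finite (snd ` out_arcs (finite_subset_graph S) A)" by (rule finite_imageI)
  moreover have "{B\<in>nonempty_finite_subsets S. A < B} \<subseteq> snd ` out_arcs (finite_subset_graph S) A"
  proof
    fix B assume "B \<in> {B\<in>nonempty_finite_subsets S. A < B}"
    then have "(A, B) \<in> out_arcs (finite_subset_graph S) A"
      using assms(2) by (simp add: out_arcs_def)
    then show "B \<in> snd ` out_arcs (finite_subset_graph S) A" by (rule rev_image_eqI) simp
  qed
  ultimately show False using infinite_supersets[OF assms] finite_subset by blast
qed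

text \<open>
  The relations hold for the operators.  There is nothing to check for (CK2), because every vertex
  emits infinitely many edges.
\<close>

lemma lpa_relations_eval:
  assumes "infinite S" "r \<in> lpa_relations (finite_subset_graph S)"
  shows "eval_op r = (0 :: ('x set, 'k::field) linop) \<and> r \<in> carrier (free_alg S)"
  using assms(2)
proof cases
  case (V v w)
  have "shift [v] [v] * shift [w] [w] = (if v = w then shift [v] [v] else (0 :: ('x set, 'k) linop))"
    using shift_mult_incomparable[of "[w]" "[v]" "[v]" "[w]"] by auto
  then show ?thesis
    using V by (auto simp: generator_mon mon_append[symmetric] eval_op_diff eval_op_mult eval_op_mon
        intro!: free_algebra_diff mon_in_free_algebra)
next
  case (E1_source e)
  obtain A B where e: "e = (A, B)" by force
  have "shift [A] [A] * shift [A, B] [B] = (shift [A, B] [B] :: ('x set, 'k) linop)"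
    using shift_mult_ext_right[of "[A]" "[A]" "[B]" "[B]"] by simp
  then show ?thesis
    using E1_source e by (auto simp: generator_mon mon_append[symmetric] eval_op_diff eval_op_mult eval_op_mon
        intro!: free_algebra_diff mon_in_free_algebra)
next
  case (E1_range e)
  then show ?thesis
    by (cases e) (auto simp: generator_mon mon_append[symmetric] eval_op_diff eval_op_mult eval_op_mon
        intro!: free_algebra_diff mon_in_free_algebra)
next
  case (E2_range e)
  then show ?thesis
    by (cases e) (auto simp: generator_mon mon_append[symmetric] eval_op_diff eval_op_mult eval_op_mon
        intro!: free_algebra_diff mon_in_free_algebra)
next
  case (E2_source e)
  obtain A B where e: "e = (A, B)" by force
  have "shift [B] [A, B] * shift [A] [A] = (shift [B] [A, B] :: ('x set, 'k) linop)"
    using shift_mult_ext_left[of "[B]" "[A]" "[B]" "[A]"] by simp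
  then show ?thesis
    using E2_source e by (auto simp: generator_mon mon_append[symmetric] eval_op_diff eval_op_mult eval_op_mon
        intro!: free_algebra_diff mon_in_free_algebra)
next
  case (CK1 e e')
  obtain A B C D where e: "e = (A, B)" "e' = (C, D)" by force
  have "shift [B] [A, B] * shift [C, D] [D] =
      (if (A, B) = (C, D) then shift [B] [B] else (0 :: ('x set, 'k) linop))"
    using shift_mult_incomparable[of "[C, D]" "[A, B]" "[B]" "[D]"] by auto
  then show ?thesis
    using CK1 e by (auto simp: generator_mon mon_append[symmetric] eval_op_diff eval_op_mult eval_op_mon
        intro!: free_algebra_diff mon_in_free_algebra)
next
  case (CK2 v)
  then show ?thesis using infinite_out_arcs[OF assms(1), of v] by simp
qed

lemma lpa_ideal_eval:
  assumes "infinite S" "f \<in> lpa_ideal S"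
  shows "eval_op f = (0 :: ('x set, 'k::field) linop) \<and> f \<in> carrier (free_alg S)"
  using assms(2) unfolding lpa_ideal_def
proof (induction rule: alg_ideal_gen.induct)
  case (gen r)
  then show ?case using lpa_relations_eval[OF assms(1)] by blast
next
  case (smult f c)
  then show ?case by (simp add: eval_op_scale free_algebra_scale)
qed (simp_all add: free_algebra_0 eval_op_add eval_op_mult free_algebra_add free_algebra_mult)

section \<open>Normal form modulo the defining ideal\<close>

text \<open>
  The word of \<open>p q\<^sup>*\<close>.  The common end of the paths is kept as a letter in the middle, so that the
  word is not empty when both paths have length zero.
\<close>

definition path_word :: "'x set list \<Rightarrow> 'x set list \<Rightarrow> 'x gens list" where
  "path_word p q = map Edge (zip p (tl p)) @ Vertex (last p) # map Ghost (rev (zip q (tl q)))"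

lemma word_op_path_word:
  assumes "p \<noteq> []" "q \<noteq> []" "last p = last q"
  shows "word_op (path_word p q) = (shift p q :: ('x set, 'k::field) linop)"
proof -
  have edges: "word_op (map Edge (zip p (tl p))) * shift [last p] r = (shift p r :: ('x set, 'k) linop)"
    if "p \<noteq> []" for p r :: "'x set list"
    using that
  proof (induction p rule: list_nonempty_induct)
    case (cons A p)
    then obtain B p' where p: "p = B # p'" by (cases p) auto
    have "word_op (map Edge (zip (A # p) (tl (A # p)))) * shift [last (A # p)] r =
        shift [A, B] [B] * (shift p r :: ('x set, 'k) linop)"
      using cons.IH p by (simp add: mult.assoc)
    also have "\<dots> = shift (A # p) r"
      using shift_mult_ext_right[of "[A, B]" "[B]" p' r] p by simp
    finally show ?case .
  qed simp
  have ghosts: "shift r [last q] * word_op (map Ghost (rev (zip q (tl q)))) = (shift r q :: ('x set, 'k) linop)"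
    if "q \<noteq> []" for q r :: "'x set list"
    using that
  proof (induction q rule: list_nonempty_induct)
    case (cons A q)
    then obtain B q' where q: "q = B # q'" by (cases q) auto
    have "shift r [last (A # q)] * word_op (map Ghost (rev (zip (A # q) (tl (A # q))))) =
        (shift r q :: ('x set, 'k) linop) * shift [B] [A, B]"
      using cons.IH q by (simp add: mult.assoc[symmetric])
    also have "\<dots> = shift r (A # q)"
      using shift_mult_ext_left[of r "[B]" q' "[A, B]"] q by simp
    finally show ?case .
  qed simp
  have "word_op (path_word p q) =
      word_op (map Edge (zip p (tl p))) * (shift [last p] [last p] * word_op (map Ghost (rev (zip q (tl q)))) :: ('x set, 'k) linop)"
    by (simp add: path_word_def)
  also have "\<dots> = shift p q"
    using edges[OF assms(1)] ghosts[OF assms(2)] assms(3) by simp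
  finally show ?thesis .
qed

text \<open>
  Congruence of two monomials modulo the ideal, and vanishing of a monomial modulo the ideal.  The
  second argument only serves to fix the ground field.
\<close>

definition congruent_mod :: "'x set \<Rightarrow> 'k::field itself \<Rightarrow> 'x gens list \<Rightarrow> 'x gens list \<Rightarrow> bool" where
  "congruent_mod S (_ :: 'k itself) us vs \<longleftrightarrow> (word_mon us - word_mon vs :: 'x gens free_word \<Rightarrow>\<^sub>0 'k) \<in> lpa_ideal S"

definition null_mod :: "'x set \<Rightarrow> 'k::field itself \<Rightarrow> 'x gens list \<Rightarrow> bool" where
  "null_mod S (_ :: 'k itself) us \<longleftrightarrow> (word_mon us :: 'x gens free_word \<Rightarrow>\<^sub>0 'k) \<in> lpa_ideal S"

context
  fixes S :: "'x set" and K :: "'k::field itself"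
begin

abbreviation cong (infix "\<approx>\<^sub>I" 50) where "us \<approx>\<^sub>I vs \<equiv> congruent_mod S K us vs"
abbreviation null where "null us \<equiv> null_mod S K us"
abbreviation fsets where "fsets \<equiv> nonempty_finite_subsets S"

lemma cong_refl: "us \<approx>\<^sub>I us"
  by (simp add: congruent_mod_def lpa_ideal_0)

lemma cong_sym: "us \<approx>\<^sub>I vs \<Longrightarrow> vs \<approx>\<^sub>I us"
  unfolding congruent_mod_def by (drule lpa_ideal_uminus) simp

lemma cong_trans: "us \<approx>\<^sub>I vs \<Longrightarrow> vs \<approx>\<^sub>I ws \<Longrightarrow> us \<approx>\<^sub>I ws"
  unfolding congruent_mod_def by (drule (1) lpa_ideal_add) simp

lemma cong_null: "us \<approx>\<^sub>I vs \<Longrightarrow> null vs \<Longrightarrow> null us"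
  unfolding congruent_mod_def null_mod_def by (drule (1) lpa_ideal_add) simp

lemma cong_append: "us \<approx>\<^sub>I vs \<Longrightarrow> set ws \<subseteq> gens S \<Longrightarrow> us @ ws \<approx>\<^sub>I vs @ ws"
  unfolding congruent_mod_def
  by (cases "ws = []") (auto simp: mon_append left_diff_distrib[symmetric] intro: lpa_ideal_rmult mon_in_free_algebra)

lemma null_append: "null us \<Longrightarrow> set ws \<subseteq> gens S \<Longrightarrow> null (us @ ws)"
  unfolding null_mod_def
  by (cases "ws = []") (auto simp: mon_append intro: lpa_ideal_rmult mon_in_free_algebra)

lemma cong_Cons: "us \<approx>\<^sub>I vs \<Longrightarrow> x \<in> gens S \<Longrightarrow> x # us \<approx>\<^sub>I x # vs"
  unfolding congruent_mod_def mon_Cons[of x us] mon_Cons[of x vs] right_diff_distrib[symmetric]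
  by (rule lpa_ideal_lmult[OF mon_in_free_algebra]) simp_all

lemma null_Cons: "null us \<Longrightarrow> x \<in> gens S \<Longrightarrow> null (x # us)"
  unfolding null_mod_def mon_Cons[of x us]
  by (rule lpa_ideal_lmult[OF mon_in_free_algebra]) simp_all

lemma cong_relI: "r \<in> lpa_relations (finite_subset_graph S) \<Longrightarrow> (word_mon us - word_mon vs :: _ \<Rightarrow>\<^sub>0 'k) = r \<Longrightarrow> us \<approx>\<^sub>I vs"
  by (simp add: congruent_mod_def lpa_ideal_rel)

lemma null_relI: "r \<in> lpa_relations (finite_subset_graph S) \<Longrightarrow> (word_mon us :: _ \<Rightarrow>\<^sub>0 'k) = r \<Longrightarrow> null us"
  by (simp add: null_mod_def lpa_ideal_rel)

lemma rel_VV: "A \<in> fsets \<Longrightarrow> [Vertex A, Vertex A] \<approx>\<^sub>I [Vertex A]"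
  by (rule cong_relI[OF lpa_relations.V[of A _ A]]) (simp_all add: generator_mon mon_pair)

lemma rel_VV_null: "A \<in> fsets \<Longrightarrow> B \<in> fsets \<Longrightarrow> A \<noteq> B \<Longrightarrow> null [Vertex A, Vertex B]"
  by (rule null_relI[OF lpa_relations.V[of A _ B]]) (simp_all add: generator_mon mon_pair)

lemma rel_VE: "Edge (A, B) \<in> gens S \<Longrightarrow> [Vertex A, Edge (A, B)] \<approx>\<^sub>I [Edge (A, B)]"
  by (rule cong_relI[OF lpa_relations.E1_source[of "(A, B)"]]) (simp_all add: generator_mon mon_pair)

lemma rel_EV: "Edge (A, B) \<in> gens S \<Longrightarrow> [Edge (A, B), Vertex B] \<approx>\<^sub>I [Edge (A, B)]"
  by (rule cong_relI[OF lpa_relations.E1_range[of "(A, B)"]]) (simp_all add: generator_mon mon_pair)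

lemma rel_VG: "Ghost (A, B) \<in> gens S \<Longrightarrow> [Vertex B, Ghost (A, B)] \<approx>\<^sub>I [Ghost (A, B)]"
  by (rule cong_relI[OF lpa_relations.E2_range[of "(A, B)"]]) (simp_all add: generator_mon mon_pair)

lemma rel_GV: "Ghost (A, B) \<in> gens S \<Longrightarrow> [Ghost (A, B), Vertex A] \<approx>\<^sub>I [Ghost (A, B)]"
  by (rule cong_relI[OF lpa_relations.E2_source[of "(A, B)"]]) (simp_all add: generator_mon mon_pair)

lemma rel_GE: "Ghost (A, B) \<in> gens S \<Longrightarrow> [Ghost (A, B), Edge (A, B)] \<approx>\<^sub>I [Vertex B]"
  by (rule cong_relI[OF lpa_relations.CK1[of "(A, B)" _ "(A, B)"]]) (simp_all add: generator_mon mon_pair)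

lemma rel_GE_null:
  "Ghost (A, B) \<in> gens S \<Longrightarrow> Edge (C, D) \<in> gens S \<Longrightarrow> (A, B) \<noteq> (C, D) \<Longrightarrow> null [Ghost (A, B), Edge (C, D)]"
  by (rule null_relI[OF lpa_relations.CK1[of "(A, B)" _ "(C, D)"]])
    (simp, simp, simp only: generator_mon mon_pair if_False diff_zero)

lemma rel_VE_null:
  assumes "A \<in> fsets" "Edge (B, C) \<in> gens S" "A \<noteq> B"
  shows "null [Vertex A, Edge (B, C)]"
proof (rule cong_null)
  show "[Vertex A, Edge (B, C)] \<approx>\<^sub>I [Vertex A, Vertex B, Edge (B, C)]"
    using assms by (intro cong_Cons cong_sym[OF rel_VE]) auto
  show "null [Vertex A, Vertex B, Edge (B, C)]"
    using null_append[OF rel_VV_null[of A B], of "[Edge (B, C)]"] assms by simp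
qed

lemma rel_EE_null:
  assumes "Edge (A, B) \<in> gens S" "Edge (C, D) \<in> gens S" "B \<noteq> C"
  shows "null [Edge (A, B), Edge (C, D)]"
proof (rule cong_null)
  show "[Edge (A, B), Edge (C, D)] \<approx>\<^sub>I [Edge (A, B), Vertex B, Edge (C, D)]"
    using cong_append[OF cong_sym[OF rel_EV[OF assms(1)]], of "[Edge (C, D)]"] assms(2) by simp
  show "null [Edge (A, B), Vertex B, Edge (C, D)]"
    using assms by (intro null_Cons rel_VE_null) auto
qed

lemma rel_EV_null:
  assumes "Edge (A, B) \<in> gens S" "C \<in> fsets" "B \<noteq> C"
  shows "null [Edge (A, B), Vertex C]"
proof (rule cong_null)
  show "[Edge (A, B), Vertex C] \<approx>\<^sub>I [Edge (A, B), Vertex B, Vertex C]"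
    using cong_append[OF cong_sym[OF rel_EV[OF assms(1)]], of "[Vertex C]"] assms(2) by simp
  show "null [Edge (A, B), Vertex B, Vertex C]"
    using assms by (intro null_Cons rel_VV_null) auto
qed

lemma rel_GV_null:
  assumes "Ghost (A, B) \<in> gens S" "C \<in> fsets" "A \<noteq> C"
  shows "null [Ghost (A, B), Vertex C]"
proof (rule cong_null)
  show "[Ghost (A, B), Vertex C] \<approx>\<^sub>I [Ghost (A, B), Vertex A, Vertex C]"
    using cong_append[OF cong_sym[OF rel_GV[OF assms(1)]], of "[Vertex C]"] assms(2) by simp
  show "null [Ghost (A, B), Vertex A, Vertex C]"
    using assms by (intro null_Cons rel_VV_null) auto
qed

lemma path_word_gens:
  assumes "strict_chain fsets p" "strict_chain fsets q" "p \<noteq> []"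
  shows "set (path_word p q) \<subseteq> gens S"
proof -
  have arcs: "set (zip r (tl r)) \<subseteq> arcs (finite_subset_graph S)" if "strict_chain fsets r" for r
    using that
  proof (induction r)
    case (Cons A r)
    then show ?case by (cases r) (auto simp: strict_chain_def)
  qed simp
  have "Vertex (last p) \<in> gens S" using assms last_in_set by (fastforce simp: strict_chain_def)
  then show ?thesis
    using arcs[OF assms(1)] arcs[OF assms(2)] by (auto simp: path_word_def lpa_generators_def)
qed

text \<open>
  The normal form of a word modulo the ideal: zero, or \<open>p q\<^sup>*\<close>.
\<close>

definition reducible :: "'x gens list \<Rightarrow> bool" where
  "reducible ws \<longleftrightarrow> null ws \<or> (\<exists>p q. (p, q) \<in> chain_pairs fsets \<and> p \<noteq> [] \<and> ws \<approx>\<^sub>I path_word p q)"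

lemma reducible_null: "null ws \<Longrightarrow> reducible ws"
  and reducible_path: "(p, q) \<in> chain_pairs fsets \<Longrightarrow> p \<noteq> [] \<Longrightarrow> ws \<approx>\<^sub>I path_word p q \<Longrightarrow> reducible ws"
  by (auto simp: reducible_def)

lemma path_word_Cons: "path_word (A # B # p) q = Edge (A, B) # path_word (B # p) q"
  by (simp add: path_word_def)

lemma vertex_path_word:
  assumes "(A # p, q) \<in> chain_pairs fsets"
  shows "Vertex A # path_word (A # p) q \<approx>\<^sub>I path_word (A # p) q"
proof -
  have g: "set (path_word (A # p) q) \<subseteq> gens S"
    using assms by (intro path_word_gens) (auto simp: chain_pairs_def)
  show ?thesis
  proof (cases p)
    case Nil
    then obtain t where t: "path_word (A # p) q = Vertex A # t" by (simp add: path_word_def)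
    then show ?thesis using cong_append[OF rel_VV[of A], of t] g by simp
  next
    case (Cons B p')
    then show ?thesis
      using cong_append[OF rel_VE[of A B], of "path_word (B # p') q"] g by (simp add: path_word_Cons)
  qed
qed

lemma reducible_step:
  assumes pq: "(p, q) \<in> chain_pairs fsets" "p \<noteq> []" and x: "x \<in> gens S"
  shows "reducible (x # path_word p q)"
proof -
  obtain A p' where p: "p = A # p'" using pq(2) by (cases p) auto
  have A: "A \<in> fsets" using pq by (auto simp: p chain_pairs_def strict_chain_def)
  have g: "set (path_word p q) \<subseteq> gens S"
    using pq by (intro path_word_gens) (auto simp: chain_pairs_def)
  have q: "q \<noteq> []" "last q = last p" using pq by (auto simp: chain_pairs_def same_end_def)
  obtain y t where yt: "path_word p q = y # t" and y: "p' = [] \<Longrightarrow> y = Vertex A"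
    "\<And>B p''. p' = B # p'' \<Longrightarrow> y = Edge (A, B) \<and> t = path_word (B # p'') q"
    by (cases p') (auto simp: p path_word_def)
  have gy: "y \<in> gens S" "set t \<subseteq> gens S" using g yt by auto
  have null_yt: "reducible (x # path_word p q)" if "null [x, y]"
    using null_append[OF that gy(2)] yt by (simp add: reducible_null)
  show ?thesis
  proof (cases x)
    case (Vertex B)
    show ?thesis
    proof (cases "B = A")
      case True
      then show ?thesis
        using vertex_path_word[of A p' q] pq Vertex p by (intro reducible_path[OF pq]) auto
    next
      case False
      have "null [x, y]"
        using x gy Vertex False y A by (cases p') (auto intro: rel_VV_null rel_VE_null)
      then show ?thesis by (rule null_yt)
    qed
  next
    case (Edge e)
    obtain B C where e: "e = (B, C)" by force
    show ?thesis
    proof (cases "C = A")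
      case True
      have "strict_chain fsets (B # p)"
        using pq x by (auto simp: chain_pairs_def strict_chain_def p Edge e True dest: less_trans)
      then have "(B # p, q) \<in> chain_pairs fsets"
        using pq by (auto simp: chain_pairs_def same_end_def)
      moreover have "x # path_word p q = path_word (B # p) q"
        by (simp add: p Edge e True path_word_Cons)
      ultimately show ?thesis by (metis cong_refl reducible_path list.distinct(1))
    next
      case False
      have "null [x, y]"
        using x gy Edge e False y A by (cases p') (auto intro: rel_EV_null rel_EE_null)
      then show ?thesis by (rule null_yt)
    qed
  next
    case (Ghost e)
    obtain B C where e: "e = (B, C)" by force
    show ?thesis
    proof (cases p')
      case Nil
      then have y': "y = Vertex A" and t: "t = map Ghost (rev (zip q (tl q)))"
        using y yt by (auto simp: p path_word_def)
      show ?thesis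
      proof (cases "B = A")
        case True
        have qC: "strict_chain fsets (q @ [C])"
          using pq q x by (auto simp: chain_snoc chain_pairs_def p Nil Ghost e True)
        then have "([C], q @ [C]) \<in> chain_pairs fsets"
          by (auto simp: chain_pairs_def chain_snoc same_end_def strict_chain_def)
        moreover have "x # path_word p q \<approx>\<^sub>I path_word [C] (q @ [C])"
        proof (rule cong_trans)
          show "x # path_word p q \<approx>\<^sub>I x # t"
            using cong_append[OF rel_GV[of A C] gy(2)] x by (simp add: yt y' Ghost e True)
          have "zip (q @ [C]) (tl (q @ [C])) = zip q (tl q) @ [(last q, C)]"
            using q(1) by (induction q rule: list_nonempty_induct) (auto simp: neq_Nil_conv)
          then have "path_word [C] (q @ [C]) = Vertex C # x # t"
            using q by (simp add: path_word_def t Ghost e True p Nil)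
          then show "x # t \<approx>\<^sub>I path_word [C] (q @ [C])"
            using cong_append[OF cong_sym[OF rel_VG[of A C]] gy(2)] x by (simp add: Ghost e True)
        qed
        ultimately show ?thesis by (intro reducible_path) auto
      next
        case False
        have "null [x, y]" using x A False by (simp add: Ghost e y' rel_GV_null)
        then show ?thesis by (rule null_yt)
      qed
    next
      case (Cons D p'')
      then have y': "y = Edge (A, D)" and t: "t = path_word (D # p'') q" using y by auto
      show ?thesis
      proof (cases "(B, C) = (A, D)")
        case True
        have Dq: "(D # p'', q) \<in> chain_pairs fsets"
          using pq by (auto simp: chain_pairs_def strict_chain_def same_end_def p Cons)
        have "x # path_word p q \<approx>\<^sub>I t"
        proof (rule cong_trans)
          show "x # path_word p q \<approx>\<^sub>I Vertex D # t"
            using cong_append[OF rel_GE[of A D] gy(2)] x True by (simp add: yt y' Ghost e)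
          show "Vertex D # t \<approx>\<^sub>I t" using vertex_path_word[OF Dq] t by simp
        qed
        then show ?thesis using Dq t by (intro reducible_path) auto
      next
        case False
        have "null [x, y]" using x gy False by (auto simp: Ghost e y' intro!: rel_GE_null)
        then show ?thesis by (rule null_yt)
      qed
    qed
  qed
qed

lemma reducible_word:
  assumes "ws \<noteq> []" "set ws \<subseteq> gens S"
  shows "reducible ws"
  using assms
proof (induction ws rule: list_nonempty_induct)
  case (single x)
  show ?case
  proof (cases x)
    case (Vertex A)
    then have "([A], [A]) \<in> chain_pairs fsets" "[x] = path_word [A] [A]"
      using single by (auto simp: vertex_chain_pairs path_word_def)
    then show ?thesis by (metis cong_refl reducible_path list.distinct(1))
  next
    case (Edge e)
    obtain A B where e: "e = (A, B)" by force
    have "([A, B], [B]) \<in> chain_pairs fsets"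
      using single by (auto simp: Edge e chain_pairs_def strict_chain_def same_end_def)
    moreover have "[x] \<approx>\<^sub>I path_word [A, B] [B]"
      using cong_sym[OF rel_EV[of A B]] single by (simp add: Edge e path_word_def)
    ultimately show ?thesis by (intro reducible_path) auto
  next
    case (Ghost e)
    obtain A B where e: "e = (A, B)" by force
    have "([B], [A, B]) \<in> chain_pairs fsets"
      using single by (auto simp: Ghost e chain_pairs_def strict_chain_def same_end_def)
    moreover have "[x] \<approx>\<^sub>I path_word [B] [A, B]"
      using cong_sym[OF rel_VG[of A B]] single by (simp add: Ghost e path_word_def)
    ultimately show ?thesis by (intro reducible_path) auto
  qed
next
  case (cons x ws)
  then consider "null ws" | p q where "(p, q) \<in> chain_pairs fsets" "p \<noteq> []" "ws \<approx>\<^sub>I path_word p q"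
    by (auto simp: reducible_def)
  then show ?case
  proof cases
    case 1
    then show ?thesis using cons by (intro reducible_null null_Cons) auto
  next
    case 2
    then have "x # ws \<approx>\<^sub>I x # path_word p q" "reducible (x # path_word p q)"
      using cons by (auto intro: cong_Cons reducible_step)
    then show ?thesis unfolding reducible_def by (meson cong_null cong_trans)
  qed
qed

end

section \<open>The Leavitt path algebra as an algebra of operators\<close>

lemma single_sum:
  "Poly_Mapping.single k (sum f A) = (\<Sum>x\<in>A. Poly_Mapping.single k (f x :: 'b::comm_monoid_add))"
  by (induction A rule: infinite_finite_induct) (auto simp: single_add)

lemma mon_single_decomp:
  "f = (\<Sum>w\<in>Poly_Mapping.keys f. Poly_Mapping.single 0 (Poly_Mapping.lookup f w) * word_mon (letters w))"
proof -
  have "Poly_Mapping.single 0 (Poly_Mapping.lookup f w) * word_mon (letters w) =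
      Poly_Mapping.single w (Poly_Mapping.lookup f w)" for w
    by (simp add: word_mon_def mult_single)
  then show ?thesis using poly_mapping_sum_single[of f] by simp
qed

text \<open>
  Modulo the ideal, \<open>f\<close> is a linear combination of the words of different pairs \<open>(p, q)\<close>.  Their
  operators are linearly independent, so all coefficients vanish if the value of \<open>f\<close> does.
\<close>

lemma eval_op_kernel:
  fixes f :: "'x gens free_word \<Rightarrow>\<^sub>0 'k::field"
  assumes inf: "infinite S" and f: "f \<in> carrier (free_alg S)" and zero: "eval_op f = 0"
  shows "f \<in> lpa_ideal S"
proof -
  let ?V = "nonempty_finite_subsets S" and ?c = "Poly_Mapping.lookup f"
  let ?m = "word_mon :: 'x gens list \<Rightarrow> 'x gens free_word \<Rightarrow>\<^sub>0 'k"
  have "\<exists>d. ?m (letters w) \<in> lpa_ideal S \<or>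
      (d \<in> chain_pairs ?V \<and> fst d \<noteq> [] \<and> ?m (letters w) - ?m (path_word (fst d) (snd d)) \<in> lpa_ideal S)"
    if "w \<in> Poly_Mapping.keys f" for w
  proof -
    have "letters w \<noteq> []" "set (letters w) \<subseteq> gens S" using f that by (auto simp: in_free_algebra)
    then have "reducible S TYPE('k) (letters w)" by (rule reducible_word)
    then show ?thesis by (fastforce simp: reducible_def null_mod_def congruent_mod_def)
  qed
  then obtain d where d: "\<And>w. w \<in> Poly_Mapping.keys f \<Longrightarrow> ?m (letters w) \<in> lpa_ideal S \<or>
      (d w \<in> chain_pairs ?V \<and> fst (d w) \<noteq> [] \<and>
        ?m (letters w) - ?m (path_word (fst (d w)) (snd (d w))) \<in> lpa_ideal S)" by metis
  \<comment> \<open>The monomials outside \<open>W\<close> vanish modulo the ideal; those in \<open>W\<close> are grouped by their normal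
    forms, with total coefficients \<open>C\<close>.\<close>
  define W where "W = {w\<in>Poly_Mapping.keys f. ?m (letters w) \<notin> lpa_ideal S}"
  have fW: "finite W" by (simp add: W_def)
  let ?n = "\<lambda>e. ?m (path_word (fst e) (snd e))"
  define C where "C e = (\<Sum>w | w \<in> W \<and> d w = e. ?c w)" for e
  define g where "g = (\<Sum>e\<in>d`W. Poly_Mapping.single 0 (C e) * ?n e)"
  have g_W: "g = (\<Sum>w\<in>W. Poly_Mapping.single 0 (?c w) * ?n (d w))"
  proof -
    have "(\<Sum>w\<in>W. Poly_Mapping.single 0 (?c w) * ?n (d w)) =
        (\<Sum>e\<in>d`W. \<Sum>w | w \<in> W \<and> d w = e. Poly_Mapping.single 0 (?c w) * ?n (d w))"
      using fW by (rule sum.image_gen)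
    also have "\<dots> = g"
      unfolding g_def
    proof (rule sum.cong[OF refl])
      fix e
      have "Poly_Mapping.single 0 (C e) = (\<Sum>w | w \<in> W \<and> d w = e. Poly_Mapping.single (0 :: 'x gens free_word) (?c w))"
        unfolding C_def by (rule single_sum)
      then show "(\<Sum>w | w \<in> W \<and> d w = e. Poly_Mapping.single 0 (?c w) * ?n (d w)) =
          Poly_Mapping.single 0 (C e) * ?n e"
        by (simp add: sum_distrib_right)
    qed
    finally show ?thesis by simp
  qed
  have fg: "f - g \<in> lpa_ideal S"
  proof -
    let ?h = "\<lambda>w. Poly_Mapping.single 0 (?c w) * ?m (letters w) -
      (if w \<in> W then Poly_Mapping.single 0 (?c w) * ?n (d w) else 0)"
    have "g = (\<Sum>w\<in>Poly_Mapping.keys f. if w \<in> W then Poly_Mapping.single 0 (?c w) * ?n (d w) else 0)"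
      unfolding g_W by (rule sum.mono_neutral_cong_left) (auto simp: W_def)
    then have "f - g = (\<Sum>w\<in>Poly_Mapping.keys f. ?h w)"
      by (subst mon_single_decomp[of f]) (simp add: sum_subtractf)
    also have "\<dots> \<in> lpa_ideal S"
    proof (rule lpa_ideal_sum)
      fix w assume w: "w \<in> Poly_Mapping.keys f"
      show "?h w \<in> lpa_ideal S"
      proof (cases "w \<in> W")
        case True
        then have "?m (letters w) - ?n (d w) \<in> lpa_ideal S" using d[OF w] by (auto simp: W_def)
        then show ?thesis using True lpa_ideal_scale by (simp add: right_diff_distrib[symmetric])
      next
        case False
        then have "?m (letters w) \<in> lpa_ideal S" using w by (simp add: W_def)
        then show ?thesis using False lpa_ideal_scale by simp
      qed
    qed
    finally show ?thesis .
  qed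
  have dW: "d w \<in> chain_pairs ?V" "fst (d w) \<noteq> []" if "w \<in> W" for w
    using that d[of w] by (auto simp: W_def)
  have "eval_op g = (\<Sum>e\<in>d`W. scal (C e) * shift (fst e) (snd e))"
    unfolding g_def eval_op_sum
  proof (rule sum.cong[OF refl])
    fix e assume "e \<in> d ` W"
    then have e: "e \<in> chain_pairs ?V" "fst e \<noteq> []" using dW by auto
    then have "word_op (path_word (fst e) (snd e)) = (shift (fst e) (snd e) :: ('x set, 'k) linop)"
      by (intro word_op_path_word) (auto simp: chain_pairs_def same_end_def split: prod.splits)
    then show "eval_op (Poly_Mapping.single 0 (C e) * ?n e) = scal (C e) * shift (fst e) (snd e)"
      by (simp only: eval_op_scale eval_op_mon)
  qed
  moreover have "eval_op g = 0"
    using lpa_ideal_eval[OF inf fg] zero by (simp add: eval_op_diff)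
  ultimately have "C e = 0" if "e \<in> d ` W" for e
    using shift_independent[of "d ` W" C e] fW that by simp
  then have "g = 0" by (simp add: g_def)
  then show ?thesis using fg by simp
qed

text \<open>
  The elements of the Leavitt path algebra.
\<close>

definition coset :: "'x set \<Rightarrow> ('x gens free_word \<Rightarrow>\<^sub>0 'k::field) \<Rightarrow> ('x gens free_word \<Rightarrow>\<^sub>0 'k) set" where
  "coset S f = lpa_ideal S +>\<^bsub>free_alg S\<^esub> f"

lemma coset_eq_fibre:
  assumes inf: "infinite S" and f: "f \<in> carrier (free_alg S)"
  shows "coset S f = {g \<in> carrier (free_alg S). eval_op g = eval_op f}"
proof -
  have "coset S f = {i + f | i. i \<in> lpa_ideal S}"
    by (auto simp: coset_def a_r_coset_def r_coset_def)
  also have "\<dots> = {g \<in> carrier (free_alg S). eval_op g = eval_op f}"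
  proof (intro Set.equalityI subsetI)
    fix g assume "g \<in> {i + f | i. i \<in> lpa_ideal S}"
    then obtain i where "i \<in> lpa_ideal S" "g = i + f" by blast
    then show "g \<in> {g \<in> carrier (free_alg S). eval_op g = eval_op f}"
      using lpa_ideal_eval[OF inf, of i] f by (simp add: eval_op_add free_algebra_add)
  next
    fix g assume g: "g \<in> {g \<in> carrier (free_alg S). eval_op g = eval_op f}"
    then have "g - f \<in> lpa_ideal S"
      using f by (intro eval_op_kernel[OF inf]) (auto simp: free_algebra_diff eval_op_diff)
    moreover have "g = (g - f) + f" by simp
    ultimately show "g \<in> {i + f | i. i \<in> lpa_ideal S}" by blast
  qed
  finally show ?thesis .
qed

abbreviation lpa :: "'x set \<Rightarrow> ('k::field, ('x gens free_word \<Rightarrow>\<^sub>0 'k) set) module" where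
  "lpa S \<equiv> leavitt_path_algebra (finite_subset_graph S)"

lemma lpa_def: "lpa S = quotient_algebra (free_alg S) (lpa_ideal S)"
  by (simp add: leavitt_path_algebra_def lpa_ideal_def)

lemma lpa_carrier: "carrier (lpa S) = coset S ` carrier (free_alg S)"
  by (auto simp: lpa_def quotient_algebra_def A_RCOSETS_def RCOSETS_def coset_def a_r_coset_def)

lemma self_in_coset: "infinite S \<Longrightarrow> f \<in> carrier (free_alg S) \<Longrightarrow> f \<in> coset S f"
  by (simp add: coset_eq_fibre)

lemma coset_eqI:
  "infinite S \<Longrightarrow> f \<in> carrier (free_alg S) \<Longrightarrow> g \<in> carrier (free_alg S) \<Longrightarrow>
    eval_op f = eval_op g \<Longrightarrow> coset S f = coset S g"
  by (simp add: coset_eq_fibre)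

lemma lpa_ops:
  assumes inf: "infinite S" and f: "f \<in> carrier (free_alg S)" and g: "g \<in> carrier (free_alg S)"
  shows lpa_mult: "coset S f \<otimes>\<^bsub>lpa S\<^esub> coset S g = coset S (f * g)"
    and lpa_add: "coset S f \<oplus>\<^bsub>lpa S\<^esub> coset S g = coset S (f + g)"
    and lpa_smult: "c \<odot>\<^bsub>lpa S\<^esub> coset S f = coset S (Poly_Mapping.single 0 c * f)"
    and lpa_zero: "\<zero>\<^bsub>lpa S\<^esub> = coset S (0 :: 'x gens free_word \<Rightarrow>\<^sub>0 'k::field)"
proof -
  note fib = coset_eq_fibre[OF inf]
  have "coset S f \<otimes>\<^bsub>lpa S\<^esub> coset S g = (\<Union>a\<in>coset S f. \<Union>b\<in>coset S g. coset S (a * b))"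
    by (simp add: lpa_def quotient_algebra_def rcoset_mult_def coset_def)
  also have "\<dots> = coset S (f * g)"
  proof -
    have "coset S (a * b) = coset S (f * g)" if "a \<in> coset S f" "b \<in> coset S g" for a b
      using that f g by (intro coset_eqI[OF inf]) (auto simp: fib free_algebra_mult eval_op_mult)
    then show ?thesis using self_in_coset[OF inf f] self_in_coset[OF inf g] by blast
  qed
  finally show "coset S f \<otimes>\<^bsub>lpa S\<^esub> coset S g = coset S (f * g)" .
  have "coset S f \<oplus>\<^bsub>lpa S\<^esub> coset S g = {a + b | a b. a \<in> coset S f \<and> b \<in> coset S g}"
    by (auto simp: lpa_def quotient_algebra_def set_add_def set_mult_def)
  also have "\<dots> = coset S (f + g)"
  proof (intro Set.equalityI subsetI)
    fix h assume "h \<in> {a + b | a b. a \<in> coset S f \<and> b \<in> coset S g}"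
    then show "h \<in> coset S (f + g)"
      using f g by (auto simp: fib free_algebra_add eval_op_add)
  next
    fix h assume "h \<in> coset S (f + g)"
    then have "h - g \<in> coset S f"
      using f g by (simp add: fib free_algebra_add free_algebra_diff eval_op_add eval_op_diff)
    moreover have "h = (h - g) + g" by simp
    ultimately show "h \<in> {a + b | a b. a \<in> coset S f \<and> b \<in> coset S g}"
      using self_in_coset[OF inf g] by blast
  qed
  finally show "coset S f \<oplus>\<^bsub>lpa S\<^esub> coset S g = coset S (f + g)" .
  have "c \<odot>\<^bsub>lpa S\<^esub> coset S f = (\<Union>a\<in>coset S f. coset S (Poly_Mapping.single 0 c * a))"
    by (simp add: lpa_def quotient_algebra_def coset_def)
  also have "\<dots> = coset S (Poly_Mapping.single 0 c * f)"
  proof -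
    have "coset S (Poly_Mapping.single 0 c * a) = coset S (Poly_Mapping.single 0 c * f)" if "a \<in> coset S f" for a
      using that f by (intro coset_eqI[OF inf]) (auto simp: fib free_algebra_scale eval_op_scale)
    then show ?thesis using self_in_coset[OF inf f] by blast
  qed
  finally show "c \<odot>\<^bsub>lpa S\<^esub> coset S f = coset S (Poly_Mapping.single 0 c * f)" .
  have "(lpa_ideal S :: ('x gens free_word \<Rightarrow>\<^sub>0 'k) set) = coset S 0"
    by (auto simp: fib[OF free_algebra_0] lpa_ideal_eval[OF inf] intro: eval_op_kernel[OF inf])
  then show "\<zero>\<^bsub>lpa S\<^esub> = coset S (0 :: 'x gens free_word \<Rightarrow>\<^sub>0 'k)"
    by (simp add: lpa_def quotient_algebra_def)
qed

text \<open>
  The isomorphism from the unitization to the algebra of operators, \<open>(k, r) \<mapsto> k + r\<close>.  The value of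
  a coset is read off from any representative.
\<close>

definition unit_op :: "'k::field \<times> ('x gens free_word \<Rightarrow>\<^sub>0 'k) set \<Rightarrow> ('x set, 'k) linop" where
  "unit_op x = scal (fst x) + eval_op (SOME f. f \<in> snd x)"

lemma unit_op_coset:
  assumes "infinite S" "f \<in> carrier (free_alg S)"
  shows "unit_op (k, coset S f) = scal k + eval_op f"
proof -
  have "(SOME g. g \<in> coset S f) \<in> coset S f" using self_in_coset[OF assms] by (rule someI)
  then show ?thesis using assms by (simp add: unit_op_def coset_eq_fibre)
qed

lemma gen_op_in_chain_ops: "x \<in> gens S \<Longrightarrow> gen_op x \<in> chain_ops (nonempty_finite_subsets S)"
  by (cases x rule: gen_op.cases)
    (auto intro!: shift_in_chain_ops simp: chain_pairs_def strict_chain_def same_end_def)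

lemma eval_op_in_chain_ops:
  assumes "f \<in> carrier (free_alg S)"
  shows "eval_op f \<in> chain_ops (nonempty_finite_subsets S)"
proof -
  have "word_op ws \<in> chain_ops (nonempty_finite_subsets S)" if "set ws \<subseteq> gens S" for ws
    using that by (induction ws) (auto intro: chain_ops_1 chain_ops_mult gen_op_in_chain_ops)
  then show ?thesis
    unfolding eval_op_def using assms
    by (intro chain_ops_sum chain_ops_scale) (auto simp: in_free_algebra)
qed

lemma app_gen_op_Nil: "app (gen_op x) g [] = 0"
  by (cases x rule: gen_op.cases) (auto simp: app_shift_outside)

text \<open>
  The value of an element of the free algebra without identity maps every function to one that
  vanishes at the empty word.  No nonzero scalar does this, which makes \<open>unit_op\<close> injective.
\<close>

lemma app_eval_op_Nil:
  assumes "f \<in> carrier (free_alg S)"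
  shows "app (eval_op f) g [] = 0"
proof -
  have "app (word_op ws) g [] = 0" if "ws \<noteq> []" for ws
    using that by (cases ws) (auto simp: app_simps app_gen_op_Nil)
  then show ?thesis
    using assms by (simp add: eval_op_def app_sum app_simps in_free_algebra)
qed

lemma chain_ops_decomp:
  assumes "a \<in> chain_ops (nonempty_finite_subsets S)"
  shows "\<exists>k. \<exists>f\<in>carrier (free_alg S). a = scal k + eval_op f"
  using assms
proof (induction rule: chain_ops_induct)
  case zero
  then show ?case by (intro exI[of _ 0] bexI[of _ 0]) (simp_all add: free_algebra_0)
next
  case (step c p q b)
  then obtain k f where kf: "f \<in> carrier (free_alg S)" "b = scal k + eval_op f" by blast
  show ?case
  proof (cases "p = []")
    case True
    then have "q = []" using step.hyps(1) by (simp add: chain_pairs_def same_end_def)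
    then have "scal c * shift p q + b = scal (c + k) + eval_op f"
      using True kf by (simp add: scal_add add.assoc)
    then show ?thesis using kf by blast
  next
    case False
    let ?m = "word_mon (path_word p q)"
    have pq: "strict_chain (nonempty_finite_subsets S) p" "strict_chain (nonempty_finite_subsets S) q" "q \<noteq> []" "last p = last q"
      using step.hyps(1) False by (auto simp: chain_pairs_def same_end_def)
    have m: "?m \<in> carrier (free_alg S)"
      using path_word_gens[OF pq(1,2) False] by (intro mon_in_free_algebra) (auto simp: path_word_def)
    have "scal c * shift p q + b = scal k + eval_op (Poly_Mapping.single 0 c * ?m + f)"
      by (simp only: word_op_path_word[OF False pq(3,4)] kf eval_op_add eval_op_scale eval_op_mon
          add.left_commute)
    then show ?thesis using m kf free_algebra_add free_algebra_scale by blast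
  qed
qed

lemma unitization_simps:
  "carrier (unitization R) = UNIV \<times> carrier R"
  "(k, r) \<otimes>\<^bsub>unitization R\<^esub> (l, s) = (k * l, (k \<odot>\<^bsub>R\<^esub> s \<oplus>\<^bsub>R\<^esub> l \<odot>\<^bsub>R\<^esub> r) \<oplus>\<^bsub>R\<^esub> r \<otimes>\<^bsub>R\<^esub> s)"
  "\<one>\<^bsub>unitization R\<^esub> = (1, \<zero>\<^bsub>R\<^esub>)" "\<zero>\<^bsub>unitization R\<^esub> = (0, \<zero>\<^bsub>R\<^esub>)"
  "(k, r) \<oplus>\<^bsub>unitization R\<^esub> (l, s) = (k + l, r \<oplus>\<^bsub>R\<^esub> s)"
  "c \<odot>\<^bsub>unitization R\<^esub> (k, r) = (c * k, c \<odot>\<^bsub>R\<^esub> r)"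
  by (simp_all add: unitization_def)

lemma unit_op_hom:
  assumes inf: "infinite S"
  defines "R \<equiv> unitization (lpa S) :: ('k::field, 'k \<times> ('x gens free_word \<Rightarrow>\<^sub>0 'k) set) module"
  shows "bij_betw unit_op (carrier R) (chain_ops (nonempty_finite_subsets S) :: ('x set, 'k) linop set)"
    and "\<And>x y. x \<in> carrier R \<Longrightarrow> y \<in> carrier R \<Longrightarrow>
      x \<otimes>\<^bsub>R\<^esub> y \<in> carrier R \<and> unit_op (x \<otimes>\<^bsub>R\<^esub> y) = (unit_op x * unit_op y :: ('x set, 'k) linop)"
    and "\<And>x y. x \<in> carrier R \<Longrightarrow> y \<in> carrier R \<Longrightarrow>
      x \<oplus>\<^bsub>R\<^esub> y \<in> carrier R \<and> unit_op (x \<oplus>\<^bsub>R\<^esub> y) = (unit_op x + unit_op y :: ('x set, 'k) linop)"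
    and "\<And>c x. x \<in> carrier R \<Longrightarrow>
      c \<odot>\<^bsub>R\<^esub> x \<in> carrier R \<and> unit_op (c \<odot>\<^bsub>R\<^esub> x) = (scal c * unit_op x :: ('x set, 'k) linop)"
    and "\<one>\<^bsub>R\<^esub> \<in> carrier R" "unit_op \<one>\<^bsub>R\<^esub> = (1 :: ('x set, 'k) linop)"
    and "\<zero>\<^bsub>R\<^esub> \<in> carrier R" "unit_op \<zero>\<^bsub>R\<^esub> = (0 :: ('x set, 'k) linop)"
proof -
  let ?V = "nonempty_finite_subsets S"
  let ?F = "carrier (free_alg S) :: ('x gens free_word \<Rightarrow>\<^sub>0 'k) set"
  have carr: "x \<in> carrier R \<longleftrightarrow> (\<exists>k. \<exists>f\<in>?F. x = (k, coset S f))" for x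
    by (cases x) (auto simp: R_def unitization_simps lpa_carrier)
  note op = unit_op_coset[OF inf]
  note ops = lpa_mult[OF inf] lpa_add[OF inf] lpa_smult[OF inf]
  note closed = free_algebra_0 free_algebra_add free_algebra_mult free_algebra_scale
  have ev0: "eval_op (Poly_Mapping.single 0 c) = (scal c :: ('x set, 'k) linop)" for c
    by (simp add: eval_op_single zero_free_word_def)
  note ev = eval_op_add eval_op_mult ev0
  have zero: "\<zero>\<^bsub>lpa S\<^esub> = coset S (0 :: 'x gens free_word \<Rightarrow>\<^sub>0 'k)"
    using lpa_zero[OF inf free_algebra_0 free_algebra_0] .
  show "x \<otimes>\<^bsub>R\<^esub> y \<in> carrier R \<and> unit_op (x \<otimes>\<^bsub>R\<^esub> y) = (unit_op x * unit_op y :: ('x set, 'k) linop)"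
    if "x \<in> carrier R" "y \<in> carrier R" for x y
  proof -
    obtain k f l g where x: "x = (k, coset S f)" "f \<in> ?F" and y: "y = (l, coset S g)" "g \<in> ?F"
      using \<open>x \<in> carrier R\<close> \<open>y \<in> carrier R\<close> unfolding carr by blast
    let ?h = "(Poly_Mapping.single 0 k * g + Poly_Mapping.single 0 l * f) + f * g"
    have h: "?h \<in> ?F" using x y by (simp add: closed)
    have "(k \<odot>\<^bsub>lpa S\<^esub> coset S g \<oplus>\<^bsub>lpa S\<^esub> l \<odot>\<^bsub>lpa S\<^esub> coset S f) \<oplus>\<^bsub>lpa S\<^esub>
        coset S f \<otimes>\<^bsub>lpa S\<^esub> coset S g = coset S ?h"
      using x(2) y(2) by (simp only: lpa_smult[OF inf y(2) y(2)] lpa_smult[OF inf x(2) x(2)] ops closed)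
    then have xy: "x \<otimes>\<^bsub>R\<^esub> y = (k * l, coset S ?h)" by (simp add: R_def unitization_simps x y)
    have eq: "(scal k + eval_op f) * (scal l + eval_op g) =
        scal (k * l) + ((scal k * eval_op g + scal l * eval_op f) + eval_op f * eval_op g)"
      by (simp only: scal_mult scal_commute[of "eval_op f"] distrib_left distrib_right add.assoc
          add.left_commute)
    have "x \<otimes>\<^bsub>R\<^esub> y \<in> carrier R" unfolding carr xy using h by blast
    then show ?thesis
      unfolding xy by (simp only: op[OF h] op[OF x(2)] op[OF y(2)] x(1) y(1) ev eq)
  qed
  show "x \<oplus>\<^bsub>R\<^esub> y \<in> carrier R \<and> unit_op (x \<oplus>\<^bsub>R\<^esub> y) = (unit_op x + unit_op y :: ('x set, 'k) linop)"
    if "x \<in> carrier R" "y \<in> carrier R" for x y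
  proof -
    obtain k f l g where x: "x = (k, coset S f)" "f \<in> ?F" and y: "y = (l, coset S g)" "g \<in> ?F"
      using \<open>x \<in> carrier R\<close> \<open>y \<in> carrier R\<close> unfolding carr by blast
    have h: "f + g \<in> ?F" using x y by (simp add: closed)
    have xy: "x \<oplus>\<^bsub>R\<^esub> y = (k + l, coset S (f + g))"
      using x y by (simp add: R_def unitization_simps ops)
    have "x \<oplus>\<^bsub>R\<^esub> y \<in> carrier R" unfolding carr xy using h by blast
    then show ?thesis
      unfolding xy by (simp only: op[OF h] op[OF x(2)] op[OF y(2)] x(1) y(1) ev scal_add add.assoc add.left_commute)
  qed
  show "c \<odot>\<^bsub>R\<^esub> x \<in> carrier R \<and> unit_op (c \<odot>\<^bsub>R\<^esub> x) = (scal c * unit_op x :: ('x set, 'k) linop)"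
    if "x \<in> carrier R" for c x
  proof -
    obtain k f where x: "x = (k, coset S f)" "f \<in> ?F"
      using \<open>x \<in> carrier R\<close> unfolding carr by blast
    have h: "Poly_Mapping.single 0 c * f \<in> ?F" using x by (simp add: closed)
    have cx: "c \<odot>\<^bsub>R\<^esub> x = (c * k, coset S (Poly_Mapping.single 0 c * f))"
      using x by (simp add: R_def unitization_simps lpa_smult[OF inf x(2) x(2)])
    have "c \<odot>\<^bsub>R\<^esub> x \<in> carrier R" unfolding carr cx using h by blast
    then show ?thesis
      unfolding cx by (simp only: op[OF h] op[OF x(2)] x(1) ev scal_mult distrib_left)
  qed
  show "\<one>\<^bsub>R\<^esub> \<in> carrier R" "\<zero>\<^bsub>R\<^esub> \<in> carrier R"
    by (auto simp: R_def unitization_simps zero lpa_carrier free_algebra_0)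
  show "unit_op \<one>\<^bsub>R\<^esub> = (1 :: ('x set, 'k) linop)" "unit_op \<zero>\<^bsub>R\<^esub> = (0 :: ('x set, 'k) linop)"
    by (simp_all add: R_def unitization_simps zero op[OF free_algebra_0])
  show "bij_betw unit_op (carrier R) (chain_ops ?V :: ('x set, 'k) linop set)"
    unfolding bij_betw_def
  proof
    show "inj_on unit_op (carrier R)"
    proof (rule inj_onI)
      fix x y assume xy: "x \<in> carrier R" "y \<in> carrier R" "unit_op x = unit_op y"
      obtain k f l g where x: "x = (k, coset S f)" "f \<in> ?F" and y: "y = (l, coset S g)" "g \<in> ?F"
        using xy(1,2) unfolding carr by blast
      have eq: "scal k + eval_op f = scal l + eval_op g"
        using xy(3) by (simp only: x(1) y(1) op[OF x(2)] op[OF y(2)])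
      \<comment> \<open>Comparing values at the empty word gives the scalars.\<close>
      have "app (scal k + eval_op f) (\<lambda>_. 1) [] = app (scal l + eval_op g) (\<lambda>_. 1) []"
        by (simp only: eq)
      then have "k = l" by (simp add: app_simps app_eval_op_Nil[OF x(2)] app_eval_op_Nil[OF y(2)])
      moreover from this have "coset S f = coset S g"
        using eq x(2) y(2) by (intro coset_eqI[OF inf]) simp_all
      ultimately show "x = y" by (simp add: x y)
    qed
    show "unit_op ` carrier R = chain_ops ?V"
    proof (intro Set.equalityI subsetI)
      fix a assume "a \<in> unit_op ` carrier R"
      then obtain k f where kf: "f \<in> ?F" "a = unit_op (k, coset S f)" unfolding image_iff Bex_def carr by blast
      then show "a \<in> chain_ops ?V"
        by (auto simp: op[OF kf(1)] intro: chain_ops_add chain_ops_scal eval_op_in_chain_ops)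
    next
      fix a :: "('x set, 'k) linop" assume "a \<in> chain_ops ?V"
      then obtain k f where kf: "f \<in> ?F" "a = scal k + eval_op f" using chain_ops_decomp by blast
      have "a = unit_op (k, coset S f)" using kf(2) op[OF kf(1)] by simp
      moreover have "(k, coset S f) \<in> carrier R" using kf(1) unfolding carr by blast
      ultimately show "a \<in> unit_op ` carrier R" by blast
    qed
  qed
qed

lemma algebra_isomorphic_unitization_lpa:
  assumes "infinite S"
  defines "R \<equiv> unitization (lpa S) :: ('k::field, 'k \<times> ('x gens free_word \<Rightarrow>\<^sub>0 'k) set) module"
    and "A \<equiv> op_algebra (nonempty_finite_subsets S) :: ('k, ('x set, 'k) linop) module"
  shows "algebra_isomorphic R A" "algebra_isomorphic A R" "ring R"
proof -
  note hom = unit_op_hom[OF assms(1), where 'k = 'k, folded R_def]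
  have iso: "unit_op \<in> ring_iso R A"
    using hom bij_betwE[OF hom(1)] by (intro ring_iso_memI) (simp_all add: A_def)
  then show "algebra_isomorphic R A"
    unfolding algebra_isomorphic_def by (intro bexI[of _ unit_op]) (simp_all add: A_def hom(4))
  define j where "j = inv_into (carrier R) (unit_op :: _ \<Rightarrow> ('x set, 'k) linop)"
  have j_unit: "j (unit_op x) = x" if "x \<in> carrier R" for x
    using that hom(1) by (simp add: j_def bij_betw_def inv_into_f_f)
  have j_in: "j a \<in> carrier R" "unit_op (j a) = a" if "a \<in> carrier A" for a
    using that hom(1) by (auto simp: j_def A_def bij_betw_def intro: inv_into_into f_inv_into_f)
  have j: "j \<in> ring_iso A R"
  proof (rule ring_iso_memI)
    show "bij_betw j (carrier A) (carrier R)"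
      unfolding j_def using hom(1) by (simp add: A_def bij_betw_inv_into)
    show "j (a \<otimes>\<^bsub>A\<^esub> b) = j a \<otimes>\<^bsub>R\<^esub> j b" if "a \<in> carrier A" "b \<in> carrier A" for a b
      using hom(2)[OF j_in(1)[OF that(1)] j_in(1)[OF that(2)]] j_in(2) that j_unit[of "j a \<otimes>\<^bsub>R\<^esub> j b"]
      by (simp add: A_def)
    show "j (a \<oplus>\<^bsub>A\<^esub> b) = j a \<oplus>\<^bsub>R\<^esub> j b" if "a \<in> carrier A" "b \<in> carrier A" for a b
      using hom(3)[OF j_in(1)[OF that(1)] j_in(1)[OF that(2)]] j_in(2) that j_unit[of "j a \<oplus>\<^bsub>R\<^esub> j b"]
      by (simp add: A_def)
    show "j \<one>\<^bsub>A\<^esub> = \<one>\<^bsub>R\<^esub>" using j_unit[OF hom(5)] by (simp add: A_def hom(6))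
  qed (rule j_in)
  moreover have "j (c \<odot>\<^bsub>A\<^esub> a) = c \<odot>\<^bsub>R\<^esub> j a" if "a \<in> carrier A" for c a
    using hom(4)[OF j_in(1)[OF that], of c] j_in(2)[OF that] j_unit[of "c \<odot>\<^bsub>R\<^esub> j a"] by (simp add: A_def)
  ultimately show "algebra_isomorphic A R" unfolding algebra_isomorphic_def by blast
  have "ring A" by (simp add: A_def ring_op_algebra)
  then have "ring (R\<lparr>zero := j \<zero>\<^bsub>A\<^esub>\<rparr>)" using j by (rule ring.ring_iso_imp_img_ring)
  moreover have "j \<zero>\<^bsub>A\<^esub> = \<zero>\<^bsub>R\<^esub>" using j_unit[OF hom(7)] by (simp add: A_def hom(8))
  ultimately show "ring R" by simp
qed

section \<open>Conclusion\<close>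

lemma algebra_isomorphic_trans:
  assumes "algebra_isomorphic A B" "algebra_isomorphic B C"
  shows "algebra_isomorphic A C"
proof -
  obtain f g where f: "f \<in> ring_iso A B" "\<And>c x. x \<in> carrier A \<Longrightarrow> f (c \<odot>\<^bsub>A\<^esub> x) = c \<odot>\<^bsub>B\<^esub> f x"
    and g: "g \<in> ring_iso B C" "\<And>c x. x \<in> carrier B \<Longrightarrow> g (c \<odot>\<^bsub>B\<^esub> x) = c \<odot>\<^bsub>C\<^esub> g x"
    using assms unfolding algebra_isomorphic_def by blast
  have "g \<circ> f \<in> ring_iso A C" using f(1) g(1) by (rule ring_iso_set_trans)
  moreover have "(g \<circ> f) (c \<odot>\<^bsub>A\<^esub> x) = c \<odot>\<^bsub>C\<^esub> (g \<circ> f) x" if "x \<in> carrier A" for c x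
    using that f(2) g(2) ring_iso_memE(1)[OF f(1)] by simp
  ultimately show ?thesis unfolding algebra_isomorphic_def by blast
qed

lemma unital_algebra_isomorphic:
  fixes A :: "('k::field, 'a) module" and B :: "('k, 'b) module"
  assumes A: "unital_algebra A" and B: "ring B" and iso: "algebra_isomorphic A B"
  shows "unital_algebra B"
proof -
  obtain j where j: "j \<in> ring_iso A B" and sm: "\<And>c x. x \<in> carrier A \<Longrightarrow> j (c \<odot>\<^bsub>A\<^esub> x) = c \<odot>\<^bsub>B\<^esub> j x"
    using iso unfolding algebra_isomorphic_def by blast
  note jE = ring_iso_memE[OF j]
  interpret A: Module.module "ring_of_type_algebra :: 'k ring" A
    using A by (simp add: unital_algebra_def)
  have RA: "ring A" using A by (simp add: unital_algebra_def)
  let ?K = "ring_of_type_algebra :: 'k ring"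
  have K: "c \<in> carrier ?K" for c by (simp add: ring_of_type_algebra_simps)
  have pre: "\<exists>a\<in>carrier A. x = j a" if "x \<in> carrier B" for x
    using that jE(5) by (auto simp: bij_betw_def)
  note sm_closed = A.smult_closed[OF K]
  have "Module.module ?K B"
  proof (rule moduleI)
    show "cring ?K" by (rule cring_from_type_algebra)
    show "abelian_group B" using B by (rule ring.is_abelian_group)
    fix c d x y assume "x \<in> carrier B"
    then obtain a where a: "a \<in> carrier A" "x = j a" using pre by blast
    show "c \<odot>\<^bsub>B\<^esub> x \<in> carrier B" using jE(1)[OF sm_closed[OF a(1)]] sm[OF a(1)] a(2) by simp
    show "(c \<oplus>\<^bsub>?K\<^esub> d) \<odot>\<^bsub>B\<^esub> x = c \<odot>\<^bsub>B\<^esub> x \<oplus>\<^bsub>B\<^esub> d \<odot>\<^bsub>B\<^esub> x"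
      using A.smult_l_distr[OF K K a(1), of c d] sm[OF a(1)] jE(3)[OF sm_closed[OF a(1)] sm_closed[OF a(1)]]
      by (metis a(2))
    show "(c \<otimes>\<^bsub>?K\<^esub> d) \<odot>\<^bsub>B\<^esub> x = c \<odot>\<^bsub>B\<^esub> (d \<odot>\<^bsub>B\<^esub> x)"
      using A.smult_assoc1[OF K K a(1), of c d] sm[OF a(1)] sm[OF sm_closed[OF a(1)]] by (metis a(2))
    show "\<one>\<^bsub>?K\<^esub> \<odot>\<^bsub>B\<^esub> x = x" using A.smult_one[OF a(1)] sm[OF a(1)] by (metis a(2))
    assume "y \<in> carrier B"
    then obtain b where b: "b \<in> carrier A" "y = j b" using pre by blast
    show "c \<odot>\<^bsub>B\<^esub> (x \<oplus>\<^bsub>B\<^esub> y) = c \<odot>\<^bsub>B\<^esub> x \<oplus>\<^bsub>B\<^esub> c \<odot>\<^bsub>B\<^esub> y"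
      using A.smult_r_distr[OF K a(1) b(1), of c] sm[OF a(1)] sm[OF b(1)] sm[OF ring.ring_simprules(1)[OF RA a(1) b(1)]]
        jE(3)[OF sm_closed[OF a(1)] sm_closed[OF b(1)]] jE(3)[OF a(1) b(1)]
      by (metis a(2) b(2))
  qed
  moreover have "(c \<odot>\<^bsub>B\<^esub> x) \<otimes>\<^bsub>B\<^esub> y = c \<odot>\<^bsub>B\<^esub> (x \<otimes>\<^bsub>B\<^esub> y) \<and> x \<otimes>\<^bsub>B\<^esub> (c \<odot>\<^bsub>B\<^esub> y) = c \<odot>\<^bsub>B\<^esub> (x \<otimes>\<^bsub>B\<^esub> y)"
    if "x \<in> carrier B" "y \<in> carrier B" for c x y
  proof -
    obtain a b where a: "a \<in> carrier A" "x = j a" and b: "b \<in> carrier A" "y = j b"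
      using pre \<open>x \<in> carrier B\<close> \<open>y \<in> carrier B\<close> by metis
    have "(c \<odot>\<^bsub>A\<^esub> a) \<otimes>\<^bsub>A\<^esub> b = c \<odot>\<^bsub>A\<^esub> (a \<otimes>\<^bsub>A\<^esub> b)" "a \<otimes>\<^bsub>A\<^esub> (c \<odot>\<^bsub>A\<^esub> b) = c \<odot>\<^bsub>A\<^esub> (a \<otimes>\<^bsub>A\<^esub> b)"
      using A a(1) b(1) by (auto simp: unital_algebra_def)
    from this[THEN arg_cong[of _ _ j]] show ?thesis
      using monoid.m_closed[OF ring.is_monoid[OF RA] a(1) b(1)] by (simp add: jE(2) a b sm sm_closed)
  qed
  ultimately show ?thesis using B by (simp add: unital_algebra_def)
qed

lemma algebra_isomorphic_op_algebra_lepoll: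
  fixes V :: "'a::order set" and W :: "'b::order set"
  assumes "infinite V"
    and "algebra_isomorphic (op_algebra V :: ('k::field, ('a, 'k) linop) module)
      (op_algebra W :: ('k, ('b, 'k) linop) module)"
  shows "W \<lesssim> V"
proof -
  obtain H where H: "H \<in> ring_iso (op_algebra V :: ('k, ('a, 'k) linop) module)
      (op_algebra W :: ('k, ('b, 'k) linop) module)"
    "\<forall>c. \<forall>x\<in>chain_ops V. H (scal c * x) = scal c * H x"
    using assms(2) unfolding algebra_isomorphic_def by auto
  have "|W| \<le>o |V|"
  proof (rule card_of_surj_chain_ops[OF assms(1)])
    show "H ` chain_ops V = chain_ops W"
      using ring_iso_memE(5)[OF H(1)] by (simp add: bij_betw_def)
    show "H (a + b) = H a + H b" if "a \<in> chain_ops V" "b \<in> chain_ops V" for a b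
      using ring_iso_memE(3)[OF H(1), of a b] that by simp
    show "H (scal c * a) = scal c * H a" if "a \<in> chain_ops V" for c a
      using H(2) that by blast
  qed
  then show ?thesis by (simp add: lepoll_def card_of_ordLeq)
qed

lemma unitization_lpa_properties:
  fixes S :: "'x set"
  assumes "uncountable S"
  defines "R \<equiv> unitization (lpa S) :: ('k::field, 'k \<times> ('x gens free_word \<Rightarrow>\<^sub>0 'k) set) module"
  shows "ring R" "unital_algebra R" "prime_ring R" "\<not> left_primitive TYPE('m) R" "von_neumann_regular R"
proof -
  let ?V = "nonempty_finite_subsets S"
  define A where "A = (op_algebra ?V :: ('k, ('x set, 'k) linop) module)"
  have inf: "infinite S" using assms(1) by (rule uncountable_infinite)
  note iso = algebra_isomorphic_unitization_lpa[OF inf, where 'k = 'k, folded R_def A_def]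
  show R: "ring R" by (rule iso(3))
  have A: "ring A" by (simp add: A_def ring_op_algebra)
  obtain j where j: "j \<in> ring_iso A R" using iso(2) unfolding algebra_isomorphic_def by blast
  show "unital_algebra R"
    using unital_algebra_op_algebra R iso(2) unfolding A_def by (rule unital_algebra_isomorphic)
  have "prime_ring A"
    unfolding A_def using infinite_nonempty_finite_subsets[OF inf] infinite_supersets[OF inf]
      directed_nonempty_finite_subsets by (rule prime_op_algebra)
  with A R j show "prime_ring R" by (rule prime_ring_iso)
  have "\<not> left_primitive TYPE('m) A"
    unfolding A_def using no_countable_cover[OF assms(1)] by (rule not_left_primitive_op_algebra)
  with left_primitive_ring_iso[OF A R j] show "\<not> left_primitive TYPE('m) R" by blast
  have "von_neumann_regular A" unfolding A_def by (rule von_neumann_regular_op_algebra)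
  with j A show "von_neumann_regular R" by (rule von_neumann_regular_ring_iso)
qed

lemma unitization_lpa_isomorphic_lepoll:
  fixes S T :: "'x set"
  assumes inf: "infinite S" "infinite T"
    and iso: "algebra_isomorphic
      (unitization (lpa S) :: ('k::field, 'k \<times> ('x gens free_word \<Rightarrow>\<^sub>0 'k) set) module)
      (unitization (lpa T))"
  shows "T \<lesssim> S"
proof -
  let ?V = nonempty_finite_subsets
  have "algebra_isomorphic (op_algebra (?V S) :: ('k, ('x set, 'k) linop) module) (op_algebra (?V T))"
    using algebra_isomorphic_unitization_lpa(2)[OF inf(1)] iso
      algebra_isomorphic_unitization_lpa(1)[OF inf(2)]
    by (blast intro: algebra_isomorphic_trans)
  then have "?V T \<lesssim> ?V S"
    by (rule algebra_isomorphic_op_algebra_lepoll[OF infinite_nonempty_finite_subsets[OF inf(1)]])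
  then show ?thesis
    using lepoll_nonempty_finite_subsets[of T] nonempty_finite_subsets_lepoll[OF inf(1)]
    by (blast intro: lepoll_trans)
qed

lemma algebra_isomorphic_sym:
  assumes "ring A" "algebra_isomorphic A B" "\<And>c x. x \<in> carrier A \<Longrightarrow> c \<odot>\<^bsub>A\<^esub> x \<in> carrier A"
  shows "algebra_isomorphic B A"
proof -
  obtain j where j: "j \<in> ring_iso A B" and sm: "\<And>c x. x \<in> carrier A \<Longrightarrow> j (c \<odot>\<^bsub>A\<^esub> x) = c \<odot>\<^bsub>B\<^esub> j x"
    using assms(2) unfolding algebra_isomorphic_def by blast
  have inj: "inj_on j (carrier A)" and im: "j ` carrier A = carrier B"
    using ring_iso_memE(5)[OF j] by (auto simp: bij_betw_def)
  have "inv_into (carrier A) j \<in> ring_iso B A" using assms(1) j by (rule ring_iso_set_sym)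
  moreover have "inv_into (carrier A) j (c \<odot>\<^bsub>B\<^esub> x) = c \<odot>\<^bsub>A\<^esub> inv_into (carrier A) j x"
    if "x \<in> carrier B" for c x
  proof -
    obtain a where a: "a \<in> carrier A" "x = j a" using \<open>x \<in> carrier B\<close> unfolding im[symmetric] by blast
    have "c \<odot>\<^bsub>B\<^esub> x = j (c \<odot>\<^bsub>A\<^esub> a)" using sm[OF a(1), of c] a(2) by simp
    then show ?thesis
      by (simp only: a(2) inv_into_f_f[OF inj a(1)] inv_into_f_f[OF inj assms(3)[OF a(1)]])
  qed
  ultimately show ?thesis unfolding algebra_isomorphic_def by blast
qed

theorem theorem5p7:
  fixes S :: "'x set" and Ss :: "'i \<Rightarrow> 'y set" and \<A> :: "'i set"
  shows
    "(uncountable S \<longrightarrow>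
       (let R = unitization (leavitt_path_algebra (finite_subset_graph S) ::
                  ('k::field, ('k, 'x set, 'x set \<times> 'x set) lpa_free set) module)
        in ring R \<and> prime_ring R \<and> \<not> left_primitive TYPE('m) R \<and> von_neumann_regular R))
     \<and>
     ((\<forall>\<alpha>\<in>\<A>. uncountable (Ss \<alpha>)) \<and>
      (\<forall>\<alpha>\<in>\<A>. \<forall>\<beta>\<in>\<A>. \<alpha> \<noteq> \<beta> \<longrightarrow> \<not> Ss \<alpha> \<approx> Ss \<beta>) \<longrightarrow>
       (let R = (\<lambda>\<alpha>. unitization (leavitt_path_algebra (finite_subset_graph (Ss \<alpha>)) ::
                  (complex, (complex, 'y set, 'y set \<times> 'y set) lpa_free set) module))
        in (\<forall>\<alpha>\<in>\<A>. unital_algebra (R \<alpha>) \<and> prime_ring (R \<alpha>) \<and>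
              \<not> left_primitive TYPE('n) (R \<alpha>) \<and> von_neumann_regular (R \<alpha>)) \<and>
           (\<forall>\<alpha>\<in>\<A>. \<forall>\<beta>\<in>\<A>. \<alpha> \<noteq> \<beta> \<longrightarrow> \<not> algebra_isomorphic (R \<alpha>) (R \<beta>))))"
proof (intro conjI impI)
  assume "uncountable S"
  then show "let R = unitization (leavitt_path_algebra (finite_subset_graph S) ::
                  ('k::field, ('k, 'x set, 'x set \<times> 'x set) lpa_free set) module)
        in ring R \<and> prime_ring R \<and> \<not> left_primitive TYPE('m) R \<and> von_neumann_regular R"
    unfolding Let_def by (intro conjI unitization_lpa_properties)
next
  assume *: "(\<forall>\<alpha>\<in>\<A>. uncountable (Ss \<alpha>)) \<and>
      (\<forall>\<alpha>\<in>\<A>. \<forall>\<beta>\<in>\<A>. \<alpha> \<noteq> \<beta> \<longrightarrow> \<not> Ss \<alpha> \<approx> Ss \<beta>)"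
  let ?R = "\<lambda>\<alpha>. unitization (leavitt_path_algebra (finite_subset_graph (Ss \<alpha>)) ::
                  (complex, (complex, 'y set, 'y set \<times> 'y set) lpa_free set) module)"
  have "unital_algebra (?R \<alpha>) \<and> prime_ring (?R \<alpha>) \<and>
      \<not> left_primitive TYPE('n) (?R \<alpha>) \<and> von_neumann_regular (?R \<alpha>)" if "\<alpha> \<in> \<A>" for \<alpha>
  proof -
    have "uncountable (Ss \<alpha>)" using * that by blast
    then show ?thesis by (intro conjI unitization_lpa_properties)
  qed
  moreover have "\<not> algebra_isomorphic (?R \<alpha>) (?R \<beta>)" if "\<alpha> \<in> \<A>" "\<beta> \<in> \<A>" "\<alpha> \<noteq> \<beta>" for \<alpha> \<beta>
  proof
    assume iso: "algebra_isomorphic (?R \<alpha>) (?R \<beta>)"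
    have unc: "uncountable (Ss \<alpha>)" "uncountable (Ss \<beta>)" using * that by blast+
    then have inf: "infinite (Ss \<alpha>)" "infinite (Ss \<beta>)" by (simp_all add: uncountable_infinite)
    have "Module.module (ring_of_type_algebra :: complex ring) (?R \<alpha>)"
      using unitization_lpa_properties(2)[OF unc(1), where 'k = complex] by (simp add: unital_algebra_def)
    then have "c \<odot>\<^bsub>?R \<alpha>\<^esub> x \<in> carrier (?R \<alpha>)" if "x \<in> carrier (?R \<alpha>)" for c x
      using that by (intro module.smult_closed) (auto simp: ring_of_type_algebra_simps)
    with unitization_lpa_properties(1)[OF unc(1)] iso have iso': "algebra_isomorphic (?R \<beta>) (?R \<alpha>)"
      by (rule algebra_isomorphic_sym)
    have "Ss \<beta> \<lesssim> Ss \<alpha>" using inf iso by (rule unitization_lpa_isomorphic_lepoll)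
    moreover have "Ss \<alpha> \<lesssim> Ss \<beta>" using inf(2,1) iso' by (rule unitization_lpa_isomorphic_lepoll)
    ultimately have "Ss \<alpha> \<approx> Ss \<beta>" by (intro lepoll_antisym)
    then show False using * that by blast
  qed
  ultimately show "let R = ?R
        in (\<forall>\<alpha>\<in>\<A>. unital_algebra (R \<alpha>) \<and> prime_ring (R \<alpha>) \<and>
              \<not> left_primitive TYPE('n) (R \<alpha>) \<and> von_neumann_regular (R \<alpha>)) \<and>
           (\<forall>\<alpha>\<in>\<A>. \<forall>\<beta>\<in>\<A>. \<alpha> \<noteq> \<beta> \<longrightarrow> \<not> algebra_isomorphic (R \<alpha>) (R \<beta>))"
    unfolding Let_def by blast
qed

end
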